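(* Let $q$ be a power of a prime $p$ and suppose that there is another prime $r>3$ (so $r\neq p$) such that $r\equiv 3\pmod 4$ and $-p$ is a primitive root modulo $r^2$. Then $\lim_{n\to\infty}\mu_q(n)=1$.
   Context: For a prime power $q$ and a positive integer $n$, the Hamming distance of $g,h:\mathbb{F}_q^n\to\mathbb{F}_q$ is $d(g,h)=\#\{y\in\mathbb{F}_q^n: g(y)\neq h(y)\}$. The nonlinearity of $g:\mathbb{F}_q^n\to\mathbb{F}_q$ is $N(g)=\min_h d(g,h)$, where the minimum is over all $q^{n+1}$ affine functions $h:\mathbb{F}_q^n\to\mathbb{F}_q$ (an $\mathbb{F}_q$-linear functional plus a constant). Let $\rho_q(n)$ be the maximum of $N(g)$ over all functions $g:\mathbb{F}_q^n\to\mathbb{F}_q$, and put \[ \mu_q(n)=\frac{q^{n-1}(q-1)-\rho_q(n)}{q^{n/2-1}}. \] *)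

theory Defs
  imports
    Complex_Main
    "HOL-Library.Cardinality"
    "HOL-Number_Theory.Number_Theory"
    "Jordan_Normal_Form.Matrix"
begin

text \<open>
  The field with \<open>q\<close> elements is a type \<open>'a\<close> of sort \<open>{finite, field}\<close> with \<open>CARD('a) = q\<close>, and its
  \<open>n\<close>-dimensional coordinate space is \<^term>\<open>carrier_vec n :: 'a vec set\<close>. A function on that space
  is represented by a total function on \<^typ>\<open>'a vec\<close>; its values outside \<^term>\<open>carrier_vec n\<close> are
  irrelevant to every definition below.
\<close>

definition hamming_dist :: "nat \<Rightarrow> ('a vec \<Rightarrow> 'a) \<Rightarrow> ('a vec \<Rightarrow> 'a) \<Rightarrow> nat" where
  "hamming_dist n g h = card {y \<in> carrier_vec n. g y \<noteq> h y}"

definition linear_functional :: "nat \<Rightarrow> ('a::field vec \<Rightarrow> 'a) \<Rightarrow> bool" where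
  "linear_functional n f \<longleftrightarrow>
     (\<forall>x\<in>carrier_vec n. \<forall>y\<in>carrier_vec n. f (x + y) = f x + f y) \<and>
     (\<forall>c. \<forall>x\<in>carrier_vec n. f (c \<cdot>\<^sub>v x) = c * f x)"

definition affine_function :: "nat \<Rightarrow> ('a::field vec \<Rightarrow> 'a) \<Rightarrow> bool" where
  "affine_function n h \<longleftrightarrow>
     (\<exists>f c. linear_functional n f \<and> (\<forall>x\<in>carrier_vec n. h x = f x + c))"

definition nonlinearity :: "nat \<Rightarrow> ('a::{finite,field} vec \<Rightarrow> 'a) \<Rightarrow> nat" where
  "nonlinearity n g = Min {hamming_dist n g h | h. affine_function n h}"

definition max_nonlinearity :: "'a::{finite,field} itself \<Rightarrow> nat \<Rightarrow> nat" where
  "max_nonlinearity _ n = Max (range (nonlinearity n :: ('a vec \<Rightarrow> 'a) \<Rightarrow> nat))"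

definition mu :: "'a::{finite,field} itself \<Rightarrow> nat \<Rightarrow> real" where
  "mu F n =
     (real CARD('a) ^ (n - 1) * (real CARD('a) - 1) - real (max_nonlinearity F n))
       / real CARD('a) powr (real n / 2 - 1)"

text \<open>
  The sets under \<^const>\<open>Min\<close> and \<^const>\<open>Max\<close> are finite and nonempty, so that these are a genuine
  minimum and maximum.
\<close>

lemma finite_carrier_vec: "finite (carrier_vec n :: 'a::finite vec set)"
proof -
  have "carrier_vec n \<subseteq> vec_of_list ` {xs :: 'a list. set xs \<subseteq> UNIV \<and> length xs = n}"
  proof
    fix v :: "'a vec" assume "v \<in> carrier_vec n"
    then have "length (list_of_vec v) = n" by simp
    then show "v \<in> vec_of_list ` {xs. set xs \<subseteq> UNIV \<and> length xs = n}"
      by (intro image_eqI[of _ _ "list_of_vec v"]) (simp_all add: vec_list)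
  qed
  then show ?thesis
    by (rule finite_subset) (intro finite_imageI finite_lists_length_eq finite_class.finite_UNIV)
qed

lemma hamming_dist_le:
  fixes g h :: "'a::finite vec \<Rightarrow> 'a"
  shows "hamming_dist n g h \<le> card (carrier_vec n :: 'a vec set)"
  unfolding hamming_dist_def by (rule card_mono[OF finite_carrier_vec]) auto

lemma affine_function_zero: "affine_function n (\<lambda>_. 0)"
  unfolding affine_function_def linear_functional_def
  by (rule exI[of _ "\<lambda>_. 0"], rule exI[of _ 0]) simp

lemma nonlinearity_set:
  fixes g :: "'a::{finite,field} vec \<Rightarrow> 'a"
  shows "finite {hamming_dist n g h | h. affine_function n h}"
    and "{hamming_dist n g h | h. affine_function n h} \<noteq> {}"
proof -
  have "{hamming_dist n g h | h. affine_function n h} \<subseteq> {..card (carrier_vec n :: 'a vec set)}"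
    by (auto simp: hamming_dist_le)
  then show "finite {hamming_dist n g h | h. affine_function n h}"
    by (rule finite_subset) simp
  show "{hamming_dist n g h | h. affine_function n h} \<noteq> {}"
    using affine_function_zero[of n] by auto
qed

lemma finite_range_nonlinearity:
  "finite (range (nonlinearity n :: ('a::{finite,field} vec \<Rightarrow> 'a) \<Rightarrow> nat))"
proof -
  have "nonlinearity n g \<le> card (carrier_vec n :: 'a vec set)" for g :: "'a vec \<Rightarrow> 'a"
  proof -
    obtain h where "nonlinearity n g = hamming_dist n g h"
      using Min_in[OF nonlinearity_set[of n g]] unfolding nonlinearity_def by blast
    then show ?thesis by (simp add: hamming_dist_le)
  qed
  then have "range (nonlinearity n :: ('a vec \<Rightarrow> 'a) \<Rightarrow> nat) \<subseteq> {..card (carrier_vec n :: 'a vec set)}"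
    by blast
  then show ?thesis by (rule finite_subset) simp
qed

text \<open>
  \<^const>\<open>residue_primroot\<close> takes a natural number, so an integer is replaced by its
  least nonnegative residue.
\<close>

definition int_primroot :: "nat \<Rightarrow> int \<Rightarrow> bool" where
  "int_primroot m a \<longleftrightarrow> residue_primroot m (nat (a mod int m))"

end

theory Submission
  imports Defs "HOL-Algebra.Algebraic_Closure_Type" "Jordan_Normal_Form.Determinant"
begin

text \<open>
  A second moment argument gives \<open>mu \<ge> 1\<close>, and in even dimension quadratic forms show that this is
  asymptotically sharp. For odd dimension take \<open>F\<close> to be the field with \<open>Q = q\<^sup>f\<close> elements, \<open>f\<close> odd, and \<open>v = r\<^sup>N\<close> a
  divisor of \<open>(Q - 1) / (q - 1)\<close>; both exist because \<open>r \<equiv> 3 (mod 4)\<close> and \<open>-p\<close> is a primitive root, which make the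
  order of \<open>p\<close> modulo \<open>v\<close> odd. Functions on the space of \<open>n \<times> n\<close> matrices over \<open>F\<close> that depend only on the class
  of the determinant modulo \<open>v\<close>-th powers have Fourier coefficients given by the Gauss sums \<open>G(\<theta>)\<^sup>n\<close> of the
  characters \<open>\<theta>\<close> of order dividing \<open>v\<close>, and these coefficients have nearly minimal size once all normalised
  powers \<open>(-G(\<theta>) / \<surd>Q)\<^sup>n\<close> are close to \<open>1\<close>. The numbers \<open>-G(\<theta>) / \<surd>Q\<close> lie in a group of complex numbers of
  absolute value one that does not contain \<open>-1\<close> (a Galois descent and a congruence modulo \<open>r\<close>), and a
  Kronecker type argument then provides an odd \<open>n\<close> with this property. The resulting function is defined outside
  a sparse set; adding an even number of variables and a bent function completes it and reaches all large odd
  dimensions.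
\<close>

no_notation fps_nth (infixl \<open>$\<close> 75)
hide_const (open) Divisibility.prime

section \<open>Nonlinearity and extension by quadratic forms\<close>

text \<open>The second moment bound dictates the sign. For a fixed linear part the q deviations sum
  to zero, and for a given sum of squares the largest is smallest when q - 1 of them are equal and
  positive and one is very negative. Determinant classes have this profile when the normalised sums
  enter with a minus sign, which is why -G(\<theta>) and not G(\<theta>) has to be steered to 1;
  anisotropic planes have it too, and a split quadratic form in further variables preserves it. Over
  the field itself the phases of the Gauss sums are given. Matrices raise them to the n-th power
  while Q and v stay fixed, so n is a free parameter; it must be odd, to keep both the sign and the
  parity of the dimension f n^2, and -1 is then the obstruction to reaching 1. Only the characters
  with index 0 < c < v have to be aligned: the trivial one adds a term common to all classes, and a
  labelling of the classes that uses each value equally often cancels it. N is large because the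
  singular matrices and the at most q - 1 classes left over by this labelling must be a small
  fraction of the space.\<close>

lemma card_carrier_vec: "card (carrier_vec n :: 'a::finite vec set) = CARD('a) ^ n"
proof -
  have "bij_betw (vec n) (PiE {..<n} (\<lambda>_. UNIV)) (carrier_vec n :: 'a vec set)"
  proof (rule bij_betw_byWitness[where f' = "\<lambda>v. restrict (($) v) {..<n}"])
    show "\<forall>f\<in>{..<n} \<rightarrow>\<^sub>E UNIV. restrict (($) (vec n f)) {..<n} = f"
      by (auto simp: fun_eq_iff PiE_def extensional_def restrict_def)
    show "\<forall>v\<in>carrier_vec n. vec n (restrict (($) v) {..<n}) = (v :: 'a vec)"
      by (auto simp: vec_eq_iff)
    show "vec n ` ({..<n} \<rightarrow>\<^sub>E UNIV) \<subseteq> (carrier_vec n :: 'a vec set)"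
      by (intro image_subsetI vec_carrier)
    show "(\<lambda>v. restrict (($) v) {..<n}) ` (carrier_vec n :: 'a vec set) \<subseteq> {..<n} \<rightarrow>\<^sub>E UNIV"
      by (auto split: if_splits)
  qed
  then have "card (carrier_vec n :: 'a vec set) = card (PiE {..<n} (\<lambda>_. UNIV :: 'a set))"
    by (rule bij_betw_same_card[symmetric])
  then show ?thesis by (simp add: card_PiE)
qed

lemma card_field_gt_1: "CARD('a::{finite,field}) > 1"
proof -
  have "card {0, 1 :: 'a} \<le> CARD('a)" by (rule card_mono) auto
  then show ?thesis by simp
qed

lemma linear_functional_scalar_prod:
  fixes f :: "'a::field vec \<Rightarrow> 'a"
  assumes "linear_functional n f"
  obtains u where "u \<in> carrier_vec n" "\<And>x. x \<in> carrier_vec n \<Longrightarrow> f x = u \<bullet> x"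
proof
  let ?u = "vec n (\<lambda>i. f (unit_vec n i))"
  show "?u \<in> carrier_vec n" by simp
  fix x :: "'a vec" assume x: "x \<in> carrier_vec n"
  have add: "f (a + b) = f a + f b" if "a \<in> carrier_vec n" "b \<in> carrier_vec n" for a b
    using assms that unfolding linear_functional_def by blast
  have smult: "f (c \<cdot>\<^sub>v a) = c * f a" if "a \<in> carrier_vec n" for c a
    using assms that unfolding linear_functional_def by blast
  \<comment> \<open>Truncations of x: the induction releases one coordinate at a time.\<close>
  let ?t = "\<lambda>k. vec n (\<lambda>i. if i < k then x $ i else 0)"
  have "f (?t k) = (\<Sum>i<k. f (unit_vec n i) * x $ i)" if "k \<le> n" for k
    using that
  proof (induction k)
    case 0
    have "f (0 \<cdot>\<^sub>v ?t 0) = 0 * f (?t 0)" by (rule smult) simp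
    moreover have "0 \<cdot>\<^sub>v ?t 0 = ?t 0" by (rule eq_vecI) auto
    ultimately show ?case by simp
  next
    case (Suc k)
    have "?t (Suc k) = ?t k + x $ k \<cdot>\<^sub>v unit_vec n k"
      using Suc.prems by (intro eq_vecI) (auto simp: less_Suc_eq)
    then have "f (?t (Suc k)) = f (?t k) + x $ k * f (unit_vec n k)"
      by (simp add: add smult)
    then show ?case using Suc by simp
  qed
  from this[of n] have "f (?t n) = ?u \<bullet> x"
    using x by (simp add: scalar_prod_def lessThan_atLeast0)
  moreover have "?t n = x" using x by (intro eq_vecI) auto
  ultimately show "f x = ?u \<bullet> x" by simp
qed

lemma affine_function_scalar_prod:
  assumes "u \<in> carrier_vec n" shows "affine_function n (\<lambda>x. u \<bullet> x + c)"
  unfolding affine_function_def linear_functional_def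
  by (rule exI[of _ "\<lambda>x. u \<bullet> x"], rule exI[of _ c])
    (use assms in \<open>auto simp: scalar_prod_add_distrib\<close>)

lemma hamming_dist_eq:
  fixes g h :: "'a::finite vec \<Rightarrow> 'a"
  shows "real (hamming_dist n g h) = real CARD('a) ^ n - card {x \<in> carrier_vec n. g x = h x}"
proof -
  have "card (carrier_vec n :: 'a vec set) = card {x \<in> carrier_vec n. g x = h x} + hamming_dist n g h"
    unfolding hamming_dist_def
    by (subst card_Un_disjoint[symmetric])
      (auto intro: finite_subset[OF _ finite_carrier_vec[of n]] arg_cong[where f = card])
  then have "CARD('a) ^ n = card {x \<in> carrier_vec n. g x = h x} + hamming_dist n g h"
    by (simp add: card_carrier_vec)
  then have "real (CARD('a) ^ n) = real (card {x \<in> carrier_vec n. g x = h x} + hamming_dist n g h)"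
    by (rule arg_cong)
  then show ?thesis by simp
qed

lemma nonlinearity_le:
  fixes g :: "'a::{finite,field} vec \<Rightarrow> 'a"
  assumes "u \<in> carrier_vec n"
  shows "real (nonlinearity n g) \<le> real CARD('a) ^ n - card {x \<in> carrier_vec n. g x = u \<bullet> x + c}"
proof -
  have "nonlinearity n g \<le> hamming_dist n g (\<lambda>x. u \<bullet> x + c)"
    unfolding nonlinearity_def
    by (rule Min_le[OF nonlinearity_set(1)]) (use affine_function_scalar_prod[OF assms] in blast)
  then show ?thesis unfolding hamming_dist_eq[symmetric] by simp
qed

lemma nonlinearity_ge:
  fixes g :: "'a::{finite,field} vec \<Rightarrow> 'a"
  assumes "\<And>u c. u \<in> carrier_vec n \<Longrightarrow> real (card {x \<in> carrier_vec n. g x = u \<bullet> x + c}) \<le> A"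
  shows "real CARD('a) ^ n - A \<le> real (nonlinearity n g)"
proof -
  obtain h where h: "nonlinearity n g = hamming_dist n g h" "affine_function n h"
    using Min_in[OF nonlinearity_set[of n g]] unfolding nonlinearity_def by blast
  then obtain f c where f: "linear_functional n f" "\<And>x. x \<in> carrier_vec n \<Longrightarrow> h x = f x + c"
    unfolding affine_function_def by blast
  obtain u where u: "u \<in> carrier_vec n" "\<And>x. x \<in> carrier_vec n \<Longrightarrow> f x = u \<bullet> x"
    using linear_functional_scalar_prod[OF f(1)] by blast
  have "{x \<in> carrier_vec n. g x = h x} = {x \<in> carrier_vec n. g x = u \<bullet> x + c}"
    using f(2) u(2) by auto
  then show ?thesis unfolding h(1) hamming_dist_eq using assms[OF u(1), of c] by simp
qed

text \<open>All fibres of u \<mapsto> u . z are translates of one another, by multiples of the unit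
  vector at a coordinate where z does not vanish. The product form avoids the exponent n -
  1.\<close>

lemma card_scalar_prod_eq:
  fixes z :: "'a::{finite,field} vec"
  assumes z: "z \<in> carrier_vec n" "z \<noteq> 0\<^sub>v n"
  shows "CARD('a) * card {u \<in> carrier_vec n. u \<bullet> z = t} = CARD('a) ^ n"
proof -
  obtain j where j: "j < n" "z $ j \<noteq> 0" using z by (auto simp: vec_eq_iff)
  let ?S = "\<lambda>t. {u \<in> carrier_vec n. u \<bullet> z = t}"
  have fin: "finite (?S t)" for t by (rule finite_subset[OF _ finite_carrier_vec[of n]]) auto
  have card_eq: "card (?S t) = card (?S 0)" for t
  proof (rule bij_betw_same_card, rule bij_betw_byWitness)
    let ?d = "(t / z $ j) \<cdot>\<^sub>v unit_vec n j"
    have d: "?d \<in> carrier_vec n" by simp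
    have "?d \<bullet> z = t / z $ j * (unit_vec n j \<bullet> z)" by (rule smult_scalar_prod_distrib[of _ n]) (use z in auto)
    then have dz: "?d \<bullet> z = t" using z j by (simp add: scalar_prod_left_unit)
    show "\<forall>u\<in>?S t. (u - ?d) + ?d = u" "\<forall>u\<in>?S 0. (u + ?d) - ?d = u"
      using d by (auto intro!: eq_vecI)
    show "(\<lambda>u. u - ?d) ` ?S t \<subseteq> ?S 0" "(\<lambda>u. u + ?d) ` ?S 0 \<subseteq> ?S t"
      using d dz z by (auto simp: add_scalar_prod_distrib[of _ n] minus_scalar_prod_distrib[of _ n])
  qed
  have "(carrier_vec n :: 'a vec set) = (\<Union>t. ?S t)" by auto
  then have "CARD('a) ^ n = card (\<Union>t. ?S t)" using card_carrier_vec[of n, where 'a = 'a] by simp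
  also have "\<dots> = (\<Sum>t\<in>UNIV. card (?S t))" by (rule card_UN_disjoint) (use fin in auto)
  also have "\<dots> = (\<Sum>t\<in>(UNIV :: 'a set). card (?S 0))" by (rule sum.cong[OF refl card_eq])
  also have "\<dots> = CARD('a) * card (?S 0)" by simp
  finally show ?thesis using card_eq[of t] by simp
qed

section \<open>Lower bound: a large second moment forces a large agreement\<close>

lemma sum_sq_le_max_dev:
  fixes D :: "'a::finite \<Rightarrow> real"
  assumes "(\<Sum>c\<in>UNIV. D c) = 0" "\<And>c. D c \<le> M"
  shows "(\<Sum>c\<in>UNIV. (D c)\<^sup>2) \<le> real CARD('a) * (real CARD('a) - 1) * M\<^sup>2"
proof -
  \<comment> \<open>The numbers M - D c are nonnegative with sum q M, so their squares add up to at
    most (q M)^2. Equality holds when a single D c differs from M.\<close>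
  have "(\<Sum>c\<in>UNIV. (M - D c)\<^sup>2) \<le> (\<Sum>c\<in>UNIV. (M - D c) * (\<Sum>d\<in>UNIV. M - D d))"
    unfolding power2_eq_square
  proof (intro sum_mono mult_left_mono)
    fix c show "M - D c \<le> (\<Sum>d\<in>UNIV. M - D d)"
      by (rule member_le_sum) (use assms in auto)
  qed (use assms in auto)
  also have "\<dots> = (real CARD('a) * M)\<^sup>2"
    unfolding sum_distrib_right[symmetric] by (simp add: sum_subtractf assms(1) power2_eq_square)
  also have "(\<Sum>c\<in>UNIV. (M - D c)\<^sup>2) = real CARD('a) * M\<^sup>2 - 2 * M * (\<Sum>c\<in>UNIV. D c) + (\<Sum>c\<in>UNIV. (D c)\<^sup>2)"
    unfolding power2_diff by (simp add: sum.distrib sum_subtractf mult.assoc mult.left_commute flip: sum_distrib_left)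
  finally show ?thesis using assms(1) by (simp add: power2_eq_square algebra_simps)
qed

lemma sum_sq_dev:
  fixes N :: "'b::finite \<Rightarrow> real"
  shows "(\<Sum>c\<in>UNIV. (N c - k)\<^sup>2) = (\<Sum>c\<in>UNIV. (N c)\<^sup>2) - 2 * (\<Sum>c\<in>UNIV. N c) * k + real CARD('b) * k\<^sup>2"
  unfolding power2_diff by (simp add: sum.distrib sum_subtractf flip: sum_distrib_left sum_distrib_right)

lemma sum_of_bool_card: "finite A \<Longrightarrow> (\<Sum>x\<in>A. of_bool (P x)) = real (card {x \<in> A. P x})"
  by (simp add: sum.inter_filter[symmetric] of_bool_def)

text \<open>Each x agrees with exactly one shift of l, namely c = g x - l x, so the counts partition
  V and their squares count the pairs on which g - l takes equal values.\<close>

lemma agreement_moments: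
  fixes g l :: "'b \<Rightarrow> 'a::{finite,field}"
  assumes "finite V"
  defines "N \<equiv> \<lambda>c. real (card {x \<in> V. g x = l x + c})"
  shows "(\<Sum>c\<in>UNIV. N c) = card V"
    and "(\<Sum>c\<in>UNIV. (N c)\<^sup>2) = (\<Sum>x\<in>V. \<Sum>y\<in>V. of_bool (g x - l x = g y - l y))"
proof -
  have N_sum: "N c = (\<Sum>x\<in>V. of_bool (g x = l x + c))" for c
    unfolding N_def sum_of_bool_card[OF assms(1)] ..
  have eq: "g x = l x + c \<longleftrightarrow> c = g x - l x" for x c by auto
  have one: "(\<Sum>c\<in>UNIV. of_bool (g x = l x + c)) = (1::real)" for x
    unfolding eq by (simp add: of_bool_def)
  show "(\<Sum>c\<in>UNIV. N c) = card V"
    unfolding N_sum by (subst sum.swap) (simp add: one)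
  have two: "(\<Sum>c\<in>UNIV. of_bool (g x = l x + c) * of_bool (g y = l y + c) :: real) =
      of_bool (g x - l x = g y - l y)" for x y
  proof -
    have "(\<Sum>c\<in>UNIV. of_bool (g x = l x + c) * of_bool (g y = l y + c) :: real) =
        (\<Sum>c\<in>UNIV. if c = g x - l x then of_bool (g x - l x = g y - l y) else 0)"
      unfolding eq by (intro sum.cong refl) auto
    then show ?thesis by simp
  qed
  have "(\<Sum>c\<in>UNIV. (N c)\<^sup>2) = (\<Sum>c\<in>UNIV. \<Sum>x\<in>V. \<Sum>y\<in>V. of_bool (g x = l x + c) * of_bool (g y = l y + c))"
    by (simp only: N_sum power2_eq_square sum_product)
  also have "\<dots> = (\<Sum>x\<in>V. \<Sum>c\<in>UNIV. \<Sum>y\<in>V. of_bool (g x = l x + c) * of_bool (g y = l y + c))"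
    by (rule sum.swap)
  also have "\<dots> = (\<Sum>x\<in>V. \<Sum>y\<in>V. \<Sum>c\<in>UNIV. of_bool (g x = l x + c) * of_bool (g y = l y + c))"
    by (intro sum.cong[OF refl]) (rule sum.swap)
  finally show "(\<Sum>c\<in>UNIV. (N c)\<^sup>2) = (\<Sum>x\<in>V. \<Sum>y\<in>V. of_bool (g x - l x = g y - l y))"
    by (simp only: two)
qed

text \<open>For x \<noteq> y the condition is one nontrivial linear equation on u with coefficient
  vector x - y. The function g enters only through the right-hand side, which is why the total
  second moment does not depend on g.\<close>

lemma card_linear_coincidence:
  fixes g :: "'a::{finite,field} vec \<Rightarrow> 'a"
  assumes n: "n > 0" and x: "x \<in> carrier_vec n" and y: "y \<in> carrier_vec n"
  shows "(\<Sum>u\<in>carrier_vec n. of_bool (g x - u \<bullet> x = g y - u \<bullet> y)) =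
    (if x = y then real CARD('a) ^ n else real CARD('a) ^ (n - 1))"
proof (cases "x = y")
  case False
  have "(g x - u \<bullet> x = g y - u \<bullet> y) = (u \<bullet> (x - y) = g x - g y)" if "u \<in> carrier_vec n" for u
    using that x y by (auto simp: scalar_prod_minus_distrib[of _ n] algebra_simps)
  then have "(\<Sum>u\<in>carrier_vec n. of_bool (g x - u \<bullet> x = g y - u \<bullet> y)) =
      (\<Sum>u\<in>carrier_vec n. of_bool (u \<bullet> (x - y) = g x - g y) :: real)"
    by (intro sum.cong refl) simp
  also have "\<dots> = real (card {u \<in> carrier_vec n. u \<bullet> (x - y) = g x - g y})"
    by (rule sum_of_bool_card[OF finite_carrier_vec])
  also have "\<dots> = real CARD('a) ^ (n - 1)"
  proof -
    have "x - y \<noteq> 0\<^sub>v n"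
    proof
      assume *: "x - y = 0\<^sub>v n"
      have "x = y"
      proof (rule eq_vecI)
        fix i assume "i < dim_vec y"
        then have "(x - y) $ i = 0" using y unfolding * by simp
        then show "x $ i = y $ i" using x y \<open>i < dim_vec y\<close> by simp
      qed (use x y in simp)
      then show False using False by simp
    qed
    then have "CARD('a) * card {u \<in> carrier_vec n. u \<bullet> (x - y) = g x - g y} = CARD('a) ^ n"
      using card_scalar_prod_eq[of "x - y" n] x y by simp
    also have "\<dots> = CARD('a) * CARD('a) ^ (n - 1)" using n by (cases n) auto
    finally show ?thesis using card_field_gt_1[where 'a = 'a] by simp
  qed
  finally show ?thesis using False by simp
next
  case True
  have "(\<Sum>u\<in>carrier_vec n. of_bool (g y - u \<bullet> y = g y - u \<bullet> y)) = (\<Sum>u\<in>(carrier_vec n :: 'a vec set). 1 :: real)"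
    by (rule sum.cong) simp_all
  also have "\<dots> = real CARD('a) ^ n" by (simp add: card_carrier_vec)
  finally show ?thesis unfolding True by simp
qed

text \<open>
  The second moment of the agreement counts over all affine functions is the same for every \<open>g\<close>; for
  each linear part the deviations from the mean sum to zero, so that a large second moment forces a
  large positive deviation.
\<close>

lemma exists_affine_agreement:
  fixes g :: "'a::{finite,field} vec \<Rightarrow> 'a"
  assumes n: "n > 0"
  shows "\<exists>u c. u \<in> carrier_vec n \<and> real CARD('a) ^ (n - 1) + real CARD('a) powr (real n / 2 - 1) \<le>
    real (card {x \<in> carrier_vec n. g x = u \<bullet> x + c})"
proof (rule ccontr)
  define q V where "q = real CARD('a)" and "V = (carrier_vec n :: 'a vec set)"
  define N where "N = (\<lambda>u c. real (card {x \<in> V. g x = u \<bullet> x + c}))"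
  define D where "D = (\<lambda>u c. N u c - q ^ (n - 1))"
  have q1: "q > 1" using card_field_gt_1[where 'a = 'a] unfolding q_def by simp
  have fin: "finite V" unfolding V_def by (rule finite_carrier_vec)
  have cV: "real (card V) = q ^ n" unfolding V_def q_def by (simp add: card_carrier_vec)
  have ne: "V \<noteq> {}" unfolding V_def using zero_carrier_vec by blast
  have qn: "q * q ^ (n - 1) = q ^ n" using n by (cases n) auto
  assume "\<nexists>u c. u \<in> carrier_vec n \<and> real CARD('a) ^ (n - 1) + real CARD('a) powr (real n / 2 - 1) \<le>
    real (card {x \<in> carrier_vec n. g x = u \<bullet> x + c})"
  then have "\<not> (q ^ (n - 1) + q powr (real n / 2 - 1) \<le> N u c)" if "u \<in> V" for u c
    using that unfolding V_def N_def q_def by blast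
  then have less: "D u c < q powr (real n / 2 - 1)" if "u \<in> V" for u c
    using that unfolding D_def by (simp add: not_le diff_less_eq add.commute)
  have N1: "(\<Sum>c\<in>UNIV. N u c) = q ^ n" for u
    unfolding N_def agreement_moments(1)[OF fin] by (rule cV)
  have N2: "(\<Sum>c\<in>UNIV. (N u c)\<^sup>2) = (\<Sum>x\<in>V. \<Sum>y\<in>V. of_bool (g x - u \<bullet> x = g y - u \<bullet> y))" for u
    unfolding N_def by (rule agreement_moments(2)[OF fin])
  have "(\<Sum>u\<in>V. \<Sum>c\<in>UNIV. (N u c)\<^sup>2) = (\<Sum>x\<in>V. \<Sum>u\<in>V. \<Sum>y\<in>V. of_bool (g x - u \<bullet> x = g y - u \<bullet> y))"
    unfolding N2 by (rule sum.swap)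
  also have "\<dots> = (\<Sum>x\<in>V. \<Sum>y\<in>V. \<Sum>u\<in>V. of_bool (g x - u \<bullet> x = g y - u \<bullet> y))"
    by (rule sum.cong[OF refl], rule sum.swap)
  also have "\<dots> = (\<Sum>x\<in>V. \<Sum>y\<in>V. if x = y then q ^ n else q ^ (n - 1))"
    unfolding V_def q_def by (intro sum.cong[OF refl] card_linear_coincidence[OF n])
  also have "\<dots> = (\<Sum>x\<in>V. \<Sum>y\<in>V. q ^ (n - 1) + (if x = y then q ^ n - q ^ (n - 1) else 0))"
    by (intro sum.cong refl) auto
  also have "\<dots> = q ^ n * (q ^ n * q ^ (n - 1) + (q ^ n - q ^ (n - 1)))"
    using fin by (simp add: sum.distrib cV)
  finally have NN: "(\<Sum>u\<in>V. \<Sum>c\<in>UNIV. (N u c)\<^sup>2) = q ^ n * (q ^ n * q ^ (n - 1) + (q ^ n - q ^ (n - 1)))" .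
  have DD: "(\<Sum>c\<in>UNIV. (D u c)\<^sup>2) = (\<Sum>c\<in>UNIV. (N u c)\<^sup>2) - q ^ n * q ^ (n - 1)" for u
    using sum_sq_dev[of "N u" "q ^ (n - 1)"] qn
    unfolding D_def q_def[symmetric] N1 by (simp add: power2_eq_square mult.assoc[symmetric])
  have "(\<Sum>u\<in>V. \<Sum>c\<in>UNIV. (D u c)\<^sup>2) = q ^ n * (q ^ n - q ^ (n - 1))"
    unfolding DD sum_subtractf NN by (simp add: cV algebra_simps)
  also have "q ^ n - q ^ (n - 1) = q ^ (n - 1) * (q - 1)" unfolding qn[symmetric] by (simp add: algebra_simps)
  finally have DV: "(\<Sum>u\<in>V. \<Sum>c\<in>UNIV. (D u c)\<^sup>2) = q ^ n * (q ^ (n - 1) * (q - 1))" .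
  \<comment> \<open>The maximum over the finitely many pairs is attained, so the assumed strict
    inequality passes to M and contradicts the non-strict bound that the second moment
    gives.\<close>
  define M where "M = Max ((\<lambda>(u, c). D u c) ` (V \<times> UNIV))"
  have M_in: "M \<in> (\<lambda>(u, c). D u c) ` (V \<times> UNIV)" unfolding M_def using fin ne by (intro Max_in) auto
  have M_ge: "D u c \<le> M" if "u \<in> V" for u c
    unfolding M_def by (rule Max_ge) (use fin that in auto)
  have M_less: "M < q powr (real n / 2 - 1)" using M_in less by auto
  have D0: "(\<Sum>c\<in>UNIV. D u c) = 0" for u
    unfolding D_def sum_subtractf N1 using qn unfolding q_def by simp
  have M0: "M \<ge> 0"
  proof -
    obtain u where u: "u \<in> V" using ne by blast
    have "0 = (\<Sum>c\<in>UNIV. D u c)" using D0 by simp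
    also have "\<dots> \<le> (\<Sum>c\<in>(UNIV::'a set). M)" using M_ge[OF u] by (intro sum_mono) auto
    also have "\<dots> = q * M" unfolding q_def by simp
    finally show ?thesis using q1 by (simp add: zero_le_mult_iff)
  qed
  have "q ^ n * (q ^ (n - 1) * (q - 1)) \<le> (\<Sum>u\<in>V. q * (q - 1) * M\<^sup>2)"
    unfolding DV[symmetric]
    by (rule sum_mono, unfold q_def, rule sum_sq_le_max_dev[OF D0 M_ge])
  also have "\<dots> = q ^ n * (q * (q - 1) * M\<^sup>2)" by (simp add: cV)
  finally have "q ^ (n - 1) * (q - 1) \<le> q * (q - 1) * M\<^sup>2"
    using q1 by (simp only: mult_le_cancel_left_pos zero_less_power)
  then have "(q - 1) * q ^ (n - 1) \<le> (q - 1) * (q * M\<^sup>2)" by (simp only: mult_ac)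
  then have "q ^ (n - 1) \<le> q * M\<^sup>2" using q1 by (simp only: mult_le_cancel_left_pos)
  also have "\<dots> < q * (q powr (real n / 2 - 1))\<^sup>2"
    using M_less M0 q1 by (intro mult_strict_left_mono power_strict_mono) auto
  also have "(q powr (real n / 2 - 1))\<^sup>2 = q powr (real n - 2)"
    by (simp add: power2_eq_square powr_add[symmetric])
  also have "q * q powr (real n - 2) = q powr (real n - 1)"
    using q1 by (simp add: powr_mult_base)
  also have "\<dots> = q powr real (n - 1)" using n by (simp add: of_nat_diff)
  also have "\<dots> = q ^ (n - 1)" using q1 by (intro powr_realpow) auto
  finally show False by simp
qed

lemma max_nonlinearity_ge: "nonlinearity n (g :: 'a::{finite,field} vec \<Rightarrow> 'a) \<le> max_nonlinearity TYPE('a) n"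
  unfolding max_nonlinearity_def by (rule Max_ge[OF finite_range_nonlinearity]) simp

lemma max_nonlinearity_attained:
  obtains g :: "'a::{finite,field} vec \<Rightarrow> 'a" where "max_nonlinearity TYPE('a) n = nonlinearity n g"
proof -
  have "max_nonlinearity TYPE('a) n \<in> range (nonlinearity n :: ('a vec \<Rightarrow> 'a) \<Rightarrow> nat)"
    unfolding max_nonlinearity_def by (rule Max_in[OF finite_range_nonlinearity]) simp
  then show ?thesis using that by blast
qed

lemma mu_ge_1:
  assumes "n > 0" shows "mu TYPE('a::{finite,field}) n \<ge> 1"
proof -
  let ?q = "real CARD('a)"
  have q1: "?q > 1" using card_field_gt_1[where 'a = 'a] by simp
  obtain g :: "'a vec \<Rightarrow> 'a" where g: "max_nonlinearity TYPE('a) n = nonlinearity n g"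
    by (rule max_nonlinearity_attained)
  obtain u :: "'a vec" and c where u: "u \<in> carrier_vec n"
    "real (card {x \<in> carrier_vec n. g x = u \<bullet> x + c}) \<ge> ?q ^ (n - 1) + ?q powr (real n / 2 - 1)"
    using exists_affine_agreement[OF assms, of g] by blast
  have "real (nonlinearity n g) \<le> ?q ^ n - (?q ^ (n - 1) + ?q powr (real n / 2 - 1))"
    using nonlinearity_le[OF u(1), of g c] u(2) by simp
  moreover have "?q ^ n = ?q ^ (n - 1) * ?q" using assms by (cases n) auto
  ultimately have "?q powr (real n / 2 - 1) \<le> ?q ^ (n - 1) * (?q - 1) - real (nonlinearity n g)"
    by (simp add: algebra_simps)
  then show ?thesis unfolding mu_def g using q1 by (simp add: pos_le_divide_eq)
qed

text \<open>The mean agreement is written q^n / q, the shape in which it comes out of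
  \<open>bent_extension\<close>, so that A is exactly the excess over the mean.\<close>

lemma mu_le:
  fixes g :: "'a::{finite,field} vec \<Rightarrow> 'a"
  assumes n: "n > 0"
    and A: "\<And>u c. u \<in> carrier_vec n \<Longrightarrow>
      real (card {x \<in> carrier_vec n. g x = u \<bullet> x + c}) \<le> real CARD('a) ^ n / real CARD('a) + A"
  shows "mu TYPE('a) n \<le> A / real CARD('a) powr (real n / 2 - 1)"
proof -
  let ?q = "real CARD('a)"
  have q1: "?q > 1" using card_field_gt_1[where 'a = 'a] by simp
  have "?q ^ n - (?q ^ n / ?q + A) \<le> real (nonlinearity n g)" by (rule nonlinearity_ge[OF A])
  also have "\<dots> \<le> real (max_nonlinearity TYPE('a) n)" using max_nonlinearity_ge by simp
  also have "?q ^ n = ?q * ?q ^ (n - 1)" using n by (cases n) auto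
  finally have "?q ^ (n - 1) * (?q - 1) - real (max_nonlinearity TYPE('a) n) \<le> A"
    using q1 by (simp add: algebra_simps)
  then show ?thesis unfolding mu_def using q1 by (simp add: divide_right_mono)
qed

section \<open>Splitting the variables and adding a bent summand\<close>

lemma bij_betw_append_vec:
  "bij_betw (\<lambda>(x, y). x @\<^sub>v y) (carrier_vec n \<times> carrier_vec m) (carrier_vec (n + m) :: 'a vec set)"
proof (rule bij_betw_byWitness[where f' = "\<lambda>z. (vec_first z n, vec_last z m)"])
  show "\<forall>a\<in>carrier_vec n \<times> carrier_vec m. (vec_first (case a of (x, y) \<Rightarrow> x @\<^sub>v y) n, vec_last (case a of (x, y) \<Rightarrow> x @\<^sub>v y) m) = (a :: 'a vec \<times> 'a vec)"
    by (auto simp: vec_first_def vec_last_def vec_eq_iff)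
  show "\<forall>a'\<in>carrier_vec (n + m). (case (vec_first a' n, vec_last a' m) of (x, y) \<Rightarrow> x @\<^sub>v y) = (a' :: 'a vec)"
    by simp
  show "(\<lambda>(x, y). x @\<^sub>v y) ` (carrier_vec n \<times> carrier_vec m) \<subseteq> (carrier_vec (n + m) :: 'a vec set)"
    by auto
  show "(\<lambda>z. (vec_first z n, vec_last z m)) ` (carrier_vec (n + m) :: 'a vec set) \<subseteq> carrier_vec n \<times> carrier_vec m"
    by (rule image_subsetI) simp
qed

lemma vec_first_append: "x \<in> carrier_vec n \<Longrightarrow> vec_first (x @\<^sub>v y) n = x"
  by (auto simp: vec_first_def vec_eq_iff)

lemma vec_last_append: "y \<in> carrier_vec m \<Longrightarrow> vec_last (x @\<^sub>v y) m = y"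
  by (auto simp: vec_last_def vec_eq_iff)

lemma card_append_vec:
  fixes P :: "'a::finite vec \<Rightarrow> bool"
  shows "card {z \<in> carrier_vec (n + m). P z} = (\<Sum>x\<in>carrier_vec n. card {y \<in> carrier_vec m. P (x @\<^sub>v y)})"
proof -
  let ?A = "SIGMA x:carrier_vec n. {y \<in> carrier_vec m. P (x @\<^sub>v y)}"
  have fin: "finite {y \<in> carrier_vec m. P (x @\<^sub>v y)}" for x
    by (rule finite_subset[OF _ finite_carrier_vec[of m]]) blast
  have inj: "inj_on (\<lambda>(x, y). x @\<^sub>v y) ?A"
    by (rule inj_on_subset[OF bij_betw_imp_inj_on[OF bij_betw_append_vec[of n m]]]) blast
  have "(\<lambda>(x, y). x @\<^sub>v y) ` ?A = {z \<in> carrier_vec (n + m). P z}"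
  proof
    show "(\<lambda>(x, y). x @\<^sub>v y) ` ?A \<subseteq> {z \<in> carrier_vec (n + m). P z}" by (auto simp del: index_append_vec)
    show "{z \<in> carrier_vec (n + m). P z} \<subseteq> (\<lambda>(x, y). x @\<^sub>v y) ` ?A"
    proof
      fix z assume z: "z \<in> {z \<in> carrier_vec (n + m). P z}"
      then have "vec_first z n @\<^sub>v vec_last z m = z" by simp
      with z show "z \<in> (\<lambda>(x, y). x @\<^sub>v y) ` ?A"
        by (intro image_eqI[of _ _ "(vec_first z n, vec_last z m)"]) simp_all
    qed
  qed
  then have "card {z \<in> carrier_vec (n + m). P z} = card ?A" using card_image[OF inj] by simp
  also have "\<dots> = (\<Sum>x\<in>carrier_vec n. card {y \<in> carrier_vec m. P (x @\<^sub>v y)})"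
    by (rule card_SigmaI[OF finite_carrier_vec]) (use fin in blast)
  finally show ?thesis .
qed

text \<open>Functions with distinct linear parts agree on a hyperplane, the others everywhere or
  nowhere. In the applications v depends on further variables, and the case v = w is the only source
  of deviation from the mean.\<close>

lemma card_affine_coincidence:
  fixes v w :: "'a::{finite,field} vec"
  assumes v: "v \<in> carrier_vec n" and w: "w \<in> carrier_vec n"
  shows "real (card {y \<in> carrier_vec n. v \<bullet> y = w \<bullet> y + c}) =
    (if v = w then if c = 0 then real CARD('a) ^ n else 0 else real CARD('a) ^ n / real CARD('a))"
proof (cases "v = w")
  case True
  then show ?thesis by (simp add: card_carrier_vec)
next
  case False
  have "v \<bullet> y = w \<bullet> y + c \<longleftrightarrow> y \<bullet> (v - w) = c" if y: "y \<in> carrier_vec n" for y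
  proof -
    have "y \<bullet> (v - w) = y \<bullet> v - y \<bullet> w" by (rule scalar_prod_minus_distrib[OF y v w])
    also have "\<dots> = v \<bullet> y - w \<bullet> y" using comm_scalar_prod[OF y v] comm_scalar_prod[OF y w] by simp
    finally show ?thesis by auto
  qed
  then have eq: "{y \<in> carrier_vec n. v \<bullet> y = w \<bullet> y + c} = {y \<in> carrier_vec n. y \<bullet> (v - w) = c}" by blast
  have "v - w \<noteq> 0\<^sub>v n"
  proof
    assume *: "v - w = 0\<^sub>v n"
    have "v = w"
    proof (rule eq_vecI)
      fix i assume i: "i < dim_vec w"
      then have "(v - w) $ i = 0" using w unfolding * by simp
      then show "v $ i = w $ i" using v w i by simp
    qed (use v w in simp)
    with False show False by simp
  qed
  then have "CARD('a) * card {y \<in> carrier_vec n. y \<bullet> (v - w) = c} = CARD('a) ^ n"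
    by (intro card_scalar_prod_eq minus_carrier_vec v w)
  then have "real (CARD('a) * card {y \<in> carrier_vec n. y \<bullet> (v - w) = c}) = real (CARD('a) ^ n)"
    by (rule arg_cong)
  then show ?thesis using False unfolding eq by (simp add: field_simps)
qed

text \<open>The split quadratic form in 2 m variables. For each fixed first half it is linear in the
  second half, and distinct first halves give distinct functionals.\<close>

definition bent :: "nat \<Rightarrow> 'a::semiring_0 vec \<Rightarrow> 'a" where
  "bent m y = vec_first y m \<bullet> vec_last y m"

text \<open>For a fixed first half x the equation is affine in the second half with linear part x,
  so only x = \<open>vec_last w m\<close> deviates from the mean, and this deviation singles out one
  constant d. The order of the quantifiers matters: d depends on w but not on c.\<close>

lemma card_bent:
  fixes w :: "'a::{finite,field} vec"
  assumes w: "w \<in> carrier_vec (m + m)"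
  shows "\<exists>d. \<forall>c. real (card {y \<in> carrier_vec (m + m). bent m y = w \<bullet> y + c}) =
    real CARD('a) ^ m * (real CARD('a) ^ m - 1) / real CARD('a) + (if c = d then real CARD('a) ^ m else 0)"
proof (intro exI allI)
  fix c
  let ?w1 = "vec_first w m" and ?w2 = "vec_last w m" and ?q = "real CARD('a)"
  have w12: "?w1 @\<^sub>v ?w2 = w" using w by simp
  have "card {y \<in> carrier_vec (m + m). bent m y = w \<bullet> y + c} =
      (\<Sum>x\<in>carrier_vec m. card {y \<in> carrier_vec m. bent m (x @\<^sub>v y) = w \<bullet> (x @\<^sub>v y) + c})"
    by (rule card_append_vec)
  also have "real \<dots> = (\<Sum>x\<in>carrier_vec m. real (card {y \<in> carrier_vec m. x \<bullet> y = ?w2 \<bullet> y + (?w1 \<bullet> x + c)}))"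
    unfolding of_nat_sum
  proof (rule sum.cong[OF refl], rule arg_cong[where f = "\<lambda>S. real (card S)"], rule Collect_cong, rule conj_cong[OF refl])
    fix x y :: "'a vec" assume x: "x \<in> carrier_vec m" and y: "y \<in> carrier_vec m"
    have "w \<bullet> (x @\<^sub>v y) = ?w1 \<bullet> x + ?w2 \<bullet> y"
      by (subst w12[symmetric], rule scalar_prod_append) (use x y in simp_all)
    then show "(bent m (x @\<^sub>v y) = w \<bullet> (x @\<^sub>v y) + c) = (x \<bullet> y = ?w2 \<bullet> y + (?w1 \<bullet> x + c))"
      unfolding bent_def vec_first_append[OF x] vec_last_append[OF y] by (simp add: ac_simps)
  qed
  also have "\<dots> = (\<Sum>x\<in>carrier_vec m. ?q ^ m / ?q + (if x = ?w2 then (if ?w1 \<bullet> x + c = 0 then ?q ^ m else 0) - ?q ^ m / ?q else 0))"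
    by (intro sum.cong refl) (simp add: card_affine_coincidence)
  also have "\<dots> = ?q ^ m * (?q ^ m / ?q) + ((if ?w1 \<bullet> ?w2 + c = 0 then ?q ^ m else 0) - ?q ^ m / ?q)"
    by (simp add: sum.distrib card_carrier_vec finite_carrier_vec)
  also have "\<dots> = ?q ^ m * (?q ^ m - 1) / ?q + (if c = - (?w1 \<bullet> ?w2) then ?q ^ m else 0)"
  proof -
    have "?w1 \<bullet> ?w2 + c = 0 \<longleftrightarrow> c = - (?w1 \<bullet> ?w2)" by (simp add: add_eq_0_iff)
    moreover have "?q ^ m * (?q ^ m / ?q) - ?q ^ m / ?q = ?q ^ m * (?q ^ m - 1) / ?q"
      by (simp add: right_diff_distrib diff_divide_distrib)
    ultimately show ?thesis by simp
  qed
  finally show "real (card {y \<in> carrier_vec (m + m). bent m y = w \<bullet> y + c}) =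
    ?q ^ m * (?q ^ m - 1) / ?q + (if c = - (?w1 \<bullet> ?w2) then ?q ^ m else 0)" .
qed

text \<open>
  On the exceptional set \<open>R\<close> a Maiorana-McFarland function \<open>y' \<bullet> \<pi>(x, y'')\<close> is used, in which \<open>\<pi>\<close> is injective;
  the extra variables make room for such a \<open>\<pi>\<close> as soon as \<open>R\<close> is somewhat sparse.
\<close>

lemma bent_extension:
  fixes F :: "'a::{finite,field} vec \<Rightarrow> 'a" and B :: real
  assumes F: "\<And>u c. u \<in> carrier_vec n \<Longrightarrow>
      real (card {x \<in> carrier_vec n - R. F x = u \<bullet> x + c}) \<le> card (carrier_vec n - R) / CARD('a) + B"
    and R: "R \<subseteq> carrier_vec n" and s: "s \<le> m + m" "card R * CARD('a) ^ (m + m - s) \<le> CARD('a) ^ s"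
  shows "\<exists>g :: 'a vec \<Rightarrow> 'a. \<forall>u c. u \<in> carrier_vec (n + (m + m)) \<longrightarrow>
    real (card {z \<in> carrier_vec (n + (m + m)). g z = u \<bullet> z + c}) \<le>
      real CARD('a) ^ (n + (m + m)) / real CARD('a) + (real CARD('a) ^ m * B + real CARD('a) ^ s)"
proof -
  let ?q = "real CARD('a)" and ?V = "carrier_vec :: nat \<Rightarrow> 'a vec set"
  define t where "t = m + m - s"
  have st: "m + m = s + t" unfolding t_def using s(1) by simp
  have q1: "?q > 1" using card_field_gt_1[where 'a = 'a] by simp
  have q0: "0 \<le> ?q ^ s / ?q" "- (?q ^ s / ?q) \<le> ?q ^ s"
    by (simp, rule order_trans[of _ 0]) simp_all
  have finR: "finite R" using R finite_carrier_vec finite_subset by blast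
  have "card (R \<times> ?V t) \<le> card (?V s)"
    using s(2) unfolding t_def[symmetric] by (simp add: card_cartesian_product card_carrier_vec)
  then obtain \<pi> where \<pi>: "\<pi> ` (R \<times> ?V t) \<subseteq> ?V s" "inj_on \<pi> (R \<times> ?V t)"
    using card_le_inj[of "R \<times> ?V t" "?V s"] finR finite_carrier_vec by blast
  \<comment> \<open>The last 2 m variables are cut in two ways: into halves of length m by the bent
    function off R, and into blocks of lengths s and t on R.\<close>
  define g where "g = (\<lambda>z. let x = vec_first z n; y = vec_last z (m + m) in
    if x \<in> R then \<pi> (x, vec_last y t) \<bullet> vec_first y s else F x + bent m y)"
  have g_append: "g (x @\<^sub>v y) = (if x \<in> R then \<pi> (x, vec_last y t) \<bullet> vec_first y s else F x + bent m y)"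
    if "x \<in> ?V n" "y \<in> ?V (m + m)" for x y
    unfolding g_def Let_def vec_first_append[OF that(1)] vec_last_append[OF that(2)] ..
  show ?thesis
  proof (intro exI[of _ g] allI impI)
    fix u :: "'a vec" and c assume u: "u \<in> ?V (n + (m + m))"
    define u0 u1 where "u0 = vec_first u n" and "u1 = vec_last u (m + m)"
    have u01: "u0 @\<^sub>v u1 = u" "u0 \<in> ?V n" "u1 \<in> ?V (m + m)" unfolding u0_def u1_def using u by simp_all
    have u_prod: "u \<bullet> (x @\<^sub>v y) = u0 \<bullet> x + u1 \<bullet> y" if "x \<in> ?V n" "y \<in> ?V (m + m)" for x y
      unfolding u01(1)[symmetric] by (rule scalar_prod_append[OF u01(2,3) that])
    define v1 v2 where "v1 = vec_first u1 s" and "v2 = vec_last u1 t"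
    have v12: "v1 @\<^sub>v v2 = u1" "v1 \<in> ?V s" "v2 \<in> ?V t"
      unfolding v1_def v2_def using u01(3) unfolding st by simp_all
    obtain d where d: "\<And>c. real (card {y \<in> ?V (m + m). bent m y = u1 \<bullet> y + c}) =
        ?q ^ m * (?q ^ m - 1) / ?q + (if c = d then ?q ^ m else 0)"
      using card_bent[OF u01(3)] by blast
    define N where "N = (\<lambda>x. real (card {y \<in> ?V (m + m). g (x @\<^sub>v y) = u \<bullet> (x @\<^sub>v y) + c}))"
    \<comment> \<open>The exceptional constant d of the bent function turns into an agreement of F
      with an affine function whose constant is c - d. The sum over x is thus controlled by the
      hypothesis on F, and the deviations of F are merely scaled by q^m.\<close>
    have N_out: "N x = ?q ^ m * (?q ^ m - 1) / ?q + ?q ^ m * of_bool (F x = u0 \<bullet> x + (c - d))"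
      if x: "x \<in> ?V n - R" for x
    proof -
      have "{y \<in> ?V (m + m). g (x @\<^sub>v y) = u \<bullet> (x @\<^sub>v y) + c} =
          {y \<in> ?V (m + m). bent m y = u1 \<bullet> y + (u0 \<bullet> x + c - F x)}"
        using x by (auto simp: g_append u_prod algebra_simps)
      moreover have "(u0 \<bullet> x + c - F x = d) = (F x = u0 \<bullet> x + (c - d))" by (auto simp: algebra_simps)
      ultimately show ?thesis unfolding N_def by (simp only: d) simp
    qed
    have N_in: "N x = (\<Sum>y2\<in>?V t. ?q ^ s / ?q + (if \<pi> (x, y2) = v1 then
          (if u0 \<bullet> x + v2 \<bullet> y2 + c = 0 then ?q ^ s else 0) - ?q ^ s / ?q else 0))"
      if x: "x \<in> R" for x
    proof -
      have xn: "x \<in> ?V n" using x R by blast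
      have "card {y \<in> ?V (t + s). P y} = card {y \<in> ?V (s + t). P y}" for P by (simp add: add.commute)
      \<comment> \<open>The second block is fixed first, since on R the function is linear in the
        first block only.\<close>
      have bij: "card {y \<in> ?V (s + t). P y} = (\<Sum>y2\<in>?V t. card {y1 \<in> ?V s. P (y1 @\<^sub>v y2)})" for P :: "'a vec \<Rightarrow> bool"
      proof -
        have "card {y \<in> ?V (s + t). P y} = (\<Sum>y1\<in>?V s. card {y2 \<in> ?V t. P (y1 @\<^sub>v y2)})"
          by (rule card_append_vec)
        also have "\<dots> = (\<Sum>y1\<in>?V s. \<Sum>y2\<in>?V t. if P (y1 @\<^sub>v y2) then 1 else 0)"
          by (simp add: sum.inter_filter[symmetric] finite_carrier_vec)
        also have "\<dots> = (\<Sum>y2\<in>?V t. \<Sum>y1\<in>?V s. if P (y1 @\<^sub>v y2) then 1 else 0)"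
          by (rule sum.swap)
        also have "\<dots> = (\<Sum>y2\<in>?V t. card {y1 \<in> ?V s. P (y1 @\<^sub>v y2)})"
          by (simp add: sum.inter_filter[symmetric] finite_carrier_vec)
        finally show ?thesis .
      qed
      have "N x = (\<Sum>y2\<in>?V t. real (card {y1 \<in> ?V s. g (x @\<^sub>v (y1 @\<^sub>v y2)) = u \<bullet> (x @\<^sub>v (y1 @\<^sub>v y2)) + c}))"
        unfolding N_def st bij of_nat_sum ..
      also have "\<dots> = (\<Sum>y2\<in>?V t. real (card {y1 \<in> ?V s. \<pi> (x, y2) \<bullet> y1 = v1 \<bullet> y1 + (u0 \<bullet> x + v2 \<bullet> y2 + c)}))"
      proof (rule sum.cong[OF refl], rule arg_cong[where f = "\<lambda>S. real (card S)"], rule Collect_cong, rule conj_cong[OF refl])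
        fix y2 y1 :: "'a vec" assume y: "y2 \<in> ?V t" "y1 \<in> ?V s"
        have yy: "y1 @\<^sub>v y2 \<in> ?V (m + m)" using y unfolding st by simp
        have "u1 \<bullet> (y1 @\<^sub>v y2) = v1 \<bullet> y1 + v2 \<bullet> y2"
          unfolding v12(1)[symmetric] by (rule scalar_prod_append[OF v12(2,3) y(2,1)])
        then show "(g (x @\<^sub>v (y1 @\<^sub>v y2)) = u \<bullet> (x @\<^sub>v (y1 @\<^sub>v y2)) + c) =
            (\<pi> (x, y2) \<bullet> y1 = v1 \<bullet> y1 + (u0 \<bullet> x + v2 \<bullet> y2 + c))"
          unfolding g_append[OF xn yy] u_prod[OF xn yy] vec_first_append[OF y(2)] vec_last_append[OF y(1)]
          using x by (simp add: ac_simps)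
      qed
      also have "\<dots> = (\<Sum>y2\<in>?V t. ?q ^ s / ?q + (if \<pi> (x, y2) = v1 then
          (if u0 \<bullet> x + v2 \<bullet> y2 + c = 0 then ?q ^ s else 0) - ?q ^ s / ?q else 0))"
      proof (rule sum.cong[OF refl])
        fix y2 :: "'a vec" assume "y2 \<in> ?V t"
        then have \<pi>_in: "\<pi> (x, y2) \<in> ?V s" using \<pi>(1) x by blast
        show "real (card {y1 \<in> ?V s. \<pi> (x, y2) \<bullet> y1 = v1 \<bullet> y1 + (u0 \<bullet> x + v2 \<bullet> y2 + c)}) =
          ?q ^ s / ?q + (if \<pi> (x, y2) = v1 then (if u0 \<bullet> x + v2 \<bullet> y2 + c = 0 then ?q ^ s else 0) - ?q ^ s / ?q else 0)"
          unfolding card_affine_coincidence[OF \<pi>_in v12(2)] by simp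
      qed
      finally show ?thesis .
    qed
    \<comment> \<open>Negative terms may be dropped in an upper bound. By injectivity of \<pi> at
      most one pair (x, y2) has linear part v1, and this single pair costs q^s.\<close>
    have "(\<Sum>x\<in>R. N x) \<le> (\<Sum>x\<in>R. \<Sum>y2\<in>?V t. ?q ^ s / ?q + (if \<pi> (x, y2) = v1 then ?q ^ s else 0))"
    proof (rule sum_mono)
      fix x assume x: "x \<in> R"
      show "N x \<le> (\<Sum>y2\<in>?V t. ?q ^ s / ?q + (if \<pi> (x, y2) = v1 then ?q ^ s else 0))"
        unfolding N_in[OF x] by (intro sum_mono add_left_mono) (use q0 in auto)
    qed
    also have "\<dots> = (\<Sum>xy\<in>R \<times> ?V t. ?q ^ s / ?q + (if \<pi> xy = v1 then ?q ^ s else 0))"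
      by (simp add: sum.cartesian_product case_prod_beta)
    also have "\<dots> = real (card R) * ?q ^ t * (?q ^ s / ?q) + ?q ^ s * real (card {xy \<in> R \<times> ?V t. \<pi> xy = v1})"
      using finR by (simp add: sum.distrib sum.inter_filter[symmetric] finite_carrier_vec card_cartesian_product card_carrier_vec)
    also have "real (card {xy \<in> R \<times> ?V t. \<pi> xy = v1}) \<le> 1"
    proof -
      have "card {xy \<in> R \<times> ?V t. \<pi> xy = v1} \<le> card {v1}"
        by (rule card_inj_on_le[of \<pi>]) (use \<pi>(2) in \<open>auto simp: inj_on_def\<close>)
      then show ?thesis by simp
    qed
    finally have sum_in: "(\<Sum>x\<in>R. N x) \<le> real (card R) * ?q ^ (m + m) / ?q + ?q ^ s"
      using q1 unfolding st by (simp add: power_add mult_ac)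
    have finVR: "finite (?V n - R)" using finite_carrier_vec by blast
    have "(\<Sum>x\<in>?V n - R. N x) = (\<Sum>x\<in>?V n - R. ?q ^ m * (?q ^ m - 1) / ?q + ?q ^ m * of_bool (F x = u0 \<bullet> x + (c - d)))"
      by (intro sum.cong refl N_out)
    also have "\<dots> = real (card (?V n - R)) * (?q ^ m * (?q ^ m - 1) / ?q) +
        ?q ^ m * real (card {x \<in> ?V n - R. F x = u0 \<bullet> x + (c - d)})"
      by (simp only: sum.distrib sum_constant sum_distrib_left[symmetric] sum_of_bool_card[OF finVR])
    also have "\<dots> \<le> real (card (?V n - R)) * (?q ^ m * (?q ^ m - 1) / ?q) + ?q ^ m * (card (?V n - R) / ?q + B)"
      using F[OF u01(2), of "c - d"] q1 by (intro add_left_mono mult_left_mono) auto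
    also have "\<dots> = real (card (?V n - R)) * ?q ^ (m + m) / ?q + ?q ^ m * B"
    proof -
      have "k * (a * (a - 1) / z) + a * (k / z + B) = k * (a * a) / z + a * B" for k a z :: real
      proof -
        have "k * (a * (a - 1) / z) = k * (a * a) / z - a * (k / z)"
          by (simp add: right_diff_distrib diff_divide_distrib)
        then show ?thesis by (simp add: distrib_left)
      qed
      then show ?thesis unfolding power_add .
    qed
    finally have sum_out: "(\<Sum>x\<in>?V n - R. N x) \<le> real (card (?V n - R)) * ?q ^ (m + m) / ?q + ?q ^ m * B" .
    have cards: "real (card (?V n - R)) + real (card R) = ?q ^ n"
    proof -
      have "card (?V n) = card (?V n - R) + card R"
        using card_Diff_subset[OF finR R] card_mono[OF finite_carrier_vec R] by simp
      then show ?thesis unfolding card_carrier_vec by (metis of_nat_add of_nat_power)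
    qed
    have "real (card {z \<in> ?V (n + (m + m)). g z = u \<bullet> z + c}) = (\<Sum>x\<in>?V n. N x)"
      unfolding N_def card_append_vec of_nat_sum ..
    also have "\<dots> = (\<Sum>x\<in>?V n - R. N x) + (\<Sum>x\<in>R. N x)"
      by (rule sum.subset_diff[OF R finite_carrier_vec])
    also have "\<dots> \<le> (real (card (?V n - R)) + real (card R)) * ?q ^ (m + m) / ?q + (?q ^ m * B + ?q ^ s)"
      using sum_in sum_out by (simp add: distrib_right add_divide_distrib)
    also have "\<dots> = ?q ^ (n + (m + m)) / ?q + (?q ^ m * B + ?q ^ s)"
      unfolding cards by (simp add: power_add)
    finally show "real (card {z \<in> ?V (n + (m + m)). g z = u \<bullet> z + c}) \<le> ?q ^ (n + (m + m)) / ?q + (?q ^ m * B + ?q ^ s)" .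
  qed
qed

text \<open>The 2 m new variables multiply both the excess of F and the normalising power by q^m, so
  b is unchanged. The completion on R costs q^s, which after normalisation is the second summand; it
  is small when s stays well below m + n/2 - 1.\<close>

lemma mu_le_of_core:
  fixes F :: "'a::{finite,field} vec \<Rightarrow> 'a" and b :: real
  assumes F: "\<And>u c. u \<in> carrier_vec n \<Longrightarrow> real (card {x \<in> carrier_vec n - R. F x = u \<bullet> x + c}) \<le>
      card (carrier_vec n - R) / CARD('a) + b * real CARD('a) powr (real n / 2 - 1)"
    and R: "R \<subseteq> carrier_vec n" and s: "s \<le> m + m" "card R * CARD('a) ^ (m + m - s) \<le> CARD('a) ^ s"
    and n: "n > 0"
  shows "mu TYPE('a) (n + (m + m)) \<le> b + real CARD('a) powr (real s - real m - real n / 2 + 1)"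
proof -
  let ?q = "real CARD('a)" and ?e = "real (n + (m + m)) / 2 - 1"
  have q1: "?q > 1" using card_field_gt_1[where 'a = 'a] by simp
  obtain g :: "'a vec \<Rightarrow> 'a" where g: "\<And>u c. u \<in> carrier_vec (n + (m + m)) \<Longrightarrow>
    real (card {z \<in> carrier_vec (n + (m + m)). g z = u \<bullet> z + c}) \<le>
      ?q ^ (n + (m + m)) / ?q + (?q ^ m * (b * ?q powr (real n / 2 - 1)) + ?q ^ s)"
    using bent_extension[OF F R s] by blast
  have "mu TYPE('a) (n + (m + m)) \<le> (?q ^ m * (b * ?q powr (real n / 2 - 1)) + ?q ^ s) / ?q powr ?e"
    by (rule mu_le[OF _ g]) (use n in auto)
  also have "?q ^ m * (b * ?q powr (real n / 2 - 1)) = b * ?q powr ?e"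
  proof -
    have "?e = real m + (real n / 2 - 1)" by simp
    then have "?q powr ?e = ?q ^ m * ?q powr (real n / 2 - 1)"
      using q1 by (simp only: powr_add powr_realpow)
    then show ?thesis by simp
  qed
  also have "?q ^ s = ?q powr (real s - real m - real n / 2 + 1) * ?q powr ?e"
  proof -
    have "?q powr (real s - real m - real n / 2 + 1) * ?q powr ?e =
        ?q powr ((real s - real m - real n / 2 + 1) + ?e)"
      by (rule powr_add[symmetric])
    also have "(real s - real m - real n / 2 + 1) + ?e = real s"
    proof -
      have "real (n + (m + m)) / 2 = real n / 2 + real m" by simp
      then show ?thesis by (simp only:)
    qed
    also have "?q powr real s = ?q ^ s" using q1 by (intro powr_realpow) simp
    finally show ?thesis ..
  qed
  also have "(b * ?q powr ?e + ?q powr (real s - real m - real n / 2 + 1) * ?q powr ?e) / ?q powr ?e =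
      b + ?q powr (real s - real m - real n / 2 + 1)"
  proof -
    have cancel: "(b * z + w * z) / z = b + w" if "z \<noteq> 0" for w z :: real using that by (simp add: add_divide_distrib)
    show ?thesis by (rule cancel) (use q1 in simp)
  qed
  finally show ?thesis .
qed

section \<open>Even dimension: an anisotropic plane\<close>

lemma exists_rootfree_quadratic:
  obtains \<beta> \<gamma> :: "'a::{finite,field}" where "\<And>x. x\<^sup>2 + \<beta> * x + \<gamma> \<noteq> 0"
proof -
  have "\<exists>\<beta> \<gamma> :: 'a. \<forall>x. x\<^sup>2 + \<beta> * x + \<gamma> \<noteq> 0"
  proof (rule ccontr)
    assume "\<nexists>\<beta> \<gamma> :: 'a. \<forall>x. x\<^sup>2 + \<beta> * x + \<gamma> \<noteq> 0"
    then have root: "\<exists>x. x\<^sup>2 + \<beta> * x + \<gamma> = 0" for \<beta> \<gamma> :: 'a by blast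
    \<comment> \<open>The pair (x, y) is sent to the coefficients of (X - x)(X - y). If every monic
      quadratic had a root, this map would be onto, hence injective on a finite set, although
      swapping x and y does not change its value. The argument is uniform in the characteristic, 2
      included.\<close>
    let ?S = "\<lambda>x y. (- (x + y), x * y) :: 'a \<times> 'a"
    have surj: "(\<lambda>(x, y). ?S x y) ` UNIV = UNIV"
    proof -
      have "(\<beta>, \<gamma>) \<in> (\<lambda>(x, y). ?S x y) ` UNIV" for \<beta> \<gamma>
      proof -
        obtain x where "x\<^sup>2 + \<beta> * x + \<gamma> = 0" using root by blast
        then have "\<gamma> = - (x\<^sup>2 + \<beta> * x)" by (simp only: add_eq_0_iff)
        then have "\<gamma> = x * (- \<beta> - x)" by (simp add: power2_eq_square algebra_simps)
        then show ?thesis by (intro image_eqI[of _ _ "(x, - \<beta> - x)"]) simp_all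
      qed
      then show ?thesis by auto
    qed
    have "inj (\<lambda>(x, y). ?S x y)"
      by (rule finite_UNIV_surj_inj[OF finite_class.finite_UNIV surj])
    from injD[OF this, of "(0, 1)" "(1, 0)"] show False by simp
  qed
  then show ?thesis using that by blast
qed

text \<open>
  An affine conic without points at infinity has at most \<open>q + 1\<close> points: a point \<open>P\<close> of it is joined to the
  others by lines of distinct directions, none of them the direction of the tangent at \<open>P\<close>.
\<close>

lemma card_anisotropic_conic:
  fixes \<beta> \<gamma> a b c :: "'a::{finite,field}"
  defines "N \<equiv> \<lambda>x y. x\<^sup>2 + \<beta> * x * y + \<gamma> * y\<^sup>2"
  assumes root: "\<And>x. x\<^sup>2 + \<beta> * x + \<gamma> \<noteq> 0"
  shows "card {(x, y). N x y = a * x + b * y + c} \<le> CARD('a) + 1"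
proof (cases "{(x, y). N x y = a * x + b * y + c} = {}")
  case False
  let ?C = "{(x, y). N x y = a * x + b * y + c}"
  obtain x0 y0 where P: "N x0 y0 = a * x0 + b * y0 + c" using False by auto
  have aniso: "x = 0 \<and> y = 0" if "N x y = 0" for x y
  proof (cases "y = 0")
    case False
    have "N x y = y\<^sup>2 * ((x / y)\<^sup>2 + \<beta> * (x / y) + \<gamma>)"
      using False unfolding N_def by (simp add: field_simps power2_eq_square)
    then show ?thesis using that root[of "x / y"] False by simp
  qed (use that in \<open>simp add: N_def\<close>)
  \<comment> \<open>(k, l) is the gradient at P of the equation of the conic, so m vanishes on the
    tangent direction. Subtracting the equation at P leaves N = -m in coordinates centred at
    P.\<close>
  define k l where "k = 2 * x0 + \<beta> * y0 - a" and "l = \<beta> * x0 + 2 * \<gamma> * y0 - b"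
  define m where "m = (\<lambda>x y. k * x + l * y)"
  \<comment> \<open>The direction of the line through P, normalised by m: y and m are independent
    linear forms when k \<noteq> 0, as are x and m when k = 0 and l \<noteq> 0; for k = l = 0 there
    is no point besides P. The values lie in the field, which leaves room for q further
    points.\<close>
  define \<phi> where "\<phi> = (\<lambda>(x, y). (if k \<noteq> 0 then y - y0 else x - x0) / m (x - x0) (y - y0))"
  have line: "N (x - x0) (y - y0) = - m (x - x0) (y - y0)" if "(x, y) \<in> ?C" for x y
  proof -
    have "N (x - x0) (y - y0) + m (x - x0) (y - y0) = (N x y - (a * x + b * y + c)) - (N x0 y0 - (a * x0 + b * y0 + c))"
      unfolding N_def m_def k_def l_def by (simp add: power2_eq_square algebra_simps)
    then show ?thesis using that P by (simp add: add_eq_0_iff)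
  qed
  have inj: "inj_on \<phi> (?C - {(x0, y0)})"
  proof (rule inj_onI)
    fix P P' assume PP: "P \<in> ?C - {(x0, y0)}" "P' \<in> ?C - {(x0, y0)}" "\<phi> P = \<phi> P'"
    obtain x y x' y' where P_eq: "P = (x, y)" "P' = (x', y')" by (cases P, cases P') blast
    have xy: "(x, y) \<in> ?C" "(x', y') \<in> ?C" "(x, y) \<noteq> (x0, y0)" "(x', y') \<noteq> (x0, y0)" "\<phi> (x, y) = \<phi> (x', y')"
      using PP unfolding P_eq by simp_all
    let ?x = "x - x0" and ?y = "y - y0" and ?x' = "x' - x0" and ?y' = "y' - y0"
    have m0: "m ?x ?y \<noteq> 0" "m ?x' ?y' \<noteq> 0"
      using line[OF xy(1)] line[OF xy(2)] aniso[of ?x ?y] aniso[of ?x' ?y'] xy(3,4) by auto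
    define \<kappa> where "\<kappa> = m ?x ?y / m ?x' ?y'"
    have mk: "m ?x ?y = \<kappa> * m ?x' ?y'" unfolding \<kappa>_def using m0 by simp
    have \<kappa>0: "\<kappa> \<noteq> 0" unfolding \<kappa>_def using m0 by simp
    have ratio: "?x = \<kappa> * ?x' \<and> ?y = \<kappa> * ?y'"
    proof (cases "k = 0")
      case False
      then have "?y / m ?x ?y = ?y' / m ?x' ?y'" using xy(5) unfolding \<phi>_def by simp
      then have y: "?y = \<kappa> * ?y'" unfolding \<kappa>_def using m0 by (simp add: field_simps)
      have "k * ?x = m ?x ?y - l * ?y" unfolding m_def by simp
      also have "\<dots> = \<kappa> * (m ?x' ?y' - l * ?y')" by (subst mk, subst y) (simp add: algebra_simps)
      also have "\<dots> = k * (\<kappa> * ?x')" unfolding m_def by (simp add: algebra_simps)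
      finally show ?thesis using y False by simp
    next
      case True
      then have "?x / m ?x ?y = ?x' / m ?x' ?y'" using xy(5) unfolding \<phi>_def by simp
      then have x: "?x = \<kappa> * ?x'" unfolding \<kappa>_def using m0 by (simp add: field_simps)
      have "l \<noteq> 0" using m0 True unfolding m_def by auto
      moreover have "l * ?y = l * (\<kappa> * ?y')" using mk True unfolding m_def by (simp add: ac_simps)
      ultimately show ?thesis using x by simp
    qed
    \<comment> \<open>N is quadratic and m linear, so proportional points on the conic satisfy
      \<kappa>^2 = \<kappa>.\<close>
    have "N ?x ?y = \<kappa>\<^sup>2 * N ?x' ?y'" unfolding conjunct1[OF ratio] conjunct2[OF ratio] N_def
      by (simp add: power2_eq_square algebra_simps)
    then have "- m ?x ?y = \<kappa>\<^sup>2 * - m ?x' ?y'" unfolding line[OF xy(1)] line[OF xy(2)] .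
    then have "\<kappa> * m ?x' ?y' = \<kappa> * (\<kappa> * m ?x' ?y')" unfolding mk by (simp add: power2_eq_square mult.assoc)
    then have "\<kappa> = 1" using \<kappa>0 m0(2) by simp
    then show "P = P'" unfolding P_eq using ratio by simp
  qed
  have "card (?C - {(x0, y0)}) \<le> CARD('a)"
    using card_inj_on_le[OF inj, of UNIV] by simp
  moreover have "card ?C = Suc (card (?C - {(x0, y0)}))"
    using P by (intro card.remove) auto
  ultimately show ?thesis by simp
qed simp

text \<open>The plane has agreement at most q + 1, an excess of 1 = q powr (2/2 - 1) over the mean
  q. The exceptional set is empty and s = 0, which leaves q powr (- m) as the error.\<close>

lemma mu_even_le:
  "mu TYPE('a::{finite,field}) (2 + (m + m)) \<le> 1 + real CARD('a) powr (- real m)"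
proof -
  let ?q = "real CARD('a)"
  obtain \<beta> \<gamma> :: 'a where root: "\<And>x. x\<^sup>2 + \<beta> * x + \<gamma> \<noteq> 0" using exists_rootfree_quadratic by blast
  define F :: "'a vec \<Rightarrow> 'a" where "F = (\<lambda>v. (v $ 0)\<^sup>2 + \<beta> * v $ 0 * v $ 1 + \<gamma> * (v $ 1)\<^sup>2)"
  have "mu TYPE('a) (2 + (m + m)) \<le> 1 + ?q powr (real 0 - real m - real 2 / 2 + 1)"
  proof (rule mu_le_of_core[of 2 "{}" F])
    fix u :: "'a vec" and c assume u: "u \<in> carrier_vec 2"
    let ?S = "{x \<in> carrier_vec 2 - {}. F x = u \<bullet> x + c}"
    have prod: "u \<bullet> x = u $ 0 * x $ 0 + u $ 1 * x $ 1" if "x \<in> carrier_vec 2" for x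
      using u that by (simp add: scalar_prod_def numeral_2_eq_2)
    have "card ?S \<le> card {(x, y). x\<^sup>2 + \<beta> * x * y + \<gamma> * y\<^sup>2 = u $ 0 * x + u $ 1 * y + c}"
    proof (rule card_inj_on_le)
      show "inj_on (\<lambda>v. (v $ 0, v $ 1)) ?S"
        by (rule inj_onI) (auto intro!: eq_vecI simp: less_2_cases_iff)
      show "(\<lambda>v. (v $ 0, v $ 1)) ` ?S \<subseteq> {(x, y). x\<^sup>2 + \<beta> * x * y + \<gamma> * y\<^sup>2 = u $ 0 * x + u $ 1 * y + c}"
        by (rule image_subsetI) (simp add: F_def prod)
    qed simp
    also have "\<dots> \<le> CARD('a) + 1" by (rule card_anisotropic_conic[OF root])
    finally have "real (card ?S) \<le> ?q + 1" by linarith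
    moreover have "real (card (carrier_vec 2 - {} :: 'a vec set)) / ?q = ?q"
      by (simp add: card_carrier_vec power2_eq_square)
    ultimately show "real (card ?S) \<le> real (card (carrier_vec 2 - {} :: 'a vec set)) / ?q + 1 * ?q powr (real 2 / 2 - 1)"
      by simp
  qed auto
  then show ?thesis by simp
qed

section \<open>Matrix Gauss sums over a finite field\<close>

text \<open>The vanishing principle behind the orthogonality relations of this section: a bijection
  of the index set multiplies the summand by a constant different from 1.\<close>

lemma sum_eq_0_of_scaling:
  fixes g :: "'b \<Rightarrow> complex"
  assumes "bij_betw f A A" "\<And>x. x \<in> A \<Longrightarrow> g (f x) = c * g x" "c \<noteq> 1"
  shows "(\<Sum>x\<in>A. g x) = 0"
proof -
  have "(\<Sum>x\<in>A. g x) = (\<Sum>x\<in>A. g (f x))" by (rule sum.reindex_bij_betw[OF assms(1), symmetric])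
  also have "\<dots> = c * (\<Sum>x\<in>A. g x)"
    unfolding sum_distrib_left by (rule sum.cong[OF refl assms(2)])
  finally have "(1 - c) * (\<Sum>x\<in>A. g x) = 0" by (simp add: left_diff_distrib)
  then show ?thesis using assms(3) by simp
qed

lemma bij_betw_endo:
  assumes "finite A" "\<And>x. x \<in> A \<Longrightarrow> f x \<in> A" "inj_on f A"
  shows "bij_betw f A A"
  unfolding bij_betw_def using endo_inj_surj[OF assms(1) _ assms(3)] assms(2,3) by blast

definition mtrace :: "'a::comm_monoid_add mat \<Rightarrow> 'a" where
  "mtrace A = (\<Sum>i<dim_row A. A $$ (i, i))"

lemma mtrace_add:
  assumes "A \<in> carrier_mat n n" "B \<in> carrier_mat n n"
  shows "mtrace (A + B) = mtrace A + mtrace B"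
  using assms unfolding mtrace_def by (simp add: sum.distrib)

text \<open>The degree f of the extension is found inside the proof, so the field with q^f elements
  cannot be a type. It is a finite subset of an ambient field, later the algebraic closure of the
  given one; determinants are taken in the ambient field and shown to stay in the subset.\<close>

locale finite_subfield =
  fixes F :: "'k::field set"
  assumes finite_F: "finite F"
    and zero_F: "0 \<in> F" and one_F: "1 \<in> F"
    and add_F: "\<And>x y. x \<in> F \<Longrightarrow> y \<in> F \<Longrightarrow> x + y \<in> F"
    and minus_F: "\<And>x. x \<in> F \<Longrightarrow> - x \<in> F"
    and mult_F: "\<And>x y. x \<in> F \<Longrightarrow> y \<in> F \<Longrightarrow> x * y \<in> F"
    and inverse_F: "\<And>x. x \<in> F \<Longrightarrow> inverse x \<in> F"
begin

abbreviation Q :: nat where "Q \<equiv> card F"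

lemma diff_F: "x \<in> F \<Longrightarrow> y \<in> F \<Longrightarrow> x - y \<in> F"
  using add_F[of x "- y"] minus_F[of y] by simp

lemma divide_F: "x \<in> F \<Longrightarrow> y \<in> F \<Longrightarrow> x / y \<in> F"
  unfolding divide_inverse by (intro mult_F inverse_F)

lemma sum_F: "(\<And>i. i \<in> I \<Longrightarrow> f i \<in> F) \<Longrightarrow> (\<Sum>i\<in>I. f i) \<in> F"
  by (induction I rule: infinite_finite_induct) (auto intro: zero_F add_F)

lemma prod_F: "(\<And>i. i \<in> I \<Longrightarrow> f i \<in> F) \<Longrightarrow> (\<Prod>i\<in>I. f i) \<in> F"
  by (induction I rule: infinite_finite_induct) (auto intro: one_F mult_F)

lemma Q_gt_1: "Q > 1"
proof -
  have "card {0, 1 :: 'k} \<le> Q" by (rule card_mono[OF finite_F]) (simp add: zero_F one_F)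
  then show ?thesis by simp
qed

definition vecs :: "nat \<Rightarrow> 'k vec set" where
  "vecs n = {v \<in> carrier_vec n. \<forall>i<n. v $ i \<in> F}"

definition mats :: "nat \<Rightarrow> nat \<Rightarrow> 'k mat set" where
  "mats n m = {A \<in> carrier_mat n m. \<forall>i<n. \<forall>j<m. A $$ (i, j) \<in> F}"

lemma mats_carrier: "A \<in> mats n m \<Longrightarrow> A \<in> carrier_mat n m"
  by (simp add: mats_def)

lemma mats_index: "A \<in> mats n m \<Longrightarrow> i < n \<Longrightarrow> j < m \<Longrightarrow> A $$ (i, j) \<in> F"
  by (simp add: mats_def)

lemma bij_betw_vecs: "bij_betw (\<lambda>f. vec n f) (PiE {..<n} (\<lambda>_. F)) (vecs n)"
proof (rule bij_betw_byWitness[where f' = "\<lambda>v. restrict (($) v) {..<n}"])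
  show "\<forall>f\<in>{..<n} \<rightarrow>\<^sub>E F. restrict (($) (vec n f)) {..<n} = f"
    by (auto simp: fun_eq_iff PiE_def extensional_def restrict_def)
  show "\<forall>v\<in>vecs n. vec n (restrict (($) v) {..<n}) = v"
    by (auto simp: vecs_def vec_eq_iff)
  show "(\<lambda>f. vec n f) ` ({..<n} \<rightarrow>\<^sub>E F) \<subseteq> vecs n" by (rule image_subsetI) (auto simp: vecs_def)
  show "(\<lambda>v. restrict (($) v) {..<n}) ` vecs n \<subseteq> {..<n} \<rightarrow>\<^sub>E F"
    by (rule image_subsetI) (auto simp: vecs_def split: if_splits)
qed

lemma bij_betw_mats: "bij_betw (\<lambda>f. mat n m f) (PiE ({..<n} \<times> {..<m}) (\<lambda>_. F)) (mats n m)"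
proof (rule bij_betw_byWitness[where f' = "\<lambda>A. restrict (($$) A) ({..<n} \<times> {..<m})"])
  show "\<forall>f\<in>{..<n} \<times> {..<m} \<rightarrow>\<^sub>E F. restrict (($$) (mat n m f)) ({..<n} \<times> {..<m}) = f"
    by (auto simp: fun_eq_iff PiE_def extensional_def restrict_def)
  show "\<forall>A\<in>mats n m. mat n m (restrict (($$) A) ({..<n} \<times> {..<m})) = A"
    by (auto simp: mats_def mat_eq_iff)
  show "(\<lambda>f. mat n m f) ` ({..<n} \<times> {..<m} \<rightarrow>\<^sub>E F) \<subseteq> mats n m"
    by (rule image_subsetI) (auto simp: mats_def)
  show "(\<lambda>A. restrict (($$) A) ({..<n} \<times> {..<m})) ` mats n m \<subseteq> {..<n} \<times> {..<m} \<rightarrow>\<^sub>E F"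
    by (rule image_subsetI) (auto simp: mats_def split: if_splits)
qed

lemma finite_vecs: "finite (vecs n)" and card_vecs: "card (vecs n) = Q ^ n"
proof -
  show "finite (vecs n)"
    using bij_betw_finite[OF bij_betw_vecs[of n]] finite_F by (simp add: finite_PiE)
  show "card (vecs n) = Q ^ n"
    using bij_betw_same_card[OF bij_betw_vecs[of n]] by (simp add: card_PiE)
qed

lemma finite_mats: "finite (mats n m)" and card_mats: "card (mats n m) = Q ^ (n * m)"
proof -
  show "finite (mats n m)"
    using bij_betw_finite[OF bij_betw_mats[of n m]] finite_F by (simp add: finite_PiE)
  show "card (mats n m) = Q ^ (n * m)"
    using bij_betw_same_card[OF bij_betw_mats[of n m]] by (simp add: card_PiE card_cartesian_product)
qed

lemma zero_mats: "0\<^sub>m n m \<in> mats n m"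
  by (simp add: mats_def zero_F)

lemma one_mats: "1\<^sub>m n \<in> mats n n"
  by (simp add: mats_def zero_F one_F)

lemma add_mats: "A \<in> mats n m \<Longrightarrow> B \<in> mats n m \<Longrightarrow> A + B \<in> mats n m"
  by (auto simp: mats_def add_F)

lemma diff_mats: "A \<in> mats n m \<Longrightarrow> B \<in> mats n m \<Longrightarrow> A - B \<in> mats n m"
  by (auto simp: mats_def diff_F)

lemma smult_mats: "c \<in> F \<Longrightarrow> A \<in> mats n m \<Longrightarrow> c \<cdot>\<^sub>m A \<in> mats n m"
  by (auto simp: mats_def mult_F)

lemma mult_mats: "A \<in> mats n k \<Longrightarrow> B \<in> mats k m \<Longrightarrow> A * B \<in> mats n m"
  by (auto simp: mats_def scalar_prod_def intro!: sum_F mult_F)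

lemma det_F:
  assumes "A \<in> mats n n" shows "det A \<in> F"
proof -
  have "signof p * (\<Prod>i = 0..<n. A $$ (i, p i)) \<in> F" if "p permutes {0..<n}" for p
  proof (intro mult_F prod_F)
    show "signof p \<in> F" by (cases "sign p = 1") (simp_all add: sign_def one_F minus_F)
    fix i assume "i \<in> {0..<n}"
    then show "A $$ (i, p i) \<in> F"
      using permutes_in_image[OF that, of i] by (intro mats_index[OF assms]) auto
  qed
  then show ?thesis using mats_carrier[OF assms] unfolding det_def by (auto intro!: sum_F)
qed

lemma mtrace_F: "A \<in> mats n n \<Longrightarrow> mtrace A \<in> F"
  unfolding mtrace_def by (auto simp: mats_def intro!: sum_F)

text \<open>The inverse of b over the ambient field gives injectivity; finiteness then yields
  surjectivity without control over the entries of that inverse.\<close>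

lemma bij_betw_mult_mats:
  assumes b: "b \<in> mats n n" and "det b \<noteq> 0"
  shows "bij_betw (\<lambda>x. b * x) (mats n m) (mats n m)"
proof (rule bij_betw_endo[OF finite_mats])
  show "b * x \<in> mats n m" if "x \<in> mats n m" for x using mult_mats[OF b that] .
  have bc: "b \<in> carrier_mat n n" by (rule mats_carrier[OF b])
  obtain c where c: "c \<in> carrier_mat n n" "c * b = 1\<^sub>m n"
    using det_non_zero_imp_unit[OF bc assms(2)] unfolding Units_def ring_mat_def by auto
  show "inj_on (\<lambda>x. b * x) (mats n m)"
  proof (rule inj_onI)
    fix x y assume "x \<in> mats n m" "y \<in> mats n m" and eq: "b * x = b * y"
    then have xy: "x \<in> carrier_mat n m" "y \<in> carrier_mat n m" by (auto dest: mats_carrier)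
    have "x = c * (b * x)" using c bc xy(1) by (simp flip: assoc_mult_mat)
    also have "\<dots> = c * (b * y)" unfolding eq ..
    also have "\<dots> = y" using c bc xy(2) by (simp flip: assoc_mult_mat)
    finally show "x = y" .
  qed
qed

text \<open>
  The kernel vector has to be found with entries in \<open>F\<close>, so it comes from the pigeonhole principle on the
  finite set of matrices over \<open>F\<close>.
\<close>

lemma singular_kernel:
  assumes x: "x \<in> mats n n" and "det x = 0"
  obtains w where "w \<in> vecs n" "w \<noteq> 0\<^sub>v n" "x *\<^sub>v w = 0\<^sub>v n"
proof -
  have xc: "x \<in> carrier_mat n n" by (rule mats_carrier[OF x])
  have "\<not> inj_on (\<lambda>y. x * y) (mats n n)"
  proof
    assume "inj_on (\<lambda>y. x * y) (mats n n)"
    then have "bij_betw (\<lambda>y. x * y) (mats n n) (mats n n)"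
      using mult_mats[OF x] by (intro bij_betw_endo[OF finite_mats]) auto
    then obtain y where y: "y \<in> mats n n" "x * y = 1\<^sub>m n"
      using one_mats[of n] unfolding bij_betw_def by (metis imageE)
    have "det x * det y = 1" using det_mult[OF xc mats_carrier[OF y(1)]] y(2) by simp
    then show False using assms(2) by simp
  qed
  then obtain y z where yz: "y \<in> mats n n" "z \<in> mats n n" "x * y = x * z" "y \<noteq> z"
    unfolding inj_on_def by blast
  have yzc: "y \<in> carrier_mat n n" "z \<in> carrier_mat n n" using yz mats_carrier by auto
  obtain i j where ij: "i < n" "j < n" "y $$ (i, j) \<noteq> z $$ (i, j)"
    using yz(4) yzc by (auto simp: mat_eq_iff)
  let ?w = "col (y - z) j"
  have mc: "y - z \<in> carrier_mat n n" by (rule minus_carrier_mat[OF yzc(2)])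
  show ?thesis
  proof
    show "?w \<in> vecs n" using diff_mats[OF yz(1,2)] ij(2) carrier_matD[OF mc]
      by (auto simp: vecs_def mats_def simp del: index_minus_mat)
    show "?w \<noteq> 0\<^sub>v n"
    proof
      assume "?w = 0\<^sub>v n"
      then have "?w $ i = 0" using ij(1) by simp
      then show False using ij yzc by simp
    qed
    have "x * (y - z) = 0\<^sub>m n n"
      using mult_minus_distrib_mat[OF xc yzc] yz(3) xc yzc by (simp add: minus_r_inv_mat[of _ n n])
    then have "col (x * (y - z)) j = 0\<^sub>v n" using ij(2) by simp
    then show "x *\<^sub>v ?w = 0\<^sub>v n" using col_mult2[OF xc mc ij(2)] by simp
  qed
qed

text \<open>If \<open>w $ j\<close> is nonzero, adding s to column j of x changes x w by a nonzero
  multiple of s. When x w = 0, the vector s and then the matrix x can be recovered from the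
  sum.\<close>

lemma card_annihilating_mats:
  assumes w: "w \<in> vecs n" "w \<noteq> 0\<^sub>v n"
  shows "card {x \<in> mats n n. x *\<^sub>v w = 0\<^sub>v n} * Q ^ n \<le> Q ^ (n * n)"
proof -
  let ?A = "{x \<in> mats n n. x *\<^sub>v w = 0\<^sub>v n}"
  have wc: "w \<in> carrier_vec n" using w(1) by (simp add: vecs_def)
  obtain j where j: "j < n" "w $ j \<noteq> 0" using w(2) wc by (auto simp: vec_eq_iff)
  define E where "E = (\<lambda>s :: 'k vec. mat n n (\<lambda>(i, j'). if j' = j then s $ i else 0))"
  have Ec: "E s \<in> carrier_mat n n" for s by (simp add: E_def)
  have Ew: "E s *\<^sub>v w = (w $ j) \<cdot>\<^sub>v s" if "s \<in> carrier_vec n" for s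
  proof (rule eq_vecI)
    fix i assume i: "i < dim_vec (w $ j \<cdot>\<^sub>v s)"
    then have "(E s *\<^sub>v w) $ i = (\<Sum>j'\<in>{0..<n}. (if j' = j then s $ i else 0) * w $ j')"
      using that wc by (simp add: E_def scalar_prod_def)
    also have "\<dots> = (\<Sum>j'\<in>{0..<n}. if j' = j then s $ i * w $ j else 0)" by (intro sum.cong) auto
    also have "\<dots> = s $ i * w $ j" using j(1) by simp
    finally show "(E s *\<^sub>v w) $ i = (w $ j \<cdot>\<^sub>v s) $ i" using i by (simp add: mult.commute)
  qed (use that in \<open>simp add: E_def\<close>)
  have "card (?A \<times> vecs n) \<le> card (mats n n)"
  proof (rule card_inj_on_le[of "\<lambda>(x, s). x + E s"])
    show "inj_on (\<lambda>(x, s). x + E s) (?A \<times> vecs n)"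
    proof (rule inj_onI)
      fix p p' assume p: "p \<in> ?A \<times> vecs n" "p' \<in> ?A \<times> vecs n"
        and eq: "(\<lambda>(x, s). x + E s) p = (\<lambda>(x, s). x + E s) p'"
      obtain x s x' s' where ps: "p = (x, s)" "p' = (x', s')" by (cases p, cases p') blast
      have x: "x \<in> carrier_mat n n" "x' \<in> carrier_mat n n" "x *\<^sub>v w = 0\<^sub>v n" "x' *\<^sub>v w = 0\<^sub>v n"
        and s: "s \<in> carrier_vec n" "s' \<in> carrier_vec n"
        using p unfolding ps by (auto simp: mats_def vecs_def)
      have "(x + E s) *\<^sub>v w = (w $ j) \<cdot>\<^sub>v s"
        using add_mult_distrib_mat_vec[OF x(1) Ec wc] x(3) Ew[OF s(1)] s(1) by simp
      moreover have "(x' + E s') *\<^sub>v w = (w $ j) \<cdot>\<^sub>v s'"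
        using add_mult_distrib_mat_vec[OF x(2) Ec wc] x(4) Ew[OF s(2)] s(2) by simp
      ultimately have ws: "(w $ j) \<cdot>\<^sub>v s = (w $ j) \<cdot>\<^sub>v s'" using eq unfolding ps by simp
      have "s = s'"
      proof (rule eq_vecI)
        fix i assume i: "i < dim_vec s'"
        have "((w $ j) \<cdot>\<^sub>v s) $ i = ((w $ j) \<cdot>\<^sub>v s') $ i" unfolding ws ..
        then show "s $ i = s' $ i" using i s j(2) by simp
      qed (use s in simp)
      moreover have "x = x'"
      proof (rule eq_matI)
        fix a b assume ab: "a < dim_row x'" "b < dim_col x'"
        have "(x + E s) $$ (a, b) = (x' + E s) $$ (a, b)" using eq \<open>s = s'\<close> unfolding ps by simp
        then show "x $$ (a, b) = x' $$ (a, b)" using ab x Ec[of s] by simp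
      qed (use x in auto)
      ultimately show "p = p'" unfolding ps by simp
    qed
    show "(\<lambda>(x, s). x + E s) ` (?A \<times> vecs n) \<subseteq> mats n n"
    proof
      fix y assume "y \<in> (\<lambda>(x, s). x + E s) ` (?A \<times> vecs n)"
      then obtain x s where "x \<in> mats n n" "s \<in> vecs n" "y = x + E s" by auto
      moreover have "E s \<in> mats n n" using \<open>s \<in> vecs n\<close> by (auto simp: E_def mats_def vecs_def zero_F)
      ultimately show "y \<in> mats n n" using add_mats by blast
    qed
  qed (rule finite_mats)
  then show ?thesis by (simp add: card_cartesian_product card_vecs card_mats)
qed

text \<open>Pairs (x, w) with x w = 0 and w nonzero are counted in two ways: a singular x has at
  least Q - 1 such w, and each of the fewer than Q^n vectors w has at most Q^(n^2 - n) matrices. The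
  resulting density 1/(Q - 1) is crude but sufficient.\<close>

lemma card_singular_mats: "card {x \<in> mats n n. det x = 0} * (Q - 1) \<le> Q ^ (n * n)"
proof -
  let ?S = "{x \<in> mats n n. det x = 0}" and ?W = "vecs n - {0\<^sub>v n}"
  let ?P = "\<lambda>x. {w \<in> ?W. x *\<^sub>v w = 0\<^sub>v n}"
  have fin: "finite ?S" "finite ?W" using finite_mats finite_vecs by auto
  have kernel: "Q - 1 \<le> card (?P x)" if x: "x \<in> ?S" for x
  proof -
    obtain w where w: "w \<in> vecs n" "w \<noteq> 0\<^sub>v n" "x *\<^sub>v w = 0\<^sub>v n"
      using singular_kernel[of x n] x by auto
    have wc: "w \<in> carrier_vec n" using w(1) by (simp add: vecs_def)
    have xc: "x \<in> carrier_mat n n" using x mats_carrier by blast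
    obtain j where j: "j < n" "w $ j \<noteq> 0" using w(2) wc by (auto simp: vec_eq_iff)
    have "card (F - {0}) \<le> card (?P x)"
    proof (rule card_inj_on_le[of "\<lambda>c. c \<cdot>\<^sub>v w"])
      show "inj_on (\<lambda>c. c \<cdot>\<^sub>v w) (F - {0})"
      proof (rule inj_onI)
        fix c c' assume "c \<cdot>\<^sub>v w = c' \<cdot>\<^sub>v w"
        then have "(c \<cdot>\<^sub>v w) $ j = (c' \<cdot>\<^sub>v w) $ j" by simp
        then show "c = c'" using j wc by simp
      qed
      show "(\<lambda>c. c \<cdot>\<^sub>v w) ` (F - {0}) \<subseteq> ?P x"
      proof (rule image_subsetI)
        fix c assume c: "c \<in> F - {0}"
        have "x *\<^sub>v (c \<cdot>\<^sub>v w) = c \<cdot>\<^sub>v 0\<^sub>v n" using mult_mat_vec[OF xc wc, of c] w(3) by simp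
        also have "\<dots> = 0\<^sub>v n" by (rule eq_vecI) simp_all
        finally have "x *\<^sub>v (c \<cdot>\<^sub>v w) = 0\<^sub>v n" .
        moreover have "c \<cdot>\<^sub>v w \<noteq> 0\<^sub>v n"
        proof
          assume "c \<cdot>\<^sub>v w = 0\<^sub>v n"
          then have "(c \<cdot>\<^sub>v w) $ j = 0" using j(1) by simp
          then show False using j wc c by simp
        qed
        moreover have "c \<cdot>\<^sub>v w \<in> vecs n" using w(1) c by (auto simp: vecs_def mult_F)
        ultimately show "c \<cdot>\<^sub>v w \<in> ?P x" by blast
      qed
    qed (use fin in simp)
    then show ?thesis by (simp add: zero_F finite_F)
  qed
  have "card ?S * (Q - 1) = (\<Sum>x\<in>?S. Q - 1)" by simp
  also have "\<dots> \<le> (\<Sum>x\<in>?S. card (?P x))" by (intro sum_mono kernel)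
  also have "\<dots> \<le> (\<Sum>x\<in>mats n n. card (?P x))"
    by (intro sum_mono2 finite_mats) auto
  also have "\<dots> = (\<Sum>x\<in>mats n n. \<Sum>w\<in>?W. if x *\<^sub>v w = 0\<^sub>v n then 1 else 0)"
    using fin(2) by (intro sum.cong refl) (simp add: sum.inter_filter[symmetric])
  also have "\<dots> = (\<Sum>w\<in>?W. \<Sum>x\<in>mats n n. if x *\<^sub>v w = 0\<^sub>v n then 1 else 0)" by (rule sum.swap)
  also have "\<dots> = (\<Sum>w\<in>?W. card {x \<in> mats n n. x *\<^sub>v w = 0\<^sub>v n})"
    by (intro sum.cong refl) (simp add: sum.inter_filter[symmetric] finite_mats)
  finally have "card ?S * (Q - 1) \<le> (\<Sum>w\<in>?W. card {x \<in> mats n n. x *\<^sub>v w = 0\<^sub>v n})" .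
  then have "card ?S * (Q - 1) * Q ^ n \<le> (\<Sum>w\<in>?W. card {x \<in> mats n n. x *\<^sub>v w = 0\<^sub>v n}) * Q ^ n"
    by (rule mult_right_mono) simp
  also have "\<dots> = (\<Sum>w\<in>?W. card {x \<in> mats n n. x *\<^sub>v w = 0\<^sub>v n} * Q ^ n)" by (rule sum_distrib_right)
  also have "\<dots> \<le> (\<Sum>w\<in>?W. Q ^ (n * n))" by (intro sum_mono card_annihilating_mats) auto
  also have "\<dots> \<le> Q ^ n * Q ^ (n * n)"
  proof -
    have "card ?W \<le> Q ^ n" unfolding card_vecs[symmetric] by (rule card_mono[OF finite_vecs]) blast
    then show ?thesis by simp
  qed
  finally show ?thesis using Q_gt_1 by (simp add: mult.commute)
qed

section \<open>Splitting off the first row and column\<close>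

definition blk :: "'k \<Rightarrow> 'k mat \<Rightarrow> 'k mat \<Rightarrow> 'k mat \<Rightarrow> 'k mat" where
  "blk a \<beta> \<gamma> D = four_block_mat (mat 1 1 (\<lambda>_. a)) \<beta> \<gamma> D"

lemma bij_betw_blk:
  "bij_betw (\<lambda>(a, \<beta>, \<gamma>, D). blk a \<beta> \<gamma> D) (F \<times> mats 1 n \<times> mats n 1 \<times> mats n n) (mats (Suc n) (Suc n))"
proof (rule bij_betw_byWitness[where f' = "\<lambda>x. (x $$ (0, 0), mat 1 n (\<lambda>(i, j). x $$ (0, Suc j)),
    mat n 1 (\<lambda>(i, j). x $$ (Suc i, 0)), mat n n (\<lambda>(i, j). x $$ (Suc i, Suc j)))"], safe)
  fix a \<beta> \<gamma> D assume *: "a \<in> F" "\<beta> \<in> mats 1 n" "\<gamma> \<in> mats n 1" "D \<in> mats n n"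
  have dims: "dim_row \<beta> = 1" "dim_col \<beta> = n" "dim_row \<gamma> = n" "dim_col \<gamma> = 1" "dim_row D = n" "dim_col D = n"
    using * unfolding mats_def by auto
  show "blk a \<beta> \<gamma> D $$ (0, 0) = a" by (simp add: blk_def dims)
  show "mat 1 n (\<lambda>(i, j). blk a \<beta> \<gamma> D $$ (0, Suc j)) = \<beta>"
    by (rule eq_matI) (simp_all add: blk_def dims)
  show "mat n 1 (\<lambda>(i, j). blk a \<beta> \<gamma> D $$ (Suc i, 0)) = \<gamma>"
    by (rule eq_matI) (simp_all add: blk_def dims)
  show "mat n n (\<lambda>(i, j). blk a \<beta> \<gamma> D $$ (Suc i, Suc j)) = D"
    by (rule eq_matI) (simp_all add: blk_def dims)
  show "blk a \<beta> \<gamma> D \<in> mats (Suc n) (Suc n)"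
  proof -
    have "blk a \<beta> \<gamma> D $$ (i, j) \<in> F" if "i < Suc n" "j < Suc n" for i j
      using that * mats_index[OF *(2), of 0 "j - 1"] mats_index[OF *(3), of "i - 1" 0] mats_index[OF *(4), of "i - 1" "j - 1"]
      by (cases i; cases j) (simp_all add: blk_def dims)
    moreover have "blk a \<beta> \<gamma> D \<in> carrier_mat (Suc n) (Suc n)"
      unfolding blk_def by (rule carrier_matI) (simp_all add: dims)
    ultimately show ?thesis unfolding mats_def by simp
  qed
next
  fix x assume x: "x \<in> mats (Suc n) (Suc n)"
  have dims: "dim_row x = Suc n" "dim_col x = Suc n" using x unfolding mats_def by auto
  show "blk (x $$ (0, 0)) (mat 1 n (\<lambda>(i, j). x $$ (0, Suc j))) (mat n 1 (\<lambda>(i, j). x $$ (Suc i, 0)))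
      (mat n n (\<lambda>(i, j). x $$ (Suc i, Suc j))) = x"
    by (rule eq_matI) (auto simp: blk_def dims less_Suc_eq_0_disj)
  show "x $$ (0, 0) \<in> F" by (rule mats_index[OF x]) simp_all
  show "mat 1 n (\<lambda>(i, j). x $$ (0, Suc j)) \<in> mats 1 n"
    using mats_index[OF x] unfolding mats_def by auto
  show "mat n 1 (\<lambda>(i, j). x $$ (Suc i, 0)) \<in> mats n 1"
    using mats_index[OF x] unfolding mats_def by auto
  show "mat n n (\<lambda>(i, j). x $$ (Suc i, Suc j)) \<in> mats n n"
    using mats_index[OF x] unfolding mats_def by auto
qed

lemma sum_mats_Suc:
  "(\<Sum>x\<in>mats (Suc n) (Suc n). f x) =
    (\<Sum>a\<in>F. \<Sum>\<beta>\<in>mats 1 n. \<Sum>\<gamma>\<in>mats n 1. \<Sum>D\<in>mats n n. f (blk a \<beta> \<gamma> D))"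
  by (simp add: sum.reindex_bij_betw[OF bij_betw_blk, symmetric] sum.cartesian_product case_prod_beta)

lemma mtrace_blk:
  assumes "D \<in> carrier_mat n n" shows "mtrace (blk a \<beta> \<gamma> D) = a + mtrace D"
proof -
  have "mtrace (blk a \<beta> \<gamma> D) = (\<Sum>i<Suc n. blk a \<beta> \<gamma> D $$ (i, i))"
    using assms unfolding mtrace_def by (simp add: blk_def)
  also have "\<dots> = a + (\<Sum>i<n. D $$ (i, i))"
    unfolding sum.lessThan_Suc_shift using assms by (simp add: blk_def)
  finally show ?thesis using assms unfolding mtrace_def by simp
qed

text \<open>D is the Schur complement of the corner: the matrix is a unipotent lower block
  triangular matrix times an upper one with diagonal blocks a and D. The lower right block is
  expressed through D because the matrix sum is going to be reindexed by D.\<close>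

lemma det_blk_schur:
  assumes "a \<noteq> 0" and c: "\<beta> \<in> carrier_mat 1 n" "\<gamma> \<in> carrier_mat n 1" "D \<in> carrier_mat n n"
  shows "det (blk a \<beta> \<gamma> (D + inverse a \<cdot>\<^sub>m (\<gamma> * \<beta>))) = a * det D"
proof -
  let ?a = "mat 1 1 (\<lambda>_. a)" and ?L = "four_block_mat (1\<^sub>m 1) (0\<^sub>m 1 n) (inverse a \<cdot>\<^sub>m \<gamma>) (1\<^sub>m n)"
  let ?U = "four_block_mat ?a \<beta> (0\<^sub>m n 1) D"
  have sc: "inverse a \<cdot>\<^sub>m \<gamma> \<in> carrier_mat n 1" using c by simp
  have "?L * ?U = four_block_mat (1\<^sub>m 1 * ?a + 0\<^sub>m 1 n * 0\<^sub>m n 1) (1\<^sub>m 1 * \<beta> + 0\<^sub>m 1 n * D)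
      (inverse a \<cdot>\<^sub>m \<gamma> * ?a + 1\<^sub>m n * 0\<^sub>m n 1) (inverse a \<cdot>\<^sub>m \<gamma> * \<beta> + 1\<^sub>m n * D)"
    by (rule mult_four_block_mat) (use c in auto)
  also have "1\<^sub>m 1 * ?a + 0\<^sub>m 1 n * 0\<^sub>m n 1 = ?a" by (rule eq_matI) (auto simp: scalar_prod_def)
  also have "1\<^sub>m 1 * \<beta> + 0\<^sub>m 1 n * D = \<beta>" using c by simp
  also have "inverse a \<cdot>\<^sub>m \<gamma> * ?a + 1\<^sub>m n * 0\<^sub>m n 1 = \<gamma>"
    using c \<open>a \<noteq> 0\<close> by (intro eq_matI) (auto simp: scalar_prod_def)
  also have "inverse a \<cdot>\<^sub>m \<gamma> * \<beta> + 1\<^sub>m n * D = D + inverse a \<cdot>\<^sub>m (\<gamma> * \<beta>)"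
    using c by (simp add: mult_smult_assoc_mat[OF c(2,1)] comm_add_mat[of D n n])
  finally have "blk a \<beta> \<gamma> (D + inverse a \<cdot>\<^sub>m (\<gamma> * \<beta>)) = ?L * ?U" unfolding blk_def ..
  moreover have "det (?L * ?U) = det ?L * det ?U"
    by (rule det_mult[of _ "1 + n"]) (use c sc in auto)
  moreover have "det ?L = det (1\<^sub>m 1) * det (1\<^sub>m n)"
    by (rule det_four_block_mat_upper_right_zero[of _ 1 _ n]) (use sc in auto)
  moreover have "det ?U = det ?a * det D"
    by (rule det_four_block_mat_lower_left_zero_col) (use c in auto)
  moreover have "det ?a = a" by (simp add: det_single)
  ultimately show ?thesis by simp
qed

text \<open>With a zero corner, scaling \<beta> scales the whole first row and leaves the trace
  alone. This makes the terms with a = 0 cancel in the recursion.\<close>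

lemma det_blk_scale:
  assumes c: "\<beta> \<in> carrier_mat 1 n" "\<gamma> \<in> carrier_mat n 1" "D \<in> carrier_mat n n"
  shows "det (blk 0 (s \<cdot>\<^sub>m \<beta>) \<gamma> D) = s * det (blk 0 \<beta> \<gamma> D)"
proof -
  let ?s = "mat 1 1 (\<lambda>_. s)" and ?z = "mat 1 1 (\<lambda>_. 0)"
  let ?L = "four_block_mat ?s (0\<^sub>m 1 n) (0\<^sub>m n 1) (1\<^sub>m n)"
  have "?L * blk 0 \<beta> \<gamma> D = four_block_mat (?s * ?z + 0\<^sub>m 1 n * \<gamma>) (?s * \<beta> + 0\<^sub>m 1 n * D)
      (0\<^sub>m n 1 * ?z + 1\<^sub>m n * \<gamma>) (0\<^sub>m n 1 * \<beta> + 1\<^sub>m n * D)"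
    unfolding blk_def by (rule mult_four_block_mat) (use c in auto)
  also have "?s * ?z + 0\<^sub>m 1 n * \<gamma> = ?z" using c by (intro eq_matI) (auto simp: scalar_prod_def)
  also have "?s * \<beta> + 0\<^sub>m 1 n * D = s \<cdot>\<^sub>m \<beta>" using c by (intro eq_matI) (auto simp: scalar_prod_def)
  also have "0\<^sub>m n 1 * ?z + 1\<^sub>m n * \<gamma> = \<gamma>" using c by (intro eq_matI) (auto simp: scalar_prod_def)
  also have "0\<^sub>m n 1 * \<beta> + 1\<^sub>m n * D = D" using c by (intro eq_matI) auto
  finally have "blk 0 (s \<cdot>\<^sub>m \<beta>) \<gamma> D = ?L * blk 0 \<beta> \<gamma> D" unfolding blk_def ..
  moreover have "det (?L * blk 0 \<beta> \<gamma> D) = det ?L * det (blk 0 \<beta> \<gamma> D)"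
    by (rule det_mult[of _ "1 + n"]) (use c in \<open>auto simp: blk_def\<close>)
  moreover have "det ?L = det ?s * det (1\<^sub>m n)"
    by (rule det_four_block_mat_lower_left_zero_col) auto
  moreover have "det ?s = s" by (simp add: det_single)
  ultimately show ?thesis by simp
qed

text \<open>The value 0 at 0 restricts sums over all matrices to the invertible ones.\<close>

definition mult_char :: "('k \<Rightarrow> complex) \<Rightarrow> bool" where
  "mult_char \<theta> \<longleftrightarrow> \<theta> 0 = 0 \<and> (\<forall>x\<in>F. \<forall>y\<in>F. \<theta> (x * y) = \<theta> x * \<theta> y) \<and> (\<forall>x\<in>F - {0}. norm (\<theta> x) = 1)"

end

section \<open>Gauss sums over the field and over matrices\<close>

locale finite_subfield_char = finite_subfield F for F :: "'k::field set" +
  fixes \<psi> :: "'k \<Rightarrow> complex"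
  assumes psi_add: "\<And>x y. x \<in> F \<Longrightarrow> y \<in> F \<Longrightarrow> \<psi> (x + y) = \<psi> x * \<psi> y"
    and psi_norm: "\<And>x. x \<in> F \<Longrightarrow> norm (\<psi> x) = 1"
    and psi_nontrivial: "\<exists>x\<in>F. \<psi> x \<noteq> 1"
begin

lemma psi_0: "\<psi> 0 = 1"
proof -
  have "\<psi> 0 * \<psi> 0 = \<psi> 0 * 1" using psi_add[OF zero_F zero_F] by simp
  moreover have "\<psi> 0 \<noteq> 0" using psi_norm[OF zero_F] by auto
  ultimately show ?thesis by simp
qed

lemma psi_minus: "x \<in> F \<Longrightarrow> \<psi> (- x) = cnj (\<psi> x)"
proof -
  assume x: "x \<in> F"
  have "\<psi> x * \<psi> (- x) = 1" using psi_add[OF x minus_F[OF x]] psi_0 by simp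
  moreover have "\<psi> x * cnj (\<psi> x) = 1" using psi_norm[OF x] by (simp add: complex_norm_square[symmetric])
  moreover have "\<psi> x \<noteq> 0" using psi_norm[OF x] by auto
  ultimately show ?thesis by (metis mult_cancel_left)
qed

lemma psi_scaled_nontrivial:
  assumes "b \<in> F" "b \<noteq> 0" obtains t where "t \<in> F" "\<psi> (b * t) \<noteq> 1"
proof -
  obtain x where x: "x \<in> F" "\<psi> x \<noteq> 1" using psi_nontrivial by blast
  show ?thesis by (rule that[of "x / b"]) (use x assms in \<open>auto intro: divide_F\<close>)
qed

lemma sum_psi_scaled:
  assumes b: "b \<in> F" shows "(\<Sum>x\<in>F. \<psi> (b * x)) = (if b = 0 then of_nat Q else 0)"
proof (cases "b = 0")
  case False
  obtain t where t: "t \<in> F" "\<psi> (b * t) \<noteq> 1" using psi_scaled_nontrivial[OF b False] by blast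
  have "(\<Sum>x\<in>F. \<psi> (b * x)) = 0"
  proof (rule sum_eq_0_of_scaling[of "\<lambda>x. t + x"])
    show "bij_betw (\<lambda>x. t + x) F F"
      using add_F[OF t(1)] by (intro bij_betw_endo[OF finite_F]) auto
    show "\<psi> (b * (t + x)) = \<psi> (b * t) * \<psi> (b * x)" if "x \<in> F" for x
      unfolding distrib_left using that t(1) b by (intro psi_add mult_F)
  qed (rule t(2))
  then show ?thesis using False by simp
qed (simp add: psi_0)

definition gauss_sum :: "('k \<Rightarrow> complex) \<Rightarrow> complex" where
  "gauss_sum \<theta> = (\<Sum>x\<in>F. \<theta> x * \<psi> x)"

definition matrix_sum :: "('k \<Rightarrow> complex) \<Rightarrow> nat \<Rightarrow> 'k mat \<Rightarrow> complex" where
  "matrix_sum \<theta> n b = (\<Sum>x\<in>mats n n. \<theta> (det x) * \<psi> (mtrace (b * x)))"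

lemma bij_betw_mult_F: "c \<in> F \<Longrightarrow> c \<noteq> 0 \<Longrightarrow> bij_betw (\<lambda>x. c * x) F F"
  using mult_F by (intro bij_betw_endo[OF finite_F]) (auto intro: inj_onI)

lemma mult_char_0: "mult_char \<theta> \<Longrightarrow> \<theta> 0 = 0"
  and mult_char_mult: "mult_char \<theta> \<Longrightarrow> x \<in> F \<Longrightarrow> y \<in> F \<Longrightarrow> \<theta> (x * y) = \<theta> x * \<theta> y"
  and mult_char_norm: "mult_char \<theta> \<Longrightarrow> x \<in> F \<Longrightarrow> x \<noteq> 0 \<Longrightarrow> norm (\<theta> x) = 1"
  by (auto simp: mult_char_def)

lemma mult_char_1: "mult_char \<theta> \<Longrightarrow> \<theta> 1 = 1"
proof -
  assume \<theta>: "mult_char \<theta>"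
  have "\<theta> 1 * \<theta> 1 = \<theta> 1 * 1" using mult_char_mult[OF \<theta> one_F one_F] by simp
  moreover have "\<theta> 1 \<noteq> 0" using mult_char_norm[OF \<theta> one_F] by auto
  ultimately show ?thesis by simp
qed

lemma sum_mult_char:
  assumes \<theta>: "mult_char \<theta>" and c: "c \<in> F" "c \<noteq> 0" "\<theta> c \<noteq> 1"
  shows "(\<Sum>x\<in>F. \<theta> x) = 0"
  by (rule sum_eq_0_of_scaling[OF bij_betw_mult_F[OF c(1,2)] _ c(3)])
    (rule mult_char_mult[OF \<theta> c(1)])

text \<open>The sum twisted by y equals cnj (\<theta> y) times the Gauss sum, for y = 0 as well,
  where both sides vanish because \<theta> is nontrivial. Expanding the square of the modulus then
  leaves the additive orthogonality relation.\<close>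

lemma norm_gauss_sum:
  assumes \<theta>: "mult_char \<theta>" and c: "c \<in> F" "c \<noteq> 0" "\<theta> c \<noteq> 1"
  shows "(norm (gauss_sum \<theta>))\<^sup>2 = real Q"
proof -
  have tw: "(\<Sum>x\<in>F. \<theta> x * \<psi> (y * x)) = cnj (\<theta> y) * gauss_sum \<theta>" if y: "y \<in> F" for y
  proof (cases "y = 0")
    case True
    then show ?thesis using sum_mult_char[OF \<theta> c] mult_char_0[OF \<theta>] psi_0 by simp
  next
    case False
    have unit: "\<theta> y * cnj (\<theta> y) = 1" using mult_char_norm[OF \<theta> y False] by (simp add: complex_norm_square[symmetric])
    have cancel: "cnj (\<theta> y) * (\<theta> y * z) = z" for z
    proof -
      have "cnj (\<theta> y) * (\<theta> y * z) = (\<theta> y * cnj (\<theta> y)) * z" by (simp only: mult_ac)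
      then show ?thesis unfolding unit by simp
    qed
    have "(\<Sum>x\<in>F. \<theta> x * \<psi> (y * x)) = (\<Sum>x\<in>F. cnj (\<theta> y) * (\<theta> (y * x) * \<psi> (y * x)))"
      by (intro sum.cong refl) (simp only: mult_char_mult[OF \<theta> y] mult.assoc cancel)
    also have "\<dots> = cnj (\<theta> y) * gauss_sum \<theta>"
      unfolding sum_distrib_left[symmetric] gauss_sum_def
      by (simp only: sum.reindex_bij_betw[OF bij_betw_mult_F[OF y False], of "\<lambda>x. \<theta> x * \<psi> x"])
    finally show ?thesis .
  qed
  have "gauss_sum \<theta> * cnj (gauss_sum \<theta>) = (\<Sum>y\<in>F. cnj (\<psi> y) * (cnj (\<theta> y) * gauss_sum \<theta>))"
    unfolding gauss_sum_def by (simp add: sum_distrib_left sum_distrib_right cnj_sum ac_simps)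
  also have "\<dots> = (\<Sum>y\<in>F. \<psi> (- y) * (\<Sum>x\<in>F. \<theta> x * \<psi> (y * x)))"
    by (intro sum.cong refl) (simp add: tw psi_minus)
  also have "\<dots> = (\<Sum>y\<in>F. \<Sum>x\<in>F. \<theta> x * \<psi> ((x - 1) * y))"
    unfolding sum_distrib_left
  proof (intro sum.cong refl)
    fix y x assume yx: "y \<in> F" "x \<in> F"
    have "\<psi> ((x - 1) * y) = \<psi> (y * x + - y)" by (simp add: algebra_simps)
    also have "\<dots> = \<psi> (y * x) * \<psi> (- y)" using yx by (intro psi_add mult_F minus_F)
    finally show "\<psi> (- y) * (\<theta> x * \<psi> (y * x)) = \<theta> x * \<psi> ((x - 1) * y)" by simp
  qed
  also have "\<dots> = (\<Sum>x\<in>F. \<Sum>y\<in>F. \<theta> x * \<psi> ((x - 1) * y))" by (rule sum.swap)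
  also have "\<dots> = (\<Sum>x\<in>F. if x = 1 then of_nat Q else 0)"
  proof (intro sum.cong refl)
    fix x assume x: "x \<in> F"
    show "(\<Sum>y\<in>F. \<theta> x * \<psi> ((x - 1) * y)) = (if x = 1 then of_nat Q else 0)"
      unfolding sum_distrib_left[symmetric] sum_psi_scaled[OF diff_F[OF x one_F]]
      by (simp add: mult_char_1[OF \<theta>])
  qed
  also have "\<dots> = of_nat Q" using finite_F one_F by simp
  finally have "complex_of_real ((norm (gauss_sum \<theta>))\<^sup>2) = complex_of_real (real Q)"
    unfolding complex_norm_square by simp
  then show ?thesis unfolding of_real_eq_iff .
qed

lemma matrix_sum_invertible:
  assumes \<theta>: "mult_char \<theta>" and b: "b \<in> mats n n" "det b \<noteq> 0"
  shows "matrix_sum \<theta> n b = cnj (\<theta> (det b)) * matrix_sum \<theta> n (1\<^sub>m n)"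
proof -
  have "\<theta> (det b) * cnj (\<theta> (det b)) = 1"
    using mult_char_norm[OF \<theta> det_F[OF b(1)] b(2)] by (simp add: complex_norm_square[symmetric])
  then have "matrix_sum \<theta> n b = (\<Sum>x\<in>mats n n. cnj (\<theta> (det b)) * (\<theta> (det b) * \<theta> (det x) * \<psi> (mtrace (b * x))))"
    unfolding matrix_sum_def by (intro sum.cong refl) (simp add: ac_simps)
  also have "\<dots> = (\<Sum>x\<in>mats n n. cnj (\<theta> (det b)) * (\<theta> (det (b * x)) * \<psi> (mtrace (1\<^sub>m n * (b * x)))))"
  proof (intro sum.cong refl)
    fix x assume x: "x \<in> mats n n"
    have "\<theta> (det (b * x)) = \<theta> (det b) * \<theta> (det x)"
      unfolding det_mult[OF mats_carrier[OF b(1)] mats_carrier[OF x]]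
      by (rule mult_char_mult[OF \<theta> det_F[OF b(1)] det_F[OF x]])
    moreover have "1\<^sub>m n * (b * x) = b * x" by (rule left_mult_one_mat[OF mats_carrier[OF mult_mats[OF b(1) x]]])
    ultimately show "cnj (\<theta> (det b)) * (\<theta> (det b) * \<theta> (det x) * \<psi> (mtrace (b * x))) =
        cnj (\<theta> (det b)) * (\<theta> (det (b * x)) * \<psi> (mtrace (1\<^sub>m n * (b * x))))" by simp
  qed
  also have "\<dots> = cnj (\<theta> (det b)) * matrix_sum \<theta> n (1\<^sub>m n)"
    unfolding sum_distrib_left[symmetric] matrix_sum_def
    by (simp only: sum.reindex_bij_betw[OF bij_betw_mult_mats[OF b], of "\<lambda>x. \<theta> (det x) * \<psi> (mtrace (1\<^sub>m n * x))"])
  finally show ?thesis .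
qed

text \<open>
  If \<open>b\<close> kills a vector, some \<open>s\<close> with \<open>b s = b\<close> has prescribed determinant, and the substitution
  \<open>x \<mapsto> s x\<close> multiplies the sum by \<open>\<theta> (det s)\<close>.
\<close>

lemma matrix_sum_singular:
  assumes \<theta>: "mult_char \<theta>" and c: "c \<in> F" "c \<noteq> 0" "\<theta> c \<noteq> 1" and b: "b \<in> mats n n" "det b = 0"
  shows "matrix_sum \<theta> n b = 0"
proof -
  obtain w where w: "w \<in> vecs n" "w \<noteq> 0\<^sub>v n" "b *\<^sub>v w = 0\<^sub>v n"
    using singular_kernel[OF b] by blast
  have wc: "w \<in> carrier_vec n" and wF: "\<And>i. i < n \<Longrightarrow> w $ i \<in> F" using w(1) by (simp_all add: vecs_def)
  have bc: "b \<in> carrier_mat n n" by (rule mats_carrier[OF b(1)])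
  obtain k where k: "k < n" "w $ k \<noteq> 0" using w(2) wc by (auto simp: vec_eq_iff)
  \<comment> \<open>This column differs from the k-th unit vector by a multiple of the kernel vector
    w, so b does not see the change, and its k-th entry is c.\<close>
  define \<sigma> where "\<sigma> = unit_vec n k + ((c - 1) / w $ k) \<cdot>\<^sub>v w"
  have \<sigma>c: "\<sigma> \<in> carrier_vec n" unfolding \<sigma>_def using wc by simp
  have \<sigma>k: "\<sigma> $ k = c" unfolding \<sigma>_def using wc k by simp
  have \<sigma>F: "\<sigma> $ i \<in> F" if "i < n" for i
    unfolding \<sigma>_def using that wc k(1) wF c(1) one_F zero_F
    by (auto intro!: add_F mult_F divide_F diff_F)
  have b\<sigma>: "b *\<^sub>v \<sigma> = b *\<^sub>v unit_vec n k"
    unfolding \<sigma>_def using mult_add_distrib_mat_vec[OF bc, of "unit_vec n k" "((c - 1) / w $ k) \<cdot>\<^sub>v w"]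
      mult_mat_vec[OF bc wc, of "(c - 1) / w $ k"] w(3) bc wc
    by (simp add: vec_eq_iff)
  \<comment> \<open>The identity with column k replaced by \<sigma>; Cramer's rule reads off its
    determinant as the k-th entry of \<sigma>.\<close>
  define s where "s = replace_col (1\<^sub>m n) (1\<^sub>m n *\<^sub>v \<sigma>) k"
  have det_s: "det s = c" unfolding s_def cramer_lemma_mat[OF one_carrier_mat \<sigma>c k(1)] using \<sigma>k by simp
  have s_eq: "s = mat n n (\<lambda>(i, j). if j = k then \<sigma> $ i else if i = j then 1 else 0)"
    unfolding s_def replace_col_def using \<sigma>c by (intro eq_matI) auto
  have sc: "s \<in> carrier_mat n n" unfolding s_eq by simp
  have sF: "s \<in> mats n n" unfolding s_eq mats_def using \<sigma>F one_F zero_F by auto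
  have col_s: "col s j = (if j = k then \<sigma> else unit_vec n j)" if "j < n" for j
    unfolding s_eq using that \<sigma>c by (intro eq_vecI) (auto simp: unit_vec_def)
  have bs: "b * s = b"
  proof (rule mat_col_eqI)
    fix j assume "j < dim_col b"
    then have j: "j < n" using bc by simp
    have "col (b * s) j = b *\<^sub>v unit_vec n j"
      unfolding col_mult2[OF bc sc j] col_s[OF j] using b\<sigma> by simp
    also have "\<dots> = col b j"
      by (rule eq_vecI) (use bc j in \<open>auto simp: scalar_prod_right_unit\<close>)
    finally show "col (b * s) j = col b j" .
  qed (use bc sc in auto)
  show ?thesis unfolding matrix_sum_def
  proof (rule sum_eq_0_of_scaling[OF _ _ c(3)])
    show "bij_betw (\<lambda>x. s * x) (mats n n) (mats n n)"
      by (rule bij_betw_mult_mats[OF sF]) (simp add: det_s c(2))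
    fix x assume x: "x \<in> mats n n"
    have "b * (s * x) = b * x" using assoc_mult_mat[OF bc sc mats_carrier[OF x]] bs by simp
    moreover have "\<theta> (det (s * x)) = \<theta> c * \<theta> (det x)"
      unfolding det_mult[OF sc mats_carrier[OF x]] det_s by (rule mult_char_mult[OF \<theta> c(1) det_F[OF x]])
    ultimately show "\<theta> (det (s * x)) * \<psi> (mtrace (b * (s * x))) = \<theta> c * (\<theta> (det x) * \<psi> (mtrace (b * x)))"
      by simp
  qed
qed

text \<open>For fixed \<beta> the sum over \<gamma> is one of an additive character that is trivial
  only for \<beta> = 0, and \<beta> = 0 contributes the number of \<gamma>.\<close>

lemma sum_psi_bilinear:
  assumes a: "a \<in> F" "a \<noteq> 0"
  shows "(\<Sum>\<beta>\<in>mats 1 n. \<Sum>\<gamma>\<in>mats n 1. \<psi> (a * mtrace (\<gamma> * \<beta>))) = of_nat (Q ^ n)"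
proof -
  have tr: "mtrace (\<gamma> * \<beta>) = (\<Sum>j<n. \<gamma> $$ (j, 0) * \<beta> $$ (0, j))"
    if "\<beta> \<in> mats 1 n" "\<gamma> \<in> mats n 1" for \<beta> \<gamma>
    using mats_carrier[OF that(1)] mats_carrier[OF that(2)] unfolding mtrace_def by (simp add: scalar_prod_def)
  have inner: "(\<Sum>\<gamma>\<in>mats n 1. \<psi> (a * mtrace (\<gamma> * \<beta>))) = (if \<beta> = 0\<^sub>m 1 n then of_nat (Q ^ n) else 0)"
    if \<beta>: "\<beta> \<in> mats 1 n" for \<beta>
  proof (cases "\<beta> = 0\<^sub>m 1 n")
    case True
    then have "\<psi> (a * mtrace (\<gamma> * \<beta>)) = 1" if "\<gamma> \<in> mats n 1" for \<gamma>
      using tr[OF \<beta> that] psi_0 by simp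
    then show ?thesis using True by (simp add: card_mats)
  next
    case False
    then obtain j where j: "j < n" "\<beta> $$ (0, j) \<noteq> 0"
      using mats_carrier[OF \<beta>] by (auto simp: mat_eq_iff)
    have \<beta>j: "\<beta> $$ (0, j) \<in> F" by (rule mats_index[OF \<beta> _ j(1)]) simp
    obtain t where t: "t \<in> F" "\<psi> (a * \<beta> $$ (0, j) * t) \<noteq> 1"
      using psi_scaled_nontrivial[of "a * \<beta> $$ (0, j)"] a j(2) \<beta>j mult_F by auto
    define \<delta> where "\<delta> = mat n 1 (\<lambda>(i, _). if i = j then t else 0)"
    have \<delta>: "\<delta> \<in> mats n 1" unfolding \<delta>_def mats_def using t(1) zero_F by auto
    have "mtrace (\<delta> * \<beta>) = (\<Sum>i<n. if i = j then t * \<beta> $$ (0, j) else 0)"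
      unfolding tr[OF \<beta> \<delta>] by (intro sum.cong refl) (simp add: \<delta>_def)
    then have tr\<delta>: "mtrace (\<delta> * \<beta>) = t * \<beta> $$ (0, j)" using j(1) by simp
    have "(\<Sum>\<gamma>\<in>mats n 1. \<psi> (a * mtrace (\<gamma> * \<beta>))) = 0"
    proof (rule sum_eq_0_of_scaling[OF _ _ t(2)])
      show "bij_betw (\<lambda>\<gamma>. \<delta> + \<gamma>) (mats n 1) (mats n 1)"
      proof (rule bij_betw_endo[OF finite_mats add_mats[OF \<delta>]])
        show "inj_on (\<lambda>\<gamma>. \<delta> + \<gamma>) (mats n 1)"
        proof (rule inj_onI)
          fix x y assume xy: "x \<in> mats n 1" "y \<in> mats n 1" "\<delta> + x = \<delta> + y"
          show "x = y"
          proof (rule eq_matI)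
            fix i k assume ik: "i < dim_row y" "k < dim_col y"
            have "(\<delta> + x) $$ (i, k) = (\<delta> + y) $$ (i, k)" unfolding xy(3) ..
            then show "x $$ (i, k) = y $$ (i, k)"
              using ik mats_carrier[OF xy(1)] mats_carrier[OF xy(2)] by simp
          qed (use mats_carrier[OF xy(1)] mats_carrier[OF xy(2)] in auto)
        qed
      qed
      fix \<gamma> assume \<gamma>: "\<gamma> \<in> mats n 1"
      have "mtrace ((\<delta> + \<gamma>) * \<beta>) = mtrace (\<delta> * \<beta>) + mtrace (\<gamma> * \<beta>)"
        unfolding add_mult_distrib_mat[OF mats_carrier[OF \<delta>] mats_carrier[OF \<gamma>] mats_carrier[OF \<beta>]]
        using mats_carrier[OF \<delta>] mats_carrier[OF \<gamma>] mats_carrier[OF \<beta>] by (intro mtrace_add[of _ n]) auto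
      then have "\<psi> (a * mtrace ((\<delta> + \<gamma>) * \<beta>)) = \<psi> (a * mtrace (\<delta> * \<beta>) + a * mtrace (\<gamma> * \<beta>))"
        by (simp add: distrib_left)
      also have "\<dots> = \<psi> (a * mtrace (\<delta> * \<beta>)) * \<psi> (a * mtrace (\<gamma> * \<beta>))"
        by (intro psi_add mult_F a mtrace_F[of _ n] mult_mats[OF _ \<beta>] \<delta> \<gamma>)
      finally show "\<psi> (a * mtrace ((\<delta> + \<gamma>) * \<beta>)) = \<psi> (a * \<beta> $$ (0, j) * t) * \<psi> (a * mtrace (\<gamma> * \<beta>))"
        unfolding tr\<delta> by (simp add: ac_simps)
    qed
    then show ?thesis using False by simp
  qed
  have "(\<Sum>\<beta>\<in>mats 1 n. \<Sum>\<gamma>\<in>mats n 1. \<psi> (a * mtrace (\<gamma> * \<beta>))) =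
      (\<Sum>\<beta>\<in>mats 1 n. if \<beta> = 0\<^sub>m 1 n then of_nat (Q ^ n) else 0)"
    by (rule sum.cong[OF refl inner])
  then show ?thesis using finite_mats zero_mats by simp
qed

text \<open>The sum is split by the corner entry a. The part a = 0 vanishes by scaling the first
  row. For nonzero a, the shift of D by a^(-1) \<gamma> \<beta> separates the variables: the
  determinant becomes a det D, the trace gains a^(-1) tr(\<gamma> \<beta>), and the sum over \<beta>
  and \<gamma> is Q^n.\<close>

lemma matrix_sum_Suc:
  assumes \<theta>: "mult_char \<theta>" and c: "c \<in> F" "c \<noteq> 0" "\<theta> c \<noteq> 1"
  shows "matrix_sum \<theta> (Suc n) (1\<^sub>m (Suc n)) = gauss_sum \<theta> * of_nat (Q ^ n) * matrix_sum \<theta> n (1\<^sub>m n)"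
proof -
  have one: "mtrace (1\<^sub>m m * x) = mtrace x" if "x \<in> mats m m" for m x
    using mats_carrier[OF that] by simp
  let ?f = "\<lambda>x. \<theta> (det x) * \<psi> (mtrace x)"
  let ?T = "\<lambda>a. \<Sum>\<beta>\<in>mats 1 n. \<Sum>\<gamma>\<in>mats n 1. \<Sum>D\<in>mats n n. ?f (blk a \<beta> \<gamma> D)"
  have zero: "?T 0 = 0"
  proof (rule sum_eq_0_of_scaling[OF _ _ c(3)])
    show "bij_betw (\<lambda>\<beta>. c \<cdot>\<^sub>m \<beta>) (mats 1 n) (mats 1 n)"
    proof (rule bij_betw_endo[OF finite_mats smult_mats[OF c(1)]])
      show "inj_on (\<lambda>\<beta>. c \<cdot>\<^sub>m \<beta>) (mats 1 n)"
      proof (rule inj_onI)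
        fix x y assume xy: "x \<in> mats 1 n" "y \<in> mats 1 n" "c \<cdot>\<^sub>m x = c \<cdot>\<^sub>m y"
        show "x = y"
        proof (rule eq_matI)
          fix i k assume ik: "i < dim_row y" "k < dim_col y"
          have "(c \<cdot>\<^sub>m x) $$ (i, k) = (c \<cdot>\<^sub>m y) $$ (i, k)" unfolding xy(3) ..
          then show "x $$ (i, k) = y $$ (i, k)"
            using ik c(2) mats_carrier[OF xy(1)] mats_carrier[OF xy(2)] by simp
        qed (use mats_carrier[OF xy(1)] mats_carrier[OF xy(2)] in auto)
      qed
    qed
    fix \<beta> assume \<beta>: "\<beta> \<in> mats 1 n"
    show "(\<Sum>\<gamma>\<in>mats n 1. \<Sum>D\<in>mats n n. ?f (blk 0 (c \<cdot>\<^sub>m \<beta>) \<gamma> D)) =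
        \<theta> c * (\<Sum>\<gamma>\<in>mats n 1. \<Sum>D\<in>mats n n. ?f (blk 0 \<beta> \<gamma> D))"
      unfolding sum_distrib_left
    proof (intro sum.cong refl)
      fix \<gamma> D assume \<gamma>D: "\<gamma> \<in> mats n 1" "D \<in> mats n n"
      have "blk 0 \<beta> \<gamma> D \<in> mats (Suc n) (Suc n)"
        using bij_betwE[OF bij_betw_blk, rule_format, of "(0, \<beta>, \<gamma>, D)"] zero_F \<beta> \<gamma>D by simp
      then have "\<theta> (det (blk 0 (c \<cdot>\<^sub>m \<beta>) \<gamma> D)) = \<theta> c * \<theta> (det (blk 0 \<beta> \<gamma> D))"
        unfolding det_blk_scale[OF mats_carrier[OF \<beta>] mats_carrier[OF \<gamma>D(1)] mats_carrier[OF \<gamma>D(2)]]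
        by (intro mult_char_mult[OF \<theta> c(1)] det_F)
      then show "?f (blk 0 (c \<cdot>\<^sub>m \<beta>) \<gamma> D) = \<theta> c * ?f (blk 0 \<beta> \<gamma> D)"
        unfolding mtrace_blk[OF mats_carrier[OF \<gamma>D(2)]] by simp
    qed
  qed
  have nonzero: "?T a = \<theta> a * \<psi> a * (of_nat (Q ^ n) * matrix_sum \<theta> n (1\<^sub>m n))" if a: "a \<in> F" "a \<noteq> 0" for a
  proof -
    have ia: "inverse a \<in> F" by (rule inverse_F[OF a(1)])
    have "?T a = (\<Sum>\<beta>\<in>mats 1 n. \<Sum>\<gamma>\<in>mats n 1. \<Sum>D\<in>mats n n.
        \<psi> (inverse a * mtrace (\<gamma> * \<beta>)) * (\<theta> a * \<psi> a * (\<theta> (det D) * \<psi> (mtrace D))))"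
    proof (rule sum.cong[OF refl], rule sum.cong[OF refl])
      fix \<beta> \<gamma> assume \<beta>: "\<beta> \<in> mats 1 n" and \<gamma>: "\<gamma> \<in> mats n 1"
      let ?E = "inverse a \<cdot>\<^sub>m (\<gamma> * \<beta>)"
      have gb: "\<gamma> * \<beta> \<in> mats n n" by (rule mult_mats[OF \<gamma> \<beta>])
      have E: "?E \<in> mats n n" by (rule smult_mats[OF ia gb])
      have trE: "mtrace ?E = inverse a * mtrace (\<gamma> * \<beta>)"
        using carrier_matD[OF mats_carrier[OF \<beta>]] carrier_matD[OF mats_carrier[OF \<gamma>]]
        unfolding mtrace_def by (simp add: sum_distrib_left)
      have bij: "bij_betw (\<lambda>D. D + ?E) (mats n n) (mats n n)"
      proof (rule bij_betw_endo[OF finite_mats])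
        show "D + ?E \<in> mats n n" if "D \<in> mats n n" for D by (rule add_mats[OF that E])
        show "inj_on (\<lambda>D. D + ?E) (mats n n)"
        proof (rule inj_onI)
          fix x y assume xy: "x \<in> mats n n" "y \<in> mats n n" "x + ?E = y + ?E"
          show "x = y"
          proof (rule eq_matI)
            fix i k assume ik: "i < dim_row y" "k < dim_col y"
            have "(x + ?E) $$ (i, k) = (y + ?E) $$ (i, k)" unfolding xy(3) ..
            then show "x $$ (i, k) = y $$ (i, k)"
              using ik mats_carrier[OF xy(1)] mats_carrier[OF xy(2)] carrier_matD[OF mats_carrier[OF gb]] by simp
          qed (use mats_carrier[OF xy(1)] mats_carrier[OF xy(2)] in auto)
        qed
      qed
      have "(\<Sum>D\<in>mats n n. ?f (blk a \<beta> \<gamma> D)) = (\<Sum>D\<in>mats n n. ?f (blk a \<beta> \<gamma> (D + ?E)))"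
        by (rule sum.reindex_bij_betw[OF bij, symmetric])
      also have "\<dots> = (\<Sum>D\<in>mats n n. \<psi> (inverse a * mtrace (\<gamma> * \<beta>)) * (\<theta> a * \<psi> a * (\<theta> (det D) * \<psi> (mtrace D))))"
      proof (intro sum.cong refl)
        fix D assume D: "D \<in> mats n n"
        have "\<theta> (det (blk a \<beta> \<gamma> (D + ?E))) = \<theta> a * \<theta> (det D)"
          unfolding det_blk_schur[OF a(2) mats_carrier[OF \<beta>] mats_carrier[OF \<gamma>] mats_carrier[OF D]]
          by (rule mult_char_mult[OF \<theta> a(1) det_F[OF D]])
        moreover have "\<psi> (mtrace (blk a \<beta> \<gamma> (D + ?E))) = \<psi> a * (\<psi> (mtrace D) * \<psi> (mtrace ?E))"
        proof -
          have "mtrace (blk a \<beta> \<gamma> (D + ?E)) = a + (mtrace D + mtrace ?E)"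
            unfolding mtrace_blk[OF mats_carrier[OF add_mats[OF D E]]]
            using mtrace_add[OF mats_carrier[OF D] mats_carrier[OF E]] by simp
          then show ?thesis
            using psi_add[OF a(1) add_F[OF mtrace_F[OF D] mtrace_F[OF E]]] psi_add[OF mtrace_F[OF D] mtrace_F[OF E]]
            by simp
        qed
        ultimately show "?f (blk a \<beta> \<gamma> (D + ?E)) =
            \<psi> (inverse a * mtrace (\<gamma> * \<beta>)) * (\<theta> a * \<psi> a * (\<theta> (det D) * \<psi> (mtrace D)))"
          unfolding trE by (simp add: ac_simps)
      qed
      finally show "(\<Sum>D\<in>mats n n. ?f (blk a \<beta> \<gamma> D)) = \<dots>" .
    qed
    also have "\<dots> = (\<Sum>\<beta>\<in>mats 1 n. \<Sum>\<gamma>\<in>mats n 1. \<psi> (inverse a * mtrace (\<gamma> * \<beta>))) *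
        (\<theta> a * \<psi> a * matrix_sum \<theta> n (1\<^sub>m n))"
    proof -
      have "matrix_sum \<theta> n (1\<^sub>m n) = (\<Sum>D\<in>mats n n. \<theta> (det D) * \<psi> (mtrace D))"
        unfolding matrix_sum_def by (intro sum.cong refl) (simp only: one)
      then show ?thesis by (simp only: sum_distrib_left[symmetric] sum_distrib_right[symmetric])
    qed
    also have "(\<Sum>\<beta>\<in>mats 1 n. \<Sum>\<gamma>\<in>mats n 1. \<psi> (inverse a * mtrace (\<gamma> * \<beta>))) = of_nat (Q ^ n)"
      by (rule sum_psi_bilinear[OF ia]) (use a(2) in simp)
    finally show ?thesis by (simp add: ac_simps)
  qed
  have "matrix_sum \<theta> (Suc n) (1\<^sub>m (Suc n)) = (\<Sum>x\<in>mats (Suc n) (Suc n). ?f x)"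
    unfolding matrix_sum_def by (intro sum.cong refl) (simp only: one)
  also have "\<dots> = (\<Sum>a\<in>F. ?T a)" by (rule sum_mats_Suc)
  also have "\<dots> = (\<Sum>a\<in>F. \<theta> a * \<psi> a * (of_nat (Q ^ n) * matrix_sum \<theta> n (1\<^sub>m n)))"
  proof (intro sum.cong refl)
    fix a assume "a \<in> F"
    then show "?T a = \<theta> a * \<psi> a * (of_nat (Q ^ n) * matrix_sum \<theta> n (1\<^sub>m n))"
      using zero nonzero[of a] mult_char_0[OF \<theta>] by (cases "a = 0") simp_all
  qed
  also have "\<dots> = gauss_sum \<theta> * (of_nat (Q ^ n) * matrix_sum \<theta> n (1\<^sub>m n))"
    unfolding gauss_sum_def sum_distrib_right ..
  finally show ?thesis by (simp only: mult.assoc)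
qed

text \<open>The recursion gives Q^(n(n-1)/2) times the n-th power of the Gauss sum. The form chosen
  here separates the modulus from the phase, and only the phase is subject to approximation
  later.\<close>

theorem matrix_sum_one:
  assumes \<theta>: "mult_char \<theta>" and c: "c \<in> F" "c \<noteq> 0" "\<theta> c \<noteq> 1"
  shows "matrix_sum \<theta> n (1\<^sub>m n) = of_real (sqrt (real Q) ^ (n * n)) * (gauss_sum \<theta> / of_real (sqrt (real Q))) ^ n"
proof (induction n)
  case 0
  have "mats 0 0 = {1\<^sub>m 0}" using one_mats[of 0] by (auto simp: mats_def mat_eq_iff)
  then show ?case unfolding matrix_sum_def
    by (simp add: mult_char_1[OF \<theta>] mtrace_def psi_0)
next
  case (Suc n)
  let ?s = "complex_of_real (sqrt (real Q))"
  have s0: "?s \<noteq> 0" using Q_gt_1 by simp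
  have s2: "?s * ?s = of_nat Q"
  proof -
    have "?s * ?s = complex_of_real (sqrt (real Q) * sqrt (real Q))" by (simp only: of_real_mult)
    then show ?thesis by simp
  qed
  have "of_nat (Q ^ n) = (?s * ?s) ^ n" unfolding s2 by simp
  also have "\<dots> = ?s ^ (n + n)" by (simp add: power_add power_mult_distrib)
  finally have Qn: "(of_nat (Q ^ n) :: complex) = ?s ^ (n + n)" .
  have "matrix_sum \<theta> (Suc n) (1\<^sub>m (Suc n)) =
      gauss_sum \<theta> * ?s ^ (n + n) * (?s ^ (n * n) * (gauss_sum \<theta> / ?s) ^ n)"
    unfolding matrix_sum_Suc[OF assms] Suc Qn by simp
  also have "\<dots> = (?s ^ (n * n) * ?s ^ (n + n) * ?s) * ((gauss_sum \<theta> / ?s) ^ n * (gauss_sum \<theta> / ?s))"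
    using s0 by simp
  also have "?s ^ (n * n) * ?s ^ (n + n) * ?s = ?s ^ (Suc n * Suc n)"
  proof -
    have "?s ^ (n * n) * ?s ^ (n + n) * ?s = ?s ^ (n * n + (n + n) + 1)" by (simp only: power_add power_one_right)
    also have "n * n + (n + n) + 1 = Suc n * Suc n" by simp
    finally show ?thesis .
  qed
  finally show ?case by simp
qed

end

section \<open>Elements of absolute value one that are sums of roots of unity\<close>

abbreviation roots_unity :: "nat \<Rightarrow> complex set" where
  "roots_unity v \<equiv> {y. y ^ v = 1}"

lemma exists_primitive_root_unity:
  assumes "v > 0"
  obtains \<zeta> :: complex where "\<zeta> ^ v = 1" "\<And>c. 0 < c \<Longrightarrow> c < v \<Longrightarrow> \<zeta> ^ c \<noteq> 1"
proof
  let ?\<zeta> = "cis (2 * pi * real 1 / real v)"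
  have pow: "?\<zeta> ^ c = cis (2 * pi * real c / real v)" for c by (simp add: DeMoivre mult_ac)
  note bij = Complex.bij_betw_roots_unity[OF assms]
  show "?\<zeta> ^ v = 1" unfolding pow using assms by simp
  fix c assume c: "0 < c" "c < v"
  show "?\<zeta> ^ c \<noteq> 1"
  proof
    assume "?\<zeta> ^ c = 1"
    then have "cis (2 * pi * real c / real v) = cis (2 * pi * real 0 / real v)" unfolding pow by simp
    then show False using inj_onD[OF bij_betw_imp_inj_on[OF bij], of c 0] c by auto
  qed
qed

lemma power_eq_one_coprime:
  fixes y :: "'a :: field"
  assumes "y ^ a = 1" "y ^ b = 1" "coprime a b"
  shows "y = 1"
proof (cases "a = 0")
  case False
  then obtain i j where ij: "a * i = b * j + gcd a b" using bezout_nat[of a b] by auto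
  have "y ^ (a * i) = y ^ (b * j) * y" using assms(3) ij by simp
  then show ?thesis using assms(1,2) by (simp add: power_mult)
qed (use assms in simp)

lemma power_cong_exponent:
  fixes y :: "'a :: field"
  assumes "y ^ v = 1" "[m = n] (mod v)"
  shows "y ^ m = y ^ n"
proof -
  have "y ^ k = y ^ (k mod v)" for k
  proof -
    have "y ^ k = y ^ (v * (k div v) + k mod v)" by simp
    also have "\<dots> = y ^ (k mod v)" unfolding power_add power_mult assms(1) by simp
    finally show ?thesis .
  qed
  then show ?thesis using assms(2) unfolding cong_def by (metis (no_types))
qed

lemma finite_roots_unity': "v > 0 \<Longrightarrow> finite (roots_unity v)"
  by (simp add: finite_roots_unity)

lemma cnj_root_unity:
  assumes "y ^ v = 1" "v > 0" shows "cnj y = inverse y" "norm y = 1" "y \<noteq> 0"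
proof -
  show 1: "norm y = 1" using assms power_eq_1_iff[of y v] by auto
  then show "y \<noteq> 0" by auto
  with 1 show "cnj y = inverse y" using complex_norm_square[of y] by (simp add: field_simps)
qed

lemma bij_betw_power_roots_unity:
  assumes "coprime p v" "v > 0"
  shows "bij_betw (\<lambda>y. y ^ p) (roots_unity v) (roots_unity v)"
proof -
  have "inj_on (\<lambda>y. y ^ p) (roots_unity v)"
  proof (rule inj_onI)
    fix x y :: complex assume xy: "x \<in> roots_unity v" "y \<in> roots_unity v" "x ^ p = y ^ p"
    then have "y \<noteq> 0" using cnj_root_unity(3) assms(2) by auto
    with xy have "(x / y) ^ p = 1" "(x / y) ^ v = 1" by (simp_all add: power_divide)
    then have "x / y = 1" using power_eq_one_coprime assms(1) by blast
    then show "x = y" using \<open>y \<noteq> 0\<close> by simp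
  qed
  moreover have "(\<lambda>y. y ^ p) ` roots_unity v \<subseteq> roots_unity v"
    by (auto simp flip: power_mult) (simp add: mult.commute[of p] power_mult)
  ultimately show ?thesis
    using endo_inj_surj[OF finite_roots_unity'[OF assms(2)]] by (auto simp: bij_betw_def)
qed

lemma roots_unity_prime_generated:
  assumes "prime r" "y ^ r = 1" "y \<noteq> (1::complex)"
  shows "roots_unity r = (\<lambda>k. y ^ k) ` {..<r}"
proof -
  have r0: "r > 0" using assms(1) prime_gt_0_nat by blast
  have *: "i = j" if "i < r" "j < r" "y ^ i = y ^ j" "i \<le> j" for i j
  proof (rule ccontr)
    assume "i \<noteq> j"
    then have ij: "0 < j - i" "j - i < r" using that by auto
    have "y ^ i * y ^ (j - i) = y ^ i * 1" using that by (metis le_add_diff_inverse mult.right_neutral power_add)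
    then have "y ^ (j - i) = 1" using cnj_root_unity(3)[OF assms(2) r0] by simp
    moreover have "coprime (j - i) r" using ij assms(1)
      by (metis coprime_commute nat_dvd_not_less prime_imp_coprime)
    ultimately show False using power_eq_one_coprime assms(2,3) by blast
  qed
  have inj: "inj_on (\<lambda>k. y ^ k) {..<r}"
    by (rule inj_onI) (metis * lessThan_iff nat_le_linear)
  have "(\<lambda>k. y ^ k) ` {..<r} \<subseteq> roots_unity r"
    using assms(2) by (auto simp flip: power_mult) (simp add: mult.commute[of _ r] power_mult)
  then show ?thesis
    using card_subset_eq[of "roots_unity r" "(\<lambda>k. y ^ k) ` {..<r}"] card_roots_unity_eq[OF r0]
      card_image[OF inj] finite_roots_unity'[OF r0] by simp
qed

text \<open>The order of y is r^s with s \<ge> 2 because y^r \<noteq> 1, so \<rho> is a power of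
  y^(r^(s-1)), and the exponent 1 + r^(s-1) k is prime to r. Off the r-th roots of unity, invariance
  under such powers therefore implies invariance under multiplication by r-th roots of
  unity.\<close>

lemma root_unity_coset_power:
  assumes "prime r" "y ^ (r ^ N) = 1" "y ^ r \<noteq> (1::complex)" "\<rho> ^ r = 1"
  obtains m where "\<not> r dvd m" "y * \<rho> = y ^ m"
proof -
  define s where "s = (LEAST s. y ^ (r ^ s) = 1)"
  have s: "y ^ (r ^ s) = 1" unfolding s_def by (rule LeastI, rule assms(2))
  have s2: "s \<ge> 2"
  proof (rule ccontr)
    assume "\<not> s \<ge> 2"
    then have "s = 0 \<or> s = 1" by auto
    then show False using s assms(3) by auto
  qed
  let ?z = "y ^ (r ^ (s - 1))"
  have z1: "?z \<noteq> 1"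
    using not_less_Least[of "s - 1" "\<lambda>s. y ^ (r ^ s) = 1"] s2 unfolding s_def[symmetric] by auto
  have zr: "?z ^ r = 1" using s s2 by (simp flip: power_mult power_Suc2)
  have "\<rho> \<in> (\<lambda>k. ?z ^ k) ` {..<r}"
    using roots_unity_prime_generated[OF assms(1) zr z1] assms(4) by blast
  then obtain k where "\<rho> = ?z ^ k" by blast
  then have "y * \<rho> = y ^ (1 + r ^ (s - 1) * k)" by (simp add: power_add power_mult)
  moreover have "\<not> r dvd 1 + r ^ (s - 1) * k"
  proof -
    have "r dvd r ^ (s - 1) * k" using s2 by (simp add: dvd_power)
    then show ?thesis using assms(1) by (metis dvd_add_left_iff not_prime_unit)
  qed
  ultimately show ?thesis using that by blast
qed

text \<open>An elementary descent to the integers. Off the r-th roots of unity, e is constant on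
  their cosets, which contribute 0 to the sum and multiples of r to the sum of the coefficients. On
  the r-th roots of unity e takes one value off 1, and e 1 - e \<xi> remains, congruent to e 1 + (r
  - 1) e \<xi>.\<close>

lemma unit_invariant_sum:
  fixes e :: "complex \<Rightarrow> int"
  assumes r: "prime r" and N: "N > 0"
    and e: "\<And>y m. y \<in> roots_unity (r ^ N) \<Longrightarrow> \<not> r dvd m \<Longrightarrow> e (y ^ m) = e y"
  obtains B where "(\<Sum>y\<in>roots_unity (r ^ N). of_int (e y) * y) = of_int B"
    "[B = (\<Sum>y\<in>roots_unity (r ^ N). e y)] (mod int r)"
proof -
  have r1: "r > 1" and r0: "r > 0" using r prime_gt_1_nat prime_gt_0_nat by auto
  let ?Y = "roots_unity (r ^ N)" and ?R = "roots_unity r"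
  have fin: "finite ?Y" "finite ?R" using r0 by (auto intro: finite_roots_unity')
  have RY: "?R \<subseteq> ?Y"
  proof safe
    fix y :: complex assume "y ^ r = 1"
    then show "y ^ (r ^ N) = 1" using N by (cases N) (simp_all add: power_mult)
  qed
  define \<xi> where "\<xi> = cis (2 * pi * real 1 / real r)"
  have bij: "bij_betw (\<lambda>k. cis (2 * pi * real k / real r)) {..<r} ?R"
    by (rule Complex.bij_betw_roots_unity[OF r0])
  have \<xi>R: "\<xi> ^ r = 1"
    using bij_betwE[OF bij, rule_format, of 1] r1 unfolding \<xi>_def by simp
  have \<xi>1: "\<xi> \<noteq> 1"
    using inj_onD[OF bij_betw_imp_inj_on[OF bij], of 1 0] r1 unfolding \<xi>_def by auto
  let ?A = "?Y - ?R"
  have coset: "e (y * \<rho>) = e y" "y * \<rho> \<in> ?A" if "y \<in> ?A" "\<rho> \<in> ?R" for y \<rho>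
  proof -
    obtain m where "\<not> r dvd m" "y * \<rho> = y ^ m"
      using root_unity_coset_power[OF r, of y N \<rho>] \<open>y \<in> ?A\<close> \<open>\<rho> \<in> ?R\<close> by auto
    then show "e (y * \<rho>) = e y" using e[of y m] \<open>y \<in> ?A\<close> by auto
    show "y * \<rho> \<in> ?A" using that RY by (auto simp: power_mult_distrib)
  qed
  have A_sum: "(\<Sum>y\<in>?A. of_int (e y) * y) = 0"
  proof -
    have bijA: "bij_betw (\<lambda>y. y * \<xi>) ?A ?A"
      unfolding bij_betw_def
    proof
      show inj: "inj_on (\<lambda>y. y * \<xi>) ?A" using cnj_root_unity(3)[OF \<xi>R r0] by (auto intro!: inj_onI)
      show "(\<lambda>y. y * \<xi>) ` ?A = ?A"
        using endo_inj_surj[OF _ _ inj] fin coset(2) \<xi>R by blast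
    qed
    have "(\<Sum>y\<in>?A. of_int (e y) * y) = (\<Sum>y\<in>?A. of_int (e (y * \<xi>)) * (y * \<xi>))"
      by (rule sum.reindex_bij_betw[OF bijA, symmetric])
    also have "\<dots> = (\<Sum>y\<in>?A. of_int (e y) * (y * \<xi>))"
      by (intro sum.cong refl) (use coset(1) \<xi>R in auto)
    also have "\<dots> = (\<Sum>y\<in>?A. of_int (e y) * y) * \<xi>" by (simp add: sum_distrib_right mult.assoc)
    finally show ?thesis using \<xi>1 by simp
  qed
  have A_dvd: "int r dvd (\<Sum>y\<in>?A. e y)"
  proof -
    have "(\<Sum>y\<in>?A. e y) = (\<Sum>w\<in>(\<lambda>y. y ^ r) ` ?A. \<Sum>y\<in>{y\<in>?A. y ^ r = w}. e y)"
      by (rule sum.image_gen) (use fin in auto)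
    also have "int r dvd \<dots>"
    proof (rule dvd_sum)
      fix w assume "w \<in> (\<lambda>y. y ^ r) ` ?A"
      then obtain y0 where y0: "y0 \<in> ?A" "w = y0 ^ r" by blast
      have "y0 \<noteq> 0" using y0(1) r0 cnj_root_unity(3)[of y0 "r ^ N"] by auto
      have "{y\<in>?A. y ^ r = w} = (\<lambda>\<rho>. y0 * \<rho>) ` ?R"
      proof
        show "{y\<in>?A. y ^ r = w} \<subseteq> (\<lambda>\<rho>. y0 * \<rho>) ` ?R"
        proof
          fix y assume "y \<in> {y\<in>?A. y ^ r = w}"
          then have "(y / y0) ^ r = 1" using y0 \<open>y0 \<noteq> 0\<close> by (simp add: power_divide)
          moreover have "y = y0 * (y / y0)" using \<open>y0 \<noteq> 0\<close> by simp
          ultimately show "y \<in> (\<lambda>\<rho>. y0 * \<rho>) ` ?R" by blast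
        qed
      qed (use coset(2)[OF y0(1)] y0 in \<open>auto simp: power_mult_distrib\<close>)
      then have "(\<Sum>y\<in>{y\<in>?A. y ^ r = w}. e y) = (\<Sum>\<rho>\<in>?R. e (y0 * \<rho>))"
        using \<open>y0 \<noteq> 0\<close> by (simp add: sum.reindex inj_on_def)
      also have "\<dots> = (\<Sum>\<rho>\<in>?R. e y0)" by (intro sum.cong refl coset(1)[OF y0(1)])
      also have "\<dots> = int r * e y0" by (simp add: card_roots_unity_eq[OF r0])
      finally show "int r dvd (\<Sum>y\<in>{y\<in>?A. y ^ r = w}. e y)" by simp
    qed
    finally show ?thesis .
  qed
  have R1: "e \<rho> = e \<xi>" if "\<rho> \<in> ?R - {1}" for \<rho>
  proof -
    have "\<rho> \<in> (\<lambda>k. \<xi> ^ k) ` {..<r}"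
      using that by (simp flip: roots_unity_prime_generated[OF r \<xi>R \<xi>1])
    then obtain k where k: "k < r" "\<rho> = \<xi> ^ k" by auto
    moreover have "k \<noteq> 0" using that k(2) by (cases "k = 0") auto
    ultimately have "\<not> r dvd k" by (simp add: nat_dvd_not_less)
    then show ?thesis using e[of \<xi> k] k RY \<xi>R by auto
  qed
  have one: "1 \<in> ?R" by simp
  have "(\<Sum>y\<in>?R. of_int (e y) * y) = of_int (e 1) + (\<Sum>y\<in>?R - {1}. of_int (e y) * y)"
    by (subst sum.remove[OF fin(2) one]) simp
  also have "(\<Sum>y\<in>?R - {1}. of_int (e y) * y) = of_int (e \<xi>) * (\<Sum>y\<in>?R - {1}. y)"
    unfolding sum_distrib_left by (intro sum.cong refl) (simp add: R1)
  also have "(\<Sum>y\<in>?R - {1}. y) = -1"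
    using sum.remove[OF fin(2) one, of "\<lambda>y. y"] sum_roots_unity[OF r1] by (simp add: add_eq_0_iff)
  finally have R_sum: "(\<Sum>y\<in>?R. of_int (e y) * y) = of_int (e 1 - e \<xi>)" by simp
  have "(\<Sum>y\<in>?R. e y) = e 1 + (\<Sum>y\<in>?R - {1}. e y)" by (rule sum.remove[OF fin(2) one])
  also have "(\<Sum>y\<in>?R - {1}. e y) = (\<Sum>y\<in>?R - {1}. e \<xi>)" by (intro sum.cong refl R1)
  also have "\<dots> = (int r - 1) * e \<xi>"
    using r1 by (simp add: card_Diff_singleton[OF one] card_roots_unity_eq[OF r0] of_nat_diff)
  finally have R_int: "(\<Sum>y\<in>?R. e y) = (e 1 - e \<xi>) + int r * e \<xi>" by (simp add: algebra_simps)
  have "(\<Sum>y\<in>?Y. of_int (e y) * y) = of_int (e 1 - e \<xi>)"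
    using sum.subset_diff[OF RY fin(1), of "\<lambda>y. of_int (e y) * y"] A_sum R_sum by simp
  moreover have "[e 1 - e \<xi> = (\<Sum>y\<in>?Y. e y)] (mod int r)"
  proof -
    have "(\<Sum>y\<in>?Y. e y) - (e 1 - e \<xi>) = (\<Sum>y\<in>?A. e y) + int r * e \<xi>"
      using sum.subset_diff[OF RY fin(1), of e] R_int by simp
    then have "int r dvd (\<Sum>y\<in>?Y. e y) - (e 1 - e \<xi>)" using A_dvd by simp
    then show ?thesis by (meson cong_iff_dvd_diff cong_sym)
  qed
  ultimately show ?thesis using that by blast
qed

definition frob_sums :: "nat \<Rightarrow> nat \<Rightarrow> nat \<Rightarrow> complex set" where
  "frob_sums p r v = {(\<Sum>y\<in>roots_unity v. of_int (e y) * y) | e.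
     (\<forall>y\<in>roots_unity v. e (y ^ p) = e y) \<and>
     (\<exists>x. [(\<Sum>y\<in>roots_unity v. e y) = int p ^ x] (mod int r))}"

text \<open>The exponent m may be odd, so that Gauss sums of absolute value sqrt (p^m) can be
  normalised; allowing every m makes the set closed under products.\<close>

definition frob_units :: "nat \<Rightarrow> nat \<Rightarrow> nat \<Rightarrow> complex set" where
  "frob_units p r v = {z. norm z = 1 \<and> (\<exists>m. z * of_real (sqrt (real p ^ m)) \<in> frob_sums p r v)}"

lemma frob_sums_one:
  assumes "v > 0" "coprime p v" shows "1 \<in> frob_sums p r v"
proof -
  let ?e = "\<lambda>y::complex. if y = 1 then 1 else 0 :: int"
  have fin: "finite (roots_unity v)" using assms by (simp add: finite_roots_unity')
  have 1: "y ^ p = 1 \<longleftrightarrow> y = 1" if "y \<in> roots_unity v" for y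
    using that power_eq_one_coprime[of y p v] assms(2) by auto
  have 2: "(\<Sum>y\<in>roots_unity v. of_int (?e y) * y) = 1"
    using fin by (simp add: if_distrib[of of_int] if_distrib[of "\<lambda>x. x * _"] sum.delta cong: if_cong)
  have 3: "(\<Sum>y\<in>roots_unity v. ?e y) = int p ^ 0" using fin by simp
  show ?thesis unfolding frob_sums_def
    using 1 2 3 by (intro CollectI exI[of _ ?e] conjI) (auto intro!: exI[of _ 0])
qed

lemma frob_sums_cnj:
  assumes "v > 0" "s \<in> frob_sums p r v" shows "cnj s \<in> frob_sums p r v"
proof -
  obtain e x where e: "s = (\<Sum>y\<in>roots_unity v. of_int (e y) * y)"
    "\<And>y. y \<in> roots_unity v \<Longrightarrow> e (y ^ p) = e y" "[(\<Sum>y\<in>roots_unity v. e y) = int p ^ x] (mod int r)"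
    using assms(2) unfolding frob_sums_def by blast
  have bij: "bij_betw inverse (roots_unity v) (roots_unity v)"
    by (rule bij_betw_byWitness[of _ inverse]) (auto simp: power_inverse)
  have "cnj s = (\<Sum>y\<in>roots_unity v. of_int (e y) * inverse y)"
    unfolding e(1) by (simp add: cnj_sum cnj_root_unity(1)[OF _ assms(1)])
  also have "\<dots> = (\<Sum>y\<in>roots_unity v. of_int (e (inverse y)) * y)"
    by (subst sum.reindex_bij_betw[OF bij, symmetric]) simp
  finally have "cnj s = (\<Sum>y\<in>roots_unity v. of_int (e (inverse y)) * y)" .
  moreover have "e (inverse (y ^ p)) = e (inverse y)" if "y \<in> roots_unity v" for y
    using e(2)[of "inverse y"] that by (simp add: power_inverse)
  moreover have "(\<Sum>y\<in>roots_unity v. e (inverse y)) = (\<Sum>y\<in>roots_unity v. e y)"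
    by (rule sum.reindex_bij_betw[OF bij])
  ultimately show ?thesis unfolding frob_sums_def
    using e(3) by (intro CollectI exI[of _ "\<lambda>y. e (inverse y)"] conjI) auto
qed

text \<open>The coefficients of a product are convolutions over the group of roots of unity.
  Invariance survives by reindexing with y \<mapsto> y^p, and the coefficient sums multiply.\<close>

lemma frob_sums_mult:
  assumes v: "v > 0" and cop: "coprime p v" and s: "s \<in> frob_sums p r v" and t: "t \<in> frob_sums p r v"
  shows "s * t \<in> frob_sums p r v"
proof -
  let ?Y = "roots_unity v"
  have fin: "finite ?Y" using v by (rule finite_roots_unity')
  obtain e x where e: "s = (\<Sum>y\<in>?Y. of_int (e y) * y)"
    "\<And>y. y \<in> ?Y \<Longrightarrow> e (y ^ p) = e y" "[(\<Sum>y\<in>?Y. e y) = int p ^ x] (mod int r)"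
    using s unfolding frob_sums_def by blast
  obtain e' x' where e': "t = (\<Sum>y\<in>?Y. of_int (e' y) * y)"
    "\<And>y. y \<in> ?Y \<Longrightarrow> e' (y ^ p) = e' y" "[(\<Sum>y\<in>?Y. e' y) = int p ^ x'] (mod int r)"
    using t unfolding frob_sums_def by blast
  define c where "c = (\<lambda>w. \<Sum>y\<in>?Y. e y * e' (w / y))"
  have bij: "bij_betw (\<lambda>w. w / y) ?Y ?Y" if "y \<in> ?Y" for y
    by (rule bij_betw_byWitness[of _ "\<lambda>w. w * y"]) (use that v cnj_root_unity(3) in \<open>auto simp: power_divide power_mult_distrib\<close>)
  have conv: "(\<Sum>y\<in>?Y. f y) * (\<Sum>z\<in>?Y. g z) = (\<Sum>w\<in>?Y. \<Sum>y\<in>?Y. f y * g (w / y))"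
    for f g :: "complex \<Rightarrow> 'b::comm_semiring_0"
  proof -
    have "(\<Sum>y\<in>?Y. f y) * (\<Sum>z\<in>?Y. g z) = (\<Sum>y\<in>?Y. f y * (\<Sum>z\<in>?Y. g z))" by (simp add: sum_distrib_right)
    also have "\<dots> = (\<Sum>y\<in>?Y. f y * (\<Sum>w\<in>?Y. g (w / y)))"
      by (intro sum.cong refl arg_cong2[where f = "(*)"] sum.reindex_bij_betw[OF bij, symmetric])
    also have "\<dots> = (\<Sum>y\<in>?Y. \<Sum>w\<in>?Y. f y * g (w / y))" by (simp add: sum_distrib_left)
    also have "\<dots> = (\<Sum>w\<in>?Y. \<Sum>y\<in>?Y. f y * g (w / y))" by (rule sum.swap)
    finally show ?thesis .
  qed
  have "s * t = (\<Sum>w\<in>?Y. of_int (c w) * w)"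
  proof -
    have "s * t = (\<Sum>w\<in>?Y. \<Sum>y\<in>?Y. of_int (e y) * y * (of_int (e' (w / y)) * (w / y)))"
      unfolding e(1) e'(1) by (rule conv)
    also have "\<dots> = (\<Sum>w\<in>?Y. of_int (c w) * w)"
      unfolding c_def of_int_sum sum_distrib_right
      by (intro sum.cong refl) (use v cnj_root_unity(3) in \<open>auto simp: field_simps\<close>)
    finally show ?thesis .
  qed
  moreover have "c (w ^ p) = c w" if "w \<in> ?Y" for w
  proof -
    have "c (w ^ p) = (\<Sum>y\<in>?Y. e (y ^ p) * e' (w ^ p / y ^ p))"
      unfolding c_def by (rule sum.reindex_bij_betw[OF bij_betw_power_roots_unity[OF cop v], symmetric])
    also have "\<dots> = c w" unfolding c_def
    proof (intro sum.cong refl)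
      fix y assume "y \<in> ?Y"
      then have "w / y \<in> ?Y" using that by (simp add: power_divide)
      then show "e (y ^ p) * e' (w ^ p / y ^ p) = e y * e' (w / y)"
        using e(2) e'(2)[of "w / y"] \<open>y \<in> ?Y\<close> by (simp add: power_divide)
    qed
    finally show ?thesis .
  qed
  moreover have "[(\<Sum>w\<in>?Y. c w) = int p ^ (x + x')] (mod int r)"
    using cong_mult[OF e(3) e'(3)] unfolding conv c_def power_add .
  ultimately show ?thesis unfolding frob_sums_def by blast
qed

lemma frob_units_group:
  assumes "v > 0" "coprime p v"
  shows "1 \<in> frob_units p r v"
    and "z \<in> frob_units p r v \<Longrightarrow> cnj z \<in> frob_units p r v"
    and "z \<in> frob_units p r v \<Longrightarrow> z' \<in> frob_units p r v \<Longrightarrow> z * z' \<in> frob_units p r v"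
proof -
  show "1 \<in> frob_units p r v"
    unfolding frob_units_def using frob_sums_one[OF assms] by (auto intro!: exI[of _ 0])
  show "cnj z \<in> frob_units p r v" if "z \<in> frob_units p r v"
    using that frob_sums_cnj[OF assms(1)] unfolding frob_units_def by fastforce
  show "z * z' \<in> frob_units p r v" if z: "z \<in> frob_units p r v" "z' \<in> frob_units p r v"
  proof -
    obtain m m' where m: "z * of_real (sqrt (real p ^ m)) \<in> frob_sums p r v"
      "z' * of_real (sqrt (real p ^ m')) \<in> frob_sums p r v"
      using z unfolding frob_units_def by auto
    have "z * z' * of_real (sqrt (real p ^ (m + m'))) =
        z * of_real (sqrt (real p ^ m)) * (z' * of_real (sqrt (real p ^ m')))"
      by (simp add: power_add real_sqrt_mult mult_ac)
    then have "z * z' * of_real (sqrt (real p ^ (m + m'))) \<in> frob_sums p r v"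
      using frob_sums_mult[OF assms m] by metis
    then show ?thesis using z unfolding frob_units_def by (auto simp: norm_mult)
  qed
qed

text \<open>
  A real element of \<^const>\<open>frob_sums\<close> has coefficients that may be taken invariant under all units modulo
  \<open>v\<close>, so that it is half a rational integer, known modulo \<open>r\<close>.
\<close>

lemma minus_one_not_frob_unit:
  assumes p: "prime p" and r: "prime r" "odd r" and N: "N > 0" "v = r ^ N"
    and units: "\<And>m. \<not> r dvd m \<Longrightarrow> \<exists>x. [m = p ^ x] (mod v) \<or> [m + p ^ x = 0] (mod v)"
    and neg: "\<And>i x. \<not> r dvd p ^ i + p ^ x"
  shows "-1 \<notin> frob_units p r v"
proof
  assume "-1 \<in> frob_units p r v"
  then obtain m where m: "- complex_of_real (sqrt (real p ^ m)) \<in> frob_sums p r v"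
    unfolding frob_units_def by auto
  let ?Y = "roots_unity v" and ?s = "- complex_of_real (sqrt (real p ^ m))"
  have v: "v > 0" using N r(1) prime_gt_0_nat by simp
  obtain e x where e: "?s = (\<Sum>y\<in>?Y. of_int (e y) * y)"
    "\<And>y. y \<in> ?Y \<Longrightarrow> e (y ^ p) = e y" "[(\<Sum>y\<in>?Y. e y) = int p ^ x] (mod int r)"
    using m unfolding frob_sums_def by blast
  have bij: "bij_betw inverse ?Y ?Y"
    by (rule bij_betw_byWitness[of _ inverse]) (auto simp: power_inverse)
  \<comment> \<open>Symmetrising adds invariance under inversion. By \<open>units\<close>, p and -1
    generate the units modulo v, so e' is invariant under all unit powers; its sum is twice the real
    number at hand.\<close>
  define e' where "e' = (\<lambda>y. e y + e (inverse y))"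
  have epow: "e (y ^ (p ^ k)) = e y" if "y \<in> ?Y" for y k
  proof (induction k)
    case (Suc k)
    have "y ^ (p ^ k) \<in> ?Y" using that
      by (simp flip: power_mult) (simp add: mult.commute[of _ v] power_mult)
    then have "e ((y ^ (p ^ k)) ^ p) = e (y ^ (p ^ k))" by (rule e(2))
    then show ?case using Suc by (simp flip: power_mult add: mult.commute)
  qed simp
  have inv: "e' (y ^ n) = e' y" if y: "y \<in> ?Y" and n: "\<not> r dvd n" for y n
  proof -
    have iy: "inverse y \<in> ?Y" using y by (simp add: power_inverse)
    have e1: "e' (y ^ (p ^ k)) = e' y" for k
      using epow[OF y, of k] epow[OF iy, of k] unfolding e'_def by (simp add: power_inverse)
    obtain k where "[n = p ^ k] (mod v) \<or> [n + p ^ k = 0] (mod v)" using units[OF n] by blast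
    then show ?thesis
    proof
      assume "[n = p ^ k] (mod v)"
      then show ?thesis using power_cong_exponent[of y v n "p ^ k"] y e1 by simp
    next
      assume "[n + p ^ k = 0] (mod v)"
      then have "y ^ n * y ^ (p ^ k) = 1" using power_cong_exponent[of y v "n + p ^ k" 0] y by (simp add: power_add)
      then have "y ^ n = inverse (y ^ (p ^ k))" by (metis inverse_unique mult.commute)
      then show ?thesis using e1[of k] unfolding e'_def by simp
    qed
  qed
  obtain B where B: "(\<Sum>y\<in>?Y. of_int (e' y) * y) = of_int B" "[B = (\<Sum>y\<in>?Y. e' y)] (mod int r)"
    using unit_invariant_sum[OF r(1) N(1), of e', folded N(2), OF inv] by blast
  have "(\<Sum>y\<in>?Y. of_int (e (inverse y)) * y) = (\<Sum>y\<in>?Y. of_int (e y) * inverse y)"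
    by (subst sum.reindex_bij_betw[OF bij, symmetric]) simp
  also have "\<dots> = cnj (\<Sum>y\<in>?Y. of_int (e y) * y)"
    by (simp add: cnj_sum cnj_root_unity(1)[OF _ v])
  also have "\<dots> = ?s" unfolding e(1)[symmetric] by simp
  finally have "of_int B = 2 * ?s" unfolding B(1)[symmetric] e'_def
    using e(1) by (simp add: distrib_right sum.distrib)
  also have "2 * ?s = complex_of_real (- 2 * sqrt (real p ^ m))" by simp
  finally have "of_int B = complex_of_real (- 2 * sqrt (real p ^ m))" .
  then have Bs: "real_of_int B = - 2 * sqrt (real p ^ m)"
    
  proof -
    have "complex_of_real (real_of_int B) = complex_of_real (- 2 * sqrt (real p ^ m))"
      using \<open>of_int B = complex_of_real (- 2 * sqrt (real p ^ m))\<close> by simp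
    then show ?thesis unfolding of_real_eq_iff .
  qed
  have "real_of_int (B\<^sup>2) = real_of_int (4 * int p ^ m)" using Bs by (simp add: power_mult_distrib)
  \<comment> \<open>B is an integer with B^2 = 4 p^m, so half of it is a power of p up to sign. The
    sign is negative because it is inherited from -1.\<close>
  then have B2: "B\<^sup>2 = 4 * int p ^ m" by linarith
  then have "even (B\<^sup>2)" by simp
  then have "even B" by simp
  then obtain C where C: "B = 2 * C" by blast
  have C2: "C\<^sup>2 = int p ^ m" using B2 C by simp
  have Cneg: "C \<le> 0" using Bs C of_int_le_0_iff[of C, where 'a = real] by (simp add: real_sqrt_ge_zero)
  have "nat \<bar>C\<bar> ^ 2 = p ^ m" 
  proof -
    have "int (nat \<bar>C\<bar> ^ 2) = int (p ^ m)" using C2 by simp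
    then show ?thesis unfolding of_nat_eq_iff .
  qed
  then have "nat \<bar>C\<bar> dvd p ^ m" by (metis dvd_triv_left power2_eq_square)
  then obtain i where "nat \<bar>C\<bar> = p ^ i" using divides_primepow_nat[OF p] by blast
  then have Ci: "C = - (int p ^ i)" 
  proof -
    have "int (nat \<bar>C\<bar>) = int (p ^ i)" using \<open>nat \<bar>C\<bar> = p ^ i\<close> by (rule arg_cong)
    then show ?thesis using Cneg by simp
  qed
  have "(\<Sum>y\<in>?Y. e (inverse y)) = (\<Sum>y\<in>?Y. e y)" by (rule sum.reindex_bij_betw[OF bij])
  then have "(\<Sum>y\<in>?Y. e' y) = 2 * (\<Sum>y\<in>?Y. e y)" unfolding e'_def by (simp add: sum.distrib)
  \<comment> \<open>Modulo r the coefficient sum is 2 p^x while the value is -2 p^i, so r divides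
    p^x + p^i, against \<open>neg\<close>.\<close>
  then have "[B = 2 * int p ^ x] (mod int r)" using cong_trans[OF B(2)] cong_scalar_left[OF e(3), of 2] by simp
  then have "int r dvd 2 * int p ^ x - B" by (meson cong_iff_dvd_diff cong_sym)
  then have "int r dvd 2 * (int p ^ x + int p ^ i)" unfolding C Ci by (simp add: algebra_simps)
  moreover have "coprime (int r) 2" using r by simp
  ultimately have "int r dvd int p ^ x + int p ^ i" using coprime_dvd_mult_right_iff by blast
  then have "int r dvd int (p ^ x + p ^ i)" by simp
  then show False using neg unfolding int_dvd_int_iff by blast
qed

section \<open>Simultaneous approximation by odd powers\<close>

text \<open>Odd powers form a geometric progression in z^2, with bounded partial sums unless z^2 =
  1. The point -1 is excluded because its odd powers have mean -1.\<close>

lemma tendsto_odd_power_mean: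
  fixes z :: complex
  assumes "norm z = 1" "z \<noteq> -1"
  shows "(\<lambda>L. (\<Sum>i<L. z ^ (2 * i + 1)) / of_nat L) \<longlonglongrightarrow> (if z = 1 then 1 else 0)"
proof (cases "z = 1")
  case True
  have "\<forall>\<^sub>F L in sequentially. (\<Sum>i<L. z ^ (2 * i + 1)) / of_nat L = 1"
    using eventually_gt_at_top[of 0] by eventually_elim (use True in simp)
  then show ?thesis using True by (simp add: tendsto_eventually)
next
  case False
  then have ne: "z\<^sup>2 \<noteq> 1" using assms(2) by (simp add: power2_eq_1_iff)
  have sum: "(\<Sum>i<L. z ^ (2 * i + 1)) = z * ((z\<^sup>2) ^ L - 1) / (z\<^sup>2 - 1)" for L
    using geometric_sum[OF ne, of L] unfolding power_add power_mult
    by (simp flip: sum_distrib_right)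
  have bound: "norm ((\<Sum>i<L. z ^ (2 * i + 1)) / of_nat L) \<le> (2 / norm (z\<^sup>2 - 1)) / real L" for L
  proof -
    have "norm ((z\<^sup>2) ^ L - 1) \<le> 2"
      using norm_triangle_ineq4[of "(z\<^sup>2) ^ L" 1] assms(1) by (simp add: norm_power)
    then show ?thesis unfolding sum
      using assms(1) ne by (simp add: norm_mult norm_divide divide_right_mono)
  qed
  have "(\<lambda>L. (\<Sum>i<L. z ^ (2 * i + 1)) / of_nat L) \<longlonglongrightarrow> 0"
  proof (rule tendsto_0_le)
    show "(\<lambda>L. (2 / norm (z\<^sup>2 - 1)) / real L) \<longlonglongrightarrow> 0" by (rule lim_const_over_n)
    have "norm ((\<Sum>i<L. z ^ (2 * i + 1)) / of_nat L) \<le> norm ((2 / norm (z\<^sup>2 - 1)) / real L) * 1" for L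
      unfolding mult_1_right real_norm_def by (rule order_trans[OF bound abs_ge_self])
    then show "\<forall>\<^sub>F L in sequentially.
        norm ((\<Sum>i<L. z ^ (2 * i + 1)) / of_nat L) \<le> norm ((2 / norm (z\<^sup>2 - 1)) / real L) * 1"
      by (rule always_eventually[OF allI])
  qed
  then show ?thesis using False by simp
qed

text \<open>
  Otherwise the mean over odd \<open>d\<close> of \<open>\<bar>\<Prod>\<^sub>j ((1 + w\<^sub>j\<^sup>d) / 2)\<^sup>M\<bar>\<^sup>2\<close> would be exponentially small in \<open>M\<close>.
  Expanding the product, only the diagonal survives in the mean, because \<open>-1\<close> is not in the group;
  by Cauchy-Schwarz it is at least the inverse of the number of exponent vectors.
\<close>

lemma odd_power_near_one:
  fixes w :: "'i \<Rightarrow> complex"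
  assumes J: "finite J" "\<And>j. j \<in> J \<Longrightarrow> w j \<in> T"
    and T: "\<And>z. z \<in> T \<Longrightarrow> norm z = 1" "1 \<in> T" "\<And>y z. y \<in> T \<Longrightarrow> z \<in> T \<Longrightarrow> y * z \<in> T"
      "\<And>z. z \<in> T \<Longrightarrow> cnj z \<in> T" "-1 \<notin> T"
    and "\<delta> > 0"
  obtains d where "odd d" "\<And>j. j \<in> J \<Longrightarrow> norm (w j ^ d - 1) < \<delta>"
proof (rule ccontr)
  assume "\<not> thesis"
  then have far: "\<exists>j\<in>J. norm (w j ^ d - 1) \<ge> \<delta>" if "odd d" for d
    using that \<open>\<not> thesis\<close> \<open>\<And>d. odd d \<Longrightarrow> (\<And>j. j \<in> J \<Longrightarrow> cmod (w j ^ d - 1) < \<delta>) \<Longrightarrow> thesis\<close> not_less by blast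
  have Tpow: "z ^ n \<in> T" if "z \<in> T" for z n by (induction n) (use that T in auto)
  have Tprod: "(\<Prod>j\<in>I. f j) \<in> T" if "finite I" "\<And>j. j \<in> I \<Longrightarrow> f j \<in> T" for I and f :: "'i \<Rightarrow> complex"
    using that by (induction I rule: finite_induct) (use T in auto)
  \<comment> \<open>By the parallelogram law this bounds the squared modulus of (1 + z)/2 for z on
    the unit circle at distance at least \<delta> from 1.\<close>
  define \<rho> where "\<rho> = 1 - \<delta>\<^sup>2 / 4"
  have para: "(norm ((1 + z) / 2))\<^sup>2 = 1 - (norm (z - 1))\<^sup>2 / 4" if "norm z = 1" for z :: complex
  proof -
    have "(Re z)\<^sup>2 + (Im z)\<^sup>2 = 1" using that by (simp add: cmod_def)
    moreover have "(norm ((1 + z) / 2))\<^sup>2 = ((1 + Re z)\<^sup>2 + (Im z)\<^sup>2) / 4"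
      by (simp add: norm_divide power_divide cmod_power2)
    moreover have "(norm (z - 1))\<^sup>2 = (Re z - 1)\<^sup>2 + (Im z)\<^sup>2"
      by (simp add: cmod_power2)
    ultimately show ?thesis by (simp add: power2_eq_square field_simps)
  qed
  have le1: "norm ((1 + z) / 2) \<le> 1" if "norm z = 1" for z :: complex
    using norm_triangle_ineq[of 1 z] that by (simp add: norm_divide)
  define f where "f = (\<lambda>M d. \<Prod>j\<in>J. ((1 + w j ^ d) / 2) ^ M)"
  have f_le: "(norm (f M d))\<^sup>2 \<le> \<rho> ^ M \<and> \<rho> \<ge> 0" if d: "odd d" for M d
  proof -
    obtain j where j: "j \<in> J" "norm (w j ^ d - 1) \<ge> \<delta>" using far[OF d] by blast
    let ?g = "\<lambda>i. norm ((1 + w i ^ d) / 2)"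
    have n1: "norm (w i ^ d) = 1" if "i \<in> J" for i using J(2) T(1) Tpow that by blast
    have "(\<Prod>i\<in>J. ?g i ^ M) = ?g j ^ M * (\<Prod>i\<in>J - {j}. ?g i ^ M)"
      using J(1) j(1) by (simp add: prod.remove)
    also have "\<dots> \<le> ?g j ^ M * 1"
      by (intro mult_left_mono prod_le_1) (use power_le_one[OF norm_ge_zero le1[OF n1]] in auto)
    finally have 1: "norm (f M d) \<le> ?g j ^ M" unfolding f_def by (simp add: prod_norm[symmetric] norm_power)
    have 2: "(?g j)\<^sup>2 \<le> \<rho>"
    proof -
      have "\<delta>\<^sup>2 \<le> (norm (w j ^ d - 1))\<^sup>2" using j(2) \<open>\<delta> > 0\<close> by (intro power_mono) auto
      then show ?thesis unfolding para[OF n1[OF j(1)]] \<rho>_def by simp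
    qed
    have "(norm (f M d))\<^sup>2 \<le> (?g j ^ M)\<^sup>2" using 1 by (intro power_mono) auto
    also have "\<dots> = ((?g j)\<^sup>2) ^ M" by (simp add: power_mult[symmetric] mult.commute)
    also have "\<dots> \<le> \<rho> ^ M" by (rule power_mono[OF 2]) simp
    finally show ?thesis using 2 order_trans[OF zero_le_power2 2] by blast
  qed
  have lower: "1 / real (M + 1) ^ card J \<le> \<rho> ^ M" for M
  proof -
    \<comment> \<open>Binomial expansion of the product: \<kappa> runs over the exponent vectors
      with entries at most M, the a \<kappa> are products of binomial weights with total 1, and z
      \<kappa> is the corresponding monomial in the w j, again in T.\<close>
    define I where "I = PiE J (\<lambda>_. {..M})"
    define a where "a = (\<lambda>\<kappa>::'i \<Rightarrow> nat. \<Prod>j\<in>J. real (M choose \<kappa> j) / 2 ^ M)"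
    define z where "z = (\<lambda>\<kappa>::'i \<Rightarrow> nat. \<Prod>j\<in>J. w j ^ \<kappa> j)"
    have finI: "finite I" unfolding I_def using J(1) by (intro finite_PiE) auto
    have cardI: "card I = (M + 1) ^ card J" unfolding I_def using J(1) by (simp add: card_PiE)
    have zT: "z \<kappa> \<in> T" for \<kappa> unfolding z_def using J by (intro Tprod Tpow) auto
    have expand: "(\<Prod>j\<in>J. ((1 + x j) / 2) ^ M) = (\<Sum>\<kappa>\<in>I. of_real (a \<kappa>) * (\<Prod>j\<in>J. x j ^ \<kappa> j))"
      for x :: "'i \<Rightarrow> complex"
    proof -
      have "((1 + y) / 2) ^ M = (\<Sum>k\<le>M. of_real (real (M choose k) / 2 ^ M) * y ^ k)" for y :: complex
        by (simp add: power_divide binomial_ring[of y 1, simplified add.commute] sum_divide_distrib)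
      then have "(\<Prod>j\<in>J. ((1 + x j) / 2) ^ M) =
          (\<Sum>\<kappa>\<in>I. \<Prod>j\<in>J. of_real (real (M choose \<kappa> j) / 2 ^ M) * x j ^ \<kappa> j)"
        unfolding I_def using J(1) by (simp only: prod_sum_PiE finite_atMost)
      then show ?thesis by (simp only: a_def of_real_prod prod.distrib)
    qed
    have f_eq: "f M d = (\<Sum>\<kappa>\<in>I. of_real (a \<kappa>) * z \<kappa> ^ d)" for d
      unfolding f_def expand z_def by (simp add: prod_power_distrib power_mult[symmetric] mult.commute)
    have sum_a: "(\<Sum>\<kappa>\<in>I. a \<kappa>) = 1"
      using expand[of "\<lambda>_. 1"] by (simp flip: of_real_sum) 
    have a0: "a \<kappa> \<ge> 0" for \<kappa> unfolding a_def by (simp add: prod_nonneg)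
    have normsq: "complex_of_real ((norm (f M d))\<^sup>2) =
       (\<Sum>\<kappa>\<in>I. \<Sum>\<kappa>'\<in>I. of_real (a \<kappa> * a \<kappa>') * (z \<kappa> * cnj (z \<kappa>')) ^ d)" for d
      unfolding complex_norm_square f_eq
      by (simp add: sum_product power_mult_distrib cnj_sum mult_ac)
    let ?mean = "\<lambda>L. (\<Sum>i<L. (norm (f M (2 * i + 1)))\<^sup>2) / real L"
    let ?lim = "(\<Sum>\<kappa>\<in>I. \<Sum>\<kappa>'\<in>I. a \<kappa> * a \<kappa>' * (if z \<kappa> * cnj (z \<kappa>') = 1 then 1 else 0))"
    have "(\<lambda>L. complex_of_real (?mean L)) \<longlonglongrightarrow> of_real ?lim"
    proof -
      have "complex_of_real (?mean L) = (\<Sum>\<kappa>\<in>I. \<Sum>\<kappa>'\<in>I. of_real (a \<kappa> * a \<kappa>') *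
         ((\<Sum>i<L. (z \<kappa> * cnj (z \<kappa>')) ^ (2 * i + 1)) / of_nat L))" for L
      proof -
        have "complex_of_real (?mean L) = (\<Sum>i<L. complex_of_real ((norm (f M (2 * i + 1)))\<^sup>2)) / of_nat L"
          by simp
        also have "\<dots> = (\<Sum>i<L. \<Sum>\<kappa>\<in>I. \<Sum>\<kappa>'\<in>I. of_real (a \<kappa> * a \<kappa>') * (z \<kappa> * cnj (z \<kappa>')) ^ (2 * i + 1)) / of_nat L"
          unfolding normsq ..
        also have "\<dots> = (\<Sum>\<kappa>\<in>I. \<Sum>\<kappa>'\<in>I. \<Sum>i<L. of_real (a \<kappa> * a \<kappa>') * (z \<kappa> * cnj (z \<kappa>')) ^ (2 * i + 1)) / of_nat L"
          by (subst sum.swap, intro arg_cong2[where f = "(/)"] sum.cong refl sum.swap)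
        finally show ?thesis by (simp add: sum_divide_distrib sum_distrib_left)
      qed
      moreover have "(\<lambda>L. \<Sum>\<kappa>\<in>I. \<Sum>\<kappa>'\<in>I. of_real (a \<kappa> * a \<kappa>') *
         ((\<Sum>i<L. (z \<kappa> * cnj (z \<kappa>')) ^ (2 * i + 1)) / of_nat L)) \<longlonglongrightarrow>
         (\<Sum>\<kappa>\<in>I. \<Sum>\<kappa>'\<in>I. of_real (a \<kappa> * a \<kappa>') * (if z \<kappa> * cnj (z \<kappa>') = 1 then 1 else 0))"
      proof (intro tendsto_sum tendsto_mult tendsto_const tendsto_odd_power_mean)
        fix \<kappa> \<kappa>'
        have "z \<kappa> * cnj (z \<kappa>') \<in> T" using zT T(3,4) by blast
        then show "norm (z \<kappa> * cnj (z \<kappa>')) = 1" "z \<kappa> * cnj (z \<kappa>') \<noteq> -1" using T(1,5) by auto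
      qed
      moreover have "(\<Sum>\<kappa>\<in>I. \<Sum>\<kappa>'\<in>I. of_real (a \<kappa> * a \<kappa>') * (if z \<kappa> * cnj (z \<kappa>') = 1 then 1 else 0)) = complex_of_real ?lim"
        unfolding of_real_sum by (intro sum.cong refl) auto
      ultimately show ?thesis by simp
    qed
    then have lim: "?mean \<longlonglongrightarrow> ?lim" by (simp only: tendsto_of_real_iff)
    have "?mean L \<le> \<rho> ^ M" for L
    proof (cases "L = 0")
      case False
      have "(\<Sum>i<L. (norm (f M (2 * i + 1)))\<^sup>2) \<le> (\<Sum>i<L. \<rho> ^ M)" by (intro sum_mono) (use f_le in auto)
      then show ?thesis using False by (simp add: field_simps)
    qed (use f_le[of 1 M] in simp)
    then have up: "?lim \<le> \<rho> ^ M" using lim by (intro LIMSEQ_le_const2[OF lim]) auto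
    define n where "n = real (card I)"
    have n: "n > 0" unfolding n_def cardI by simp
    \<comment> \<open>Cauchy-Schwarz in the form of a nonnegative variance of the weights.\<close>
    have "0 \<le> (\<Sum>\<kappa>\<in>I. (a \<kappa> - 1 / n)\<^sup>2)" by (intro sum_nonneg) simp
    also have "\<dots> = (\<Sum>\<kappa>\<in>I. (a \<kappa>)\<^sup>2) + (\<Sum>\<kappa>\<in>I. (1 / n)\<^sup>2) - (\<Sum>\<kappa>\<in>I. 2 * a \<kappa> * (1 / n))"
      unfolding power2_diff by (simp only: sum.distrib sum_subtractf)
    also have "(\<Sum>\<kappa>\<in>I. 2 * a \<kappa> * (1 / n)) = 2 * (\<Sum>\<kappa>\<in>I. a \<kappa>) * (1 / n)"
      by (simp only: sum_distrib_left sum_distrib_right)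
    also have "(\<Sum>\<kappa>\<in>I. (1 / n)\<^sup>2) = n * (1 / n)\<^sup>2" unfolding n_def by simp
    finally have "1 / n \<le> (\<Sum>\<kappa>\<in>I. (a \<kappa>)\<^sup>2)" using n unfolding sum_a by (simp add: power2_eq_square)
    also have "(\<Sum>\<kappa>\<in>I. (a \<kappa>)\<^sup>2) \<le> ?lim"
    proof (rule sum_mono)
      fix \<kappa> assume \<kappa>: "\<kappa> \<in> I"
      have "z \<kappa> * cnj (z \<kappa>) = 1" using T(1)[OF zT[of \<kappa>]] by (simp add: complex_norm_square[symmetric])
      then have "(a \<kappa>)\<^sup>2 = a \<kappa> * a \<kappa> * (if z \<kappa> * cnj (z \<kappa>) = 1 then 1 else 0)" by (simp add: power2_eq_square)
      also have "\<dots> \<le> (\<Sum>\<kappa>'\<in>I. a \<kappa> * a \<kappa>' * (if z \<kappa> * cnj (z \<kappa>') = 1 then 1 else 0))"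
        using \<kappa> finI a0 by (intro member_le_sum) auto
      finally show "(a \<kappa>)\<^sup>2 \<le> \<dots>" .
    qed
    finally have "1 / n \<le> ?lim" .
    also note up
    finally show ?thesis unfolding n_def cardI by simp
  qed
  have \<rho>: "0 \<le> \<rho>" "\<rho> < 1" using f_le[of 1 0] \<open>\<delta> > 0\<close> unfolding \<rho>_def by auto
  have "0 < 1 / real (1 + 1) ^ card J" by simp
  also have "\<dots> \<le> \<rho> ^ 1" by (rule lower)
  finally have "\<rho> > 0" by simp
  have "(\<lambda>M. real (M + 1) ^ card J * \<rho> ^ M) \<longlonglongrightarrow> 0"
  proof (cases "card J = 0")
    case True
    then show ?thesis using LIMSEQ_power_zero[of \<rho>] \<rho> by simp
  next
    case False
    \<comment> \<open>Taking this root reduces the comparison of a power of M + 1 with \<rho>^M to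
      the limit of M \<sigma>^M.\<close>
    define \<sigma> where "\<sigma> = root (card J) \<rho>"
    have \<sigma>: "0 < \<sigma>" "\<sigma> < 1" "\<sigma> ^ card J = \<rho>"
      using False \<rho> \<open>\<rho> > 0\<close> unfolding \<sigma>_def by auto
    have "(\<lambda>M. real M / (1 / \<sigma>) ^ M) \<longlonglongrightarrow> 0"
      by (rule lim_n_over_pown) (use \<sigma> in auto)
    moreover have "(\<lambda>M. \<sigma> ^ M) \<longlonglongrightarrow> 0" using \<sigma> by (intro LIMSEQ_power_zero) auto
    ultimately have "(\<lambda>M. (real M / (1 / \<sigma>) ^ M + \<sigma> ^ M) ^ card J) \<longlonglongrightarrow> (0 + 0) ^ card J"
      by (intro tendsto_power tendsto_add)
    moreover have "(real M / (1 / \<sigma>) ^ M + \<sigma> ^ M) ^ card J = real (M + 1) ^ card J * \<rho> ^ M" for M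
    proof -
      have "real M / (1 / \<sigma>) ^ M + \<sigma> ^ M = real (M + 1) * \<sigma> ^ M"
        by (simp add: power_divide algebra_simps)
      then show ?thesis
        by (simp add: power_mult_distrib \<sigma>(3)[symmetric] flip: power_mult) (simp add: mult.commute)
    qed
    ultimately show ?thesis using False by (simp add: power_0_left)
  qed
  then have "\<forall>\<^sub>F M in sequentially. real (M + 1) ^ card J * \<rho> ^ M < 1"
    by (rule order_tendstoD) simp
  then obtain M where "real (M + 1) ^ card J * \<rho> ^ M < 1" by (auto simp: eventually_sequentially)
  with lower[of M] show False by (simp add: field_simps)
qed

section \<open>Exponential sums over determinant classes\<close>

lemma sum_powers_root_unity:
  fixes z :: complex
  assumes "z ^ v = 1" "v > 0"
  shows "(\<Sum>c<v. z ^ c) = (if z = 1 then of_nat v else 0)"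
  using assms geometric_sum[of z v] by auto

context finite_subfield_char
begin

text \<open>The case x = 0 is separate because 0^0 = 1: for c = 0 the result must be the trivial
  character extended by 0.\<close>

definition power_char :: "('k \<Rightarrow> complex) \<Rightarrow> nat \<Rightarrow> 'k \<Rightarrow> complex" where
  "power_char \<theta> c x = (if x = 0 then 0 else \<theta> x ^ c)"

lemma mult_char_power_char: "mult_char \<theta> \<Longrightarrow> mult_char (power_char \<theta> c)"
  unfolding mult_char_def power_char_def by (auto simp: power_mult_distrib norm_power)

text \<open>The class of y is detected by the v powers of \<theta>. The term c = 0 does not depend
  on y and goes into C. For invertible b and 0 < c < v the matrix sum is, up to \<delta>, -s times
  the conjugate of the c-th power of \<theta> (det b), the minus sign coming from odd n; summed over
  these c, this leaves -s on the single class with y \<theta> (det b) = 1 and a constant elsewhere.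
  For singular b these terms vanish.\<close>

lemma class_sum:
  assumes \<theta>: "mult_char \<theta>" and v: "v > 0"
    and val: "\<And>x. x \<in> F \<Longrightarrow> x \<noteq> 0 \<Longrightarrow> \<theta> x \<in> roots_unity v"
    and surj: "\<And>y. y \<in> roots_unity v \<Longrightarrow> \<exists>x\<in>F. x \<noteq> 0 \<and> \<theta> x = y"
    and n: "odd n" and \<delta>0: "\<delta> \<ge> 0"
    and near: "\<And>c. 0 < c \<Longrightarrow> c < v \<Longrightarrow>
      norm ((- gauss_sum (power_char \<theta> c) / of_real (sqrt (real Q))) ^ n - 1) \<le> \<delta>"
    and b: "b \<in> mats n n"
  defines "s \<equiv> sqrt (real Q) ^ (n * n)"
  shows "\<exists>C. \<forall>y\<in>roots_unity v.
    norm ((\<Sum>x | x \<in> mats n n \<and> \<theta> (det x) = y. \<psi> (mtrace (b * x))) -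
      (C - (if det b \<noteq> 0 \<and> y * \<theta> (det b) = 1 then of_real s else 0))) \<le> s * \<delta>"
proof -
  let ?Y = "roots_unity v"
  define M where "M = (\<lambda>c. matrix_sum (power_char \<theta> c) n b)"
  define S where "S = (\<lambda>y. \<Sum>x | x \<in> mats n n \<and> \<theta> (det x) = y. \<psi> (mtrace (b * x)))"
  obtain \<zeta> :: complex where \<zeta>: "\<zeta> ^ v = 1" "\<And>c. 0 < c \<Longrightarrow> c < v \<Longrightarrow> \<zeta> ^ c \<noteq> 1"
    using exists_primitive_root_unity[OF v] by blast
  obtain g where g: "g \<in> F" "g \<noteq> 0" "\<theta> g = \<zeta>" using surj[of \<zeta>] \<zeta>(1) by auto
  have s0: "s \<ge> 0" unfolding s_def by simp
  have S_eq: "of_nat v * S y = (\<Sum>c<v. cnj y ^ c * M c)" if y: "y \<in> ?Y" for y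
  proof -
    have y1: "y ^ v = 1" and y0: "y \<noteq> 0" and cnjy: "cnj y = inverse y"
      using y cnj_root_unity[of y v] v by auto
    have "(\<Sum>c<v. cnj y ^ c * M c) = (\<Sum>c<v. \<Sum>x\<in>mats n n. cnj y ^ c * (power_char \<theta> c (det x) * \<psi> (mtrace (b * x))))"
      unfolding M_def matrix_sum_def sum_distrib_left ..
    also have "\<dots> = (\<Sum>x\<in>mats n n. \<Sum>c<v. cnj y ^ c * (power_char \<theta> c (det x) * \<psi> (mtrace (b * x))))"
      by (rule sum.swap)
    also have "\<dots> = (\<Sum>x\<in>mats n n. if \<theta> (det x) = y then of_nat v * \<psi> (mtrace (b * x)) else 0)"
    proof (rule sum.cong[OF refl])
      fix x assume x: "x \<in> mats n n"
      show "(\<Sum>c<v. cnj y ^ c * (power_char \<theta> c (det x) * \<psi> (mtrace (b * x)))) =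
          (if \<theta> (det x) = y then of_nat v * \<psi> (mtrace (b * x)) else 0)"
      proof (cases "det x = 0")
        case True
        then show ?thesis using y0 mult_char_0[OF \<theta>] by (simp add: power_char_def)
      next
        case False
        have dx: "\<theta> (det x) ^ v = 1" using val[OF det_F[OF x] False] by simp
        have "(cnj y * \<theta> (det x)) ^ v = 1"
          using y1 dx unfolding power_mult_distrib by (simp flip: complex_cnj_power)
        moreover have "cnj y * \<theta> (det x) = 1 \<longleftrightarrow> \<theta> (det x) = y"
          unfolding cnjy using y0 by (auto simp: field_simps)
        ultimately have "(\<Sum>c<v. (cnj y * \<theta> (det x)) ^ c) = (if \<theta> (det x) = y then of_nat v else 0)"
          using sum_powers_root_unity[OF _ v] by simp
        moreover have "(\<Sum>c<v. cnj y ^ c * (power_char \<theta> c (det x) * \<psi> (mtrace (b * x)))) =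
            (\<Sum>c<v. (cnj y * \<theta> (det x)) ^ c) * \<psi> (mtrace (b * x))"
          unfolding sum_distrib_right power_char_def using False
          by (intro sum.cong refl) (simp add: power_mult_distrib)
        ultimately show ?thesis by simp
      qed
    qed
    also have "\<dots> = of_nat v * S y"
      unfolding S_def by (simp add: sum.inter_filter[symmetric] finite_mats sum_distrib_left)
    finally show ?thesis by simp
  qed
  have nontriv: "power_char \<theta> c g \<noteq> 1" if "0 < c" "c < v" for c
    using \<zeta>(2)[OF that] g by (simp add: power_char_def)
  have "\<exists>C. \<forall>y\<in>?Y. norm (S y - (C - (if det b \<noteq> 0 \<and> y * \<theta> (det b) = 1 then of_real s else 0))) \<le> s * \<delta>"
  proof (cases "det b = 0")
    case True
    have M0: "M c = 0" if "0 < c" "c < v" for c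
      unfolding M_def by (rule matrix_sum_singular[OF mult_char_power_char[OF \<theta>] g(1,2) nontriv[OF that] b True])
    have "S y = M 0 / of_nat v" if y: "y \<in> ?Y" for y
    proof -
      have "(\<Sum>c<v. cnj y ^ c * M c) = (\<Sum>c\<in>{0}. cnj y ^ c * M c)"
        by (rule sum.mono_neutral_right) (use v M0 in auto)
      then show ?thesis using S_eq[OF y] v by (simp add: field_simps)
    qed
    moreover have "s * \<delta> \<ge> 0" using s0 \<delta>0 by simp
    ultimately show ?thesis using True by (intro exI[of _ "M 0 / of_nat v"]) auto
  next
    case False
    define u where "u = \<theta> (det b)"
    have u: "u ^ v = 1" unfolding u_def using val[OF det_F[OF b] False] by simp
    define \<epsilon> where "\<epsilon> = (\<lambda>c. (- gauss_sum (power_char \<theta> c) / of_real (sqrt (real Q))) ^ n - 1)"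
    have M_eq: "M c = - (of_real s * (cnj u ^ c * (1 + \<epsilon> c)))" if c: "0 < c" "c < v" for c
    proof -
      let ?\<theta> = "power_char \<theta> c"
      have "M c = cnj (?\<theta> (det b)) * (of_real s * (gauss_sum ?\<theta> / of_real (sqrt (real Q))) ^ n)"
        unfolding M_def matrix_sum_invertible[OF mult_char_power_char[OF \<theta>] b False]
          matrix_sum_one[OF mult_char_power_char[OF \<theta>] g(1,2) nontriv[OF c]] s_def by simp
      also have "cnj (?\<theta> (det b)) = cnj u ^ c" unfolding u_def power_char_def using False by simp
      also have "(gauss_sum ?\<theta> / of_real (sqrt (real Q))) ^ n = - (1 + \<epsilon> c)"
        unfolding \<epsilon>_def using n by (simp add: power_minus_odd)
      finally show ?thesis by (simp add: algebra_simps)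
    qed
    \<comment> \<open>The extra s compensates for the term c = 0 that is absent from the sum of the
      powers of w.\<close>
    let ?C = "(M 0 + of_real s) / of_nat v"
    have "norm (S y - (?C - (if y * u = 1 then of_real s else 0))) \<le> s * \<delta>" if y: "y \<in> ?Y" for y
    proof -
      define w where "w = cnj y * cnj u"
      have yu: "(y * u) ^ v = 1" using y u by (simp add: power_mult_distrib)
      have w_cnj: "w = cnj (y * u)" unfolding w_def by simp
      have "w ^ v = cnj ((y * u) ^ v)" unfolding w_cnj complex_cnj_power ..
      then have wv: "w ^ v = 1" unfolding yu by simp
      have wn: "norm w = 1" using cnj_root_unity(2)[OF wv v] .
      have w1: "w = 1 \<longleftrightarrow> y * u = 1" unfolding w_cnj by (metis complex_cnj_cnj complex_cnj_one)
      have split: "(\<Sum>c<v. f c) = f 0 + (\<Sum>c\<in>{1..<v}. f c)" for f :: "nat \<Rightarrow> complex"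
        using v by (simp add: lessThan_atLeast0 sum.atLeast_Suc_lessThan)
      have "of_nat v * S y = M 0 + (\<Sum>c\<in>{1..<v}. cnj y ^ c * M c)"
        unfolding S_eq[OF y] split by simp
      also have "(\<Sum>c\<in>{1..<v}. cnj y ^ c * M c) = (\<Sum>c\<in>{1..<v}. - of_real s * w ^ c + - of_real s * (w ^ c * \<epsilon> c))"
        by (intro sum.cong refl) (simp add: M_eq w_def power_mult_distrib algebra_simps)
      also have "\<dots> = - of_real s * (\<Sum>c\<in>{1..<v}. w ^ c) + - of_real s * (\<Sum>c\<in>{1..<v}. w ^ c * \<epsilon> c)"
        by (simp only: sum.distrib sum_distrib_left)
      also have "(\<Sum>c\<in>{1..<v}. w ^ c) = (if y * u = 1 then of_nat v else 0) - 1"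
        using split[of "\<lambda>c. w ^ c"] sum_powers_root_unity[OF wv v] w1 by (simp add: algebra_simps)
      finally have vS: "of_nat v * S y = M 0 + (- of_real s * ((if y * u = 1 then of_nat v else 0) - 1) +
          - of_real s * (\<Sum>c\<in>{1..<v}. w ^ c * \<epsilon> c))" .
      have "of_nat v * (S y - (?C - (if y * u = 1 then of_real s else 0))) = - of_real s * (\<Sum>c\<in>{1..<v}. w ^ c * \<epsilon> c)"
        unfolding right_diff_distrib vS using v by (simp add: algebra_simps)
      then have "norm (of_nat v * (S y - (?C - (if y * u = 1 then of_real s else 0)))) =
          s * norm (\<Sum>c\<in>{1..<v}. w ^ c * \<epsilon> c)"
        using s0 by (simp add: norm_mult)
      also have "norm (\<Sum>c\<in>{1..<v}. w ^ c * \<epsilon> c) \<le> (\<Sum>c\<in>{1..<v}. \<delta>)"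
      proof (rule sum_norm_le)
        fix c assume "c \<in> {1..<v}"
        then show "norm (w ^ c * \<epsilon> c) \<le> \<delta>" using near[of c] wn unfolding \<epsilon>_def by (simp add: norm_mult norm_power)
      qed
      also have "(\<Sum>c\<in>{1..<v}. \<delta>) = real (v - 1) * \<delta>" by simp
      also have "\<dots> \<le> real v * \<delta>" using \<delta>0 by (intro mult_right_mono) auto
      finally have "real v * norm (S y - (?C - (if y * u = 1 then of_real s else 0))) \<le> s * (real v * \<delta>)"
        using s0 by (simp add: norm_mult mult_left_mono)
      then have "real v * norm (S y - (?C - (if y * u = 1 then of_real s else 0))) \<le> real v * (s * \<delta>)"
        by (simp only: ac_simps)
      then show ?thesis using v by (simp only: mult_le_cancel_left_pos of_nat_0_less_iff)
    qed
    then show ?thesis using False unfolding u_def by (intro exI[of _ ?C]) simp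
  qed
  then show ?thesis unfolding S_def .
qed

text \<open>
  \<open>F\<close> as a vector space over a small field \<open>'a\<close>: \<open>emb\<close> embeds the scalars and \<open>T\<close> is the trace form, with
  \<open>\<psi> = \<psi>\<^sub>0 \<circ> T\<close>.
\<close>

lemma balanced_class_count:
  fixes emb :: "'a::{finite,field} \<Rightarrow> 'k" and T :: "'k \<Rightarrow> 'a" and \<psi>0 :: "'a \<Rightarrow> complex" and f0 :: "complex \<Rightarrow> 'a"
  assumes \<theta>: "mult_char \<theta>" and v: "v > 0"
    and cls: "\<And>b. b \<in> mats n n \<Longrightarrow> \<exists>C. \<forall>y\<in>roots_unity v.
        norm ((\<Sum>x | x \<in> mats n n \<and> \<theta> (det x) = y. \<psi> (mtrace (b * x))) -
          (C - (if det b \<noteq> 0 \<and> y * \<theta> (det b) = 1 then of_real s else 0))) \<le> s * \<delta>"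
    and s: "s \<ge> 0" "\<delta> \<ge> 0"
    and \<psi>0: "finite_subfield_char (UNIV :: 'a set) \<psi>0"
    and emb: "\<And>a. emb a \<in> F" "\<And>a. emb a = 0 \<longleftrightarrow> a = 0" "\<And>a. a \<noteq> 0 \<Longrightarrow> \<theta> (emb a) = 1"
    and T: "\<And>a x. x \<in> F \<Longrightarrow> T (emb a * x) = a * T x" "\<And>x. x \<in> F \<Longrightarrow> \<psi> x = \<psi>0 (T x)"
    and I: "I \<subseteq> roots_unity v" and bal: "\<And>t. card {y \<in> I. f0 y = t} = k"
    and b: "b \<in> mats n n"
  shows "real (card {x \<in> mats n n. \<theta> (det x) \<in> I \<and> f0 (\<theta> (det x)) = T (mtrace (b * x)) + c}) \<le>
    real (card {x \<in> mats n n. \<theta> (det x) \<in> I}) / real CARD('a) + s / real CARD('a) * (1 + real CARD('a) * real v * \<delta>)"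
proof -
  interpret P: finite_subfield_char "UNIV :: 'a set" \<psi>0 by (rule \<psi>0)
  let ?q = "real CARD('a)"
  have q1: "?q > 1" using card_field_gt_1[where 'a = 'a] by simp
  let ?X = "{x \<in> mats n n. \<theta> (det x) \<in> I}"
  let ?u = "\<theta> (det b)"
  have finI: "finite I" using I finite_roots_unity'[OF v] finite_subset by blast
  have finX: "finite ?X" using finite_mats by simp
  have orth: "(\<Sum>a\<in>UNIV. \<psi>0 (a * z)) = (if z = 0 then of_nat CARD('a) else 0)" for z
    using P.sum_psi_scaled[of z] by (simp add: mult.commute)
  have orth': "(\<Sum>a\<in>UNIV - {0}. \<psi>0 (a * z)) = (if z = 0 then of_nat CARD('a) else 0) - 1" for z
    using orth[of z] sum.remove[of UNIV 0 "\<lambda>a. \<psi>0 (a * z)"] P.psi_0 by (simp add: algebra_simps)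
  define A where "A = (\<lambda>a y. \<psi>0 (a * (f0 y - c)))"
  define S where "S = (\<lambda>a y. \<Sum>x | x \<in> mats n n \<and> \<theta> (det x) = y. \<psi> (mtrace ((emb (- a) \<cdot>\<^sub>m b) * x)))"
  define W where "W = (\<lambda>a. \<Sum>y\<in>I. A a y * S a y)"
  define hit where "hit = (det b \<noteq> 0 \<and> inverse ?u \<in> I)"
  have normA: "norm (A a y) = 1" for a y unfolding A_def using P.psi_norm by simp
  \<comment> \<open>Each label occurs k times, so the constants C of the class sums cancel for every
    a \<noteq> 0.\<close>
  have sumA: "(\<Sum>y\<in>I. A a y) = 0" if "a \<noteq> 0" for a
  proof -
    have "(\<Sum>y\<in>I. A a y) = (\<Sum>t\<in>UNIV. \<Sum>y | y \<in> I \<and> f0 y = t. A a y)"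
      by (rule sum.group[symmetric]) (use finI in auto)
    also have "\<dots> = (\<Sum>t\<in>UNIV. of_nat k * \<psi>0 (a * (t - c)))"
      by (intro sum.cong refl) (simp add: A_def bal)
    also have "\<dots> = of_nat k * (\<Sum>t\<in>UNIV. \<psi>0 (a * (t - c)))" by (simp add: sum_distrib_left)
    also have "(\<Sum>t\<in>UNIV. \<psi>0 (a * (t - c))) = (\<Sum>t\<in>UNIV. \<psi>0 (a * t))"
      by (rule sum.reindex_bij_witness[of _ "\<lambda>t. t + c" "\<lambda>t. t - c"]) auto
    also have "\<dots> = 0" using P.sum_psi_scaled[of a] that by simp
    finally show ?thesis by simp
  qed
  have W: "norm (W a + (if hit then of_real s * A a (inverse ?u) else 0)) \<le> real v * (s * \<delta>)" if a: "a \<noteq> 0" for a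
  proof -
    let ?b = "emb (- a) \<cdot>\<^sub>m b"
    have ea: "emb (- a) \<noteq> 0" using a emb(2)[of "- a"] by simp
    have bm: "?b \<in> mats n n" by (rule smult_mats[OF emb(1) b])
    have db: "det ?b = emb (- a) ^ n * det b" using mats_carrier[OF b] by (simp add: det_smult)
    have epow: "emb (- a) ^ m \<in> F \<and> \<theta> (emb (- a) ^ m) = 1" for m
      by (induction m) (use emb(1,3)[of "- a"] a mult_char_mult[OF \<theta>] mult_char_1[OF \<theta>] one_F mult_F in auto)
    \<comment> \<open>Nonzero scalars are in the kernel of \<theta>, so the same class is hit for
      every a \<noteq> 0 and the contributions combine to a full character sum over a.\<close>
    have \<theta>b: "\<theta> (det ?b) = ?u" unfolding db
      using mult_char_mult[OF \<theta> conjunct1[OF epow[of n]] det_F[OF b]] epow[of n] by simp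
    have nz: "det ?b \<noteq> 0 \<longleftrightarrow> det b \<noteq> 0" unfolding db using ea by simp
    obtain C where C: "\<And>y. y \<in> roots_unity v \<Longrightarrow>
        norm (S a y - (C - (if det b \<noteq> 0 \<and> y * ?u = 1 then of_real s else 0))) \<le> s * \<delta>"
      using cls[OF bm] unfolding S_def \<theta>b nz by blast
    have ind: "(\<Sum>y\<in>I. A a y * (if det b \<noteq> 0 \<and> y * ?u = 1 then of_real s else 0)) =
        (if hit then of_real s * A a (inverse ?u) else 0)"
    proof (cases "det b \<noteq> 0")
      case True
      have "?u \<noteq> 0" using mult_char_norm[OF \<theta> det_F[OF b] True] by auto
      then have "y * ?u = 1 \<longleftrightarrow> y = inverse ?u" for y by (auto simp: field_simps)
      then have "(\<Sum>y\<in>I. A a y * (if det b \<noteq> 0 \<and> y * ?u = 1 then of_real s else 0)) =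
          (\<Sum>y\<in>I. if y = inverse ?u then of_real s * A a (inverse ?u) else 0)"
        using True by (intro sum.cong refl) simp
      then show ?thesis using True finI unfolding hit_def by simp
    qed (simp add: hit_def)
    have "W a + (if hit then of_real s * A a (inverse ?u) else 0) =
        (\<Sum>y\<in>I. A a y * (S a y - (C - (if det b \<noteq> 0 \<and> y * ?u = 1 then of_real s else 0)))) + (\<Sum>y\<in>I. A a y) * C"
      unfolding W_def ind[symmetric] sum_distrib_right sum.distrib[symmetric]
      by (intro sum.cong refl) (simp add: algebra_simps)
    also have "\<dots> = (\<Sum>y\<in>I. A a y * (S a y - (C - (if det b \<noteq> 0 \<and> y * ?u = 1 then of_real s else 0))))"
      unfolding sumA[OF a] by simp
    also have "norm \<dots> \<le> (\<Sum>y\<in>I. s * \<delta>)"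
    proof (rule sum_norm_le)
      fix y assume "y \<in> I"
      then have "y \<in> roots_unity v" using I by blast
      then show "norm (A a y * (S a y - (C - (if det b \<noteq> 0 \<and> y * ?u = 1 then of_real s else 0)))) \<le> s * \<delta>"
        unfolding norm_mult normA using C by simp
    qed
    also have "\<dots> = real (card I) * (s * \<delta>)" by simp
    also have "\<dots> \<le> real v * (s * \<delta>)"
    proof (rule mult_right_mono)
      have "card I \<le> v" using card_mono[OF finite_roots_unity'[OF v] I] card_roots_unity_eq[OF v] by simp
      then show "real (card I) \<le> real v" by simp
    qed (use s in simp)
    finally show ?thesis .
  qed
  have psi_T: "\<psi> (mtrace ((emb (- a) \<cdot>\<^sub>m b) * x)) = \<psi>0 (- a * T (mtrace (b * x)))" if x: "x \<in> mats n n" for a x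
  proof -
    have bx: "b * x \<in> mats n n" by (rule mult_mats[OF b x])
    have "(emb (- a) \<cdot>\<^sub>m b) * x = emb (- a) \<cdot>\<^sub>m (b * x)"
      by (rule mult_smult_assoc_mat[OF mats_carrier[OF b] mats_carrier[OF x]])
    then have "mtrace ((emb (- a) \<cdot>\<^sub>m b) * x) = emb (- a) * mtrace (b * x)"
      using carrier_matD[OF mats_carrier[OF b]] carrier_matD[OF mats_carrier[OF x]]
      unfolding mtrace_def by (simp add: sum_distrib_left)
    then show ?thesis using T(2)[OF mult_F[OF emb(1)[of "- a"] mtrace_F[OF bx]]] T(1)[OF mtrace_F[OF bx], of "- a"] by simp
  qed
  have W_eq: "W a = (\<Sum>x\<in>?X. \<psi>0 (a * (f0 (\<theta> (det x)) - T (mtrace (b * x)) - c)))" for a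
  proof -
    have "(\<Sum>x\<in>?X. \<psi>0 (a * (f0 (\<theta> (det x)) - T (mtrace (b * x)) - c))) =
        (\<Sum>y\<in>I. \<Sum>x | x \<in> ?X \<and> \<theta> (det x) = y. \<psi>0 (a * (f0 (\<theta> (det x)) - T (mtrace (b * x)) - c)))"
      by (rule sum.group[symmetric]) (use finX finI in auto)
    also have "\<dots> = W a" unfolding W_def S_def sum_distrib_left
    proof (intro sum.cong refl)
      fix y assume "y \<in> I"
      then show "{x \<in> ?X. \<theta> (det x) = y} = {x \<in> mats n n. \<theta> (det x) = y}" by auto
      fix x assume "x \<in> {x \<in> mats n n. \<theta> (det x) = y}"
      then have x: "x \<in> mats n n" "\<theta> (det x) = y" by auto
      have "a * (f0 y - T (mtrace (b * x)) - c) = a * (f0 y - c) + - a * T (mtrace (b * x))" by (simp add: algebra_simps)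
      then show "\<psi>0 (a * (f0 (\<theta> (det x)) - T (mtrace (b * x)) - c)) = A a y * \<psi> (mtrace ((emb (- a) \<cdot>\<^sub>m b) * x))"
        unfolding psi_T[OF x(1)] A_def x(2) by (simp only: P.psi_add[OF UNIV_I UNIV_I])
    qed
    finally show ?thesis by simp
  qed
  let ?N = "card {x \<in> mats n n. \<theta> (det x) \<in> I \<and> f0 (\<theta> (det x)) = T (mtrace (b * x)) + c}"
  have "complex_of_real (?q * real ?N) = (\<Sum>x\<in>?X. if f0 (\<theta> (det x)) - T (mtrace (b * x)) - c = 0 then of_nat CARD('a) else 0)"
  proof -
    have "{x \<in> mats n n. \<theta> (det x) \<in> I \<and> f0 (\<theta> (det x)) = T (mtrace (b * x)) + c} =
        {x \<in> ?X. f0 (\<theta> (det x)) - T (mtrace (b * x)) - c = 0}" by (auto simp: algebra_simps)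
    then show ?thesis using finX by (simp add: sum.inter_filter[symmetric])
  qed
  also have "\<dots> = (\<Sum>x\<in>?X. \<Sum>a\<in>UNIV. \<psi>0 (a * (f0 (\<theta> (det x)) - T (mtrace (b * x)) - c)))"
    unfolding orth ..
  also have "\<dots> = (\<Sum>a\<in>UNIV. W a)" unfolding W_eq by (rule sum.swap)
  also have "\<dots> = W 0 + (\<Sum>a\<in>UNIV - {0}. W a)" by (rule sum.remove) auto
  also have "W 0 = of_nat (card ?X)" unfolding W_eq using P.psi_0 by simp
  also have "(\<Sum>a\<in>UNIV - {0}. W a) =
      (\<Sum>a\<in>UNIV - {0}. W a + (if hit then of_real s * A a (inverse ?u) else 0)) -
      (if hit then of_real s * (\<Sum>a\<in>UNIV - {0}. A a (inverse ?u)) else 0)"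
    by (simp add: sum.distrib sum_distrib_left)
  also have "(if hit then of_real s * (\<Sum>a\<in>UNIV - {0}. A a (inverse ?u)) else 0) =
      complex_of_real (if hit then s * ((if f0 (inverse ?u) = c then ?q else 0) - 1) else 0)"
    unfolding A_def orth' by simp
  finally have complex_eq: "complex_of_real (?q * real ?N) = of_nat (card ?X) +
      ((\<Sum>a\<in>UNIV - {0}. W a + (if hit then of_real s * A a (inverse ?u) else 0)) -
       complex_of_real (if hit then s * ((if f0 (inverse ?u) = c then ?q else 0) - 1) else 0))" .
  have eq: "?q * real ?N = real (card ?X) +
      (Re (\<Sum>a\<in>UNIV - {0}. W a + (if hit then of_real s * A a (inverse ?u) else 0)) -
       (if hit then s * ((if f0 (inverse ?u) = c then ?q else 0) - 1) else 0))"
    using arg_cong[OF complex_eq, of Re]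
    by (simp only: Re_complex_of_real plus_complex.sel minus_complex.sel complex_Re_of_nat)
  have "Re (\<Sum>a\<in>UNIV - {0}. W a + (if hit then of_real s * A a (inverse ?u) else 0)) \<le>
      norm (\<Sum>a\<in>UNIV - {0}. W a + (if hit then of_real s * A a (inverse ?u) else 0))"
    by (rule complex_Re_le_cmod)
  also have "\<dots> \<le> (\<Sum>a\<in>(UNIV :: 'a set) - {0}. real v * (s * \<delta>))"
    by (rule sum_norm_le) (use W in auto)
  also have "\<dots> \<le> (\<Sum>a\<in>(UNIV :: 'a set). real v * (s * \<delta>))"
    by (rule sum_mono2) (use s in auto)
  also have "\<dots> = ?q * (real v * (s * \<delta>))" by simp
  finally have err: "Re (\<Sum>a\<in>UNIV - {0}. W a + (if hit then of_real s * A a (inverse ?u) else 0)) \<le> ?q * (real v * (s * \<delta>))" .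
  \<comment> \<open>The extremal profile, before division by q: the constant f0 (inverse u) loses (q
    - 1) s and every other one gains s.\<close>
  have "- (if hit then s * ((if f0 (inverse ?u) = c then ?q else 0) - 1) else 0) \<le> s"
    using s(1) q1 by (auto simp: algebra_simps)
  then have "?q * real ?N \<le> real (card ?X) + (?q * (real v * (s * \<delta>)) + s)" unfolding eq using err by linarith
  then have "real ?N \<le> (real (card ?X) + (?q * (real v * (s * \<delta>)) + s)) / ?q"
    using q1 by (simp add: pos_le_divide_eq mult.commute)
  also have "\<dots> = real (card ?X) / ?q + s / ?q * (1 + ?q * real v * \<delta>)"
    by (simp add: add_divide_distrib distrib_left ac_simps)
  finally show ?thesis .
qed

end

section \<open>Finite subfields of the algebraic closure\<close>

lemma power_card_eq_same:
  fixes x :: "'a::{finite,field}" shows "x ^ CARD('a) = x"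
proof (cases "x = 0")
  case True
  then show ?thesis using card_field_gt_1[where 'a = 'a] by (simp add: power_0_left)
next
  case False
  have "(\<Prod>y\<in>UNIV - {0}. y) = (\<Prod>y\<in>UNIV - {0}. x * y)"
    by (rule prod.reindex_bij_witness[of _ "\<lambda>y. x * y" "\<lambda>y. y / x"]) (use False in auto)
  also have "\<dots> = x ^ (CARD('a) - 1) * (\<Prod>y\<in>UNIV - {0}. y)" by (simp add: prod.distrib)
  finally have "x ^ (CARD('a) - 1) = 1" by simp
  then have "x * x ^ (CARD('a) - 1) = x" by simp
  then show ?thesis using card_field_gt_1[where 'a = 'a] by (simp flip: power_Suc)
qed

lemma card_roots_separable:
  fixes P :: "'k::alg_closed_field poly"
  assumes "P \<noteq> 0" "\<And>x. poly P x = 0 \<Longrightarrow> poly (pderiv P) x \<noteq> 0"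
  shows "card {x. poly P x = 0} = degree P"
proof -
  obtain A where A: "size A = degree P" "P = smult (lead_coeff P) (\<Prod>x\<in>#A. [:- x, 1:])"
    using alg_closed_imp_factorization[OF assms(1)] by blast
  have roots: "{x. poly P x = 0} = set_mset A"
    using assms(1) by (subst A(2)) (auto simp: poly_prod_mset)
  have "count A x = 1" if x: "x \<in># A" for x
  proof (rule ccontr)
    assume "count A x \<noteq> 1"
    then have "x \<in># A - {#x#}" using x by (metis count_greater_zero_iff count_single in_diff_count nat_neq_iff less_one)
    then obtain B where "A = add_mset x (add_mset x B)" using x by (metis insert_DiffM)
    then have "P = [:- x, 1:] * ([:- x, 1:] * smult (lead_coeff P) (\<Prod>x\<in>#B. [:- x, 1:]))"
      by (subst A(2)) simp
    then obtain R where R: "P = [:- x, 1:] * ([:- x, 1:] * R)" by blast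
    have "pderiv P = [:- x, 1:] * pderiv ([:- x, 1:] * R) + ([:- x, 1:] * R) * pderiv [:- x, 1:]"
      by (subst R) (rule pderiv_mult)
    then have "poly (pderiv P) x = 0" by simp
    moreover have "poly P x = 0" by (subst R) simp
    ultimately
    show False using assms(2) by blast
  qed
  then have "size A = card (set_mset A)" unfolding size_multiset_overloaded_eq by simp
  then show ?thesis using A(1) roots by simp
qed


lemma degree_monom_diff:
  assumes "m < n" shows "Polynomial.degree (Polynomial.monom 1 n - Polynomial.monom 1 m :: 'k::field poly) = n"
proof -
  have "Polynomial.degree (Polynomial.monom 1 n + - Polynomial.monom 1 m :: 'k poly) = Polynomial.degree (Polynomial.monom 1 n :: 'k poly)"
    by (rule degree_add_eq_left) (use assms in \<open>simp add: Polynomial.degree_monom_eq\<close>)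
  then show ?thesis by (simp add: Polynomial.degree_monom_eq)
qed

lemma card_power_eq_le:
  assumes "m < n" shows "card {x :: 'k::field. x ^ n = x ^ m} \<le> n" "finite {x :: 'k. x ^ n = x ^ m}"
proof -
  let ?P = "Polynomial.monom 1 n - Polynomial.monom 1 m :: 'k poly"
  have deg: "Polynomial.degree ?P = n" by (rule degree_monom_diff[OF assms])
  have nz: "?P \<noteq> 0" using deg assms by auto
  have eq: "{x :: 'k. x ^ n = x ^ m} = {x. poly ?P x = 0}" by (simp add: poly_monom)
  show "card {x :: 'k. x ^ n = x ^ m} \<le> n" unfolding eq using card_poly_roots_bound[OF nz] deg by simp
  show "finite {x :: 'k. x ^ n = x ^ m}" unfolding eq by (rule poly_roots_finite[OF nz])
qed

text \<open>The derivative of X^n - X is -1 because n vanishes in the field, so all roots are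
  simple.\<close>

lemma card_power_eq_self:
  assumes n: "n > 1" and char: "of_nat n = (0 :: 'k::alg_closed_field)"
  shows "card {x :: 'k. x ^ n = x} = n"
proof -
  let ?P = "Polynomial.monom 1 n - Polynomial.monom 1 1 :: 'k poly"
  have deg: "Polynomial.degree ?P = n" by (rule degree_monom_diff[OF n])
  have nz: "?P \<noteq> 0" using deg n by auto
  have "card {x. poly ?P x = 0} = Polynomial.degree ?P"
    by (rule card_roots_separable[OF nz]) (simp add: pderiv_diff pderiv_monom poly_monom char)
  moreover have "{x :: 'k. x ^ n = x} = {x. poly ?P x = 0}" by (simp add: poly_monom)
  ultimately show ?thesis unfolding deg by simp
qed

lemma card_power_eq_one:
  assumes n: "n > 0" and char: "of_nat n \<noteq> (0 :: 'k::alg_closed_field)"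
  shows "card {x :: 'k. x ^ n = 1} = n"
proof -
  let ?P = "Polynomial.monom 1 n - Polynomial.monom 1 0 :: 'k poly"
  have deg: "Polynomial.degree ?P = n" by (rule degree_monom_diff[OF n])
  have nz: "?P \<noteq> 0" using deg n by auto
  have "card {x. poly ?P x = 0} = Polynomial.degree ?P"
  proof (rule card_roots_separable[OF nz])
    fix x assume "poly ?P x = 0"
    then have "x ^ n = 1" by (simp add: poly_monom)
    then have "x \<noteq> 0" using n by (auto simp: power_0_left)
    then show "poly (pderiv ?P) x \<noteq> 0" using char by (simp add: pderiv_diff pderiv_monom poly_monom)
  qed
  moreover have "{x :: 'k. x ^ n = 1} = {x. poly ?P x = 0}" by (simp add: poly_monom)
  ultimately show ?thesis unfolding deg by simp
qed

section \<open>Frobenius fixed fields, traces and characters\<close>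

lemma CHAR_finite_field:
  assumes "prime p" "CARD('a::{finite,field}) = p ^ k" shows "CHAR('a) = p"
proof -
  have "CHAR('a) > 0" by (rule finite_imp_CHAR_pos) simp
  then have "prime CHAR('a)" by (rule prime_CHAR_semidom)
  moreover have "CHAR('a) dvd p ^ k" using CHAR_dvd_CARD[where 'a = 'a] assms(2) by simp
  ultimately show ?thesis using assms(1) by (metis prime_dvd_power primes_dvd_imp_eq)
qed

lemma finite_subfield_frobenius:
  assumes p: "prime p" "CHAR('k::alg_closed_field) = p" and m: "m > 0"
  shows "finite_subfield {x :: 'k. x ^ (p ^ m) = x}" "card {x :: 'k. x ^ (p ^ m) = x} = p ^ m"
proof -
  have pm: "p ^ m > 1" using p(1) m by (metis one_less_power prime_gt_1_nat)
  have pr: "prime CHAR('k)" using p by simp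
  \<comment> \<open>Additivity of Frobenius gives this for p = 2 as well, where p^m is even.\<close>
  have neg: "(- x) ^ (p ^ m) = - (x ^ (p ^ m))" for x :: 'k
  proof -
    have "(x + - x) ^ (p ^ m) = x ^ (p ^ m) + (- x) ^ (p ^ m)" by (rule freshmans_dream'[OF pr]) (simp add: p(2))
    moreover have "(0 :: 'k) ^ (p ^ m) = 0" by (rule zero_power) (use pm in linarith)
    ultimately have "x ^ (p ^ m) + (- x) ^ (p ^ m) = 0" by (simp only: right_minus)
    then show ?thesis by (simp only: add_eq_0_iff)
  qed
  show "finite_subfield {x :: 'k. x ^ (p ^ m) = x}"
  proof
    show "finite {x :: 'k. x ^ (p ^ m) = x}" using card_power_eq_le(2)[OF pm, where 'k = 'k] by simp
    fix x y :: 'k assume xy: "x \<in> {x. x ^ (p ^ m) = x}" "y \<in> {x. x ^ (p ^ m) = x}"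
    have "(x + y) ^ (p ^ m) = x ^ (p ^ m) + y ^ (p ^ m)" by (rule freshmans_dream'[OF pr]) (simp add: p(2))
    then show "x + y \<in> {x. x ^ (p ^ m) = x}" using xy by simp
    show "x * y \<in> {x. x ^ (p ^ m) = x}" using xy by (simp add: power_mult_distrib)
  qed (use pm neg prime_gt_0_nat[OF p(1)] in \<open>auto simp: power_0_left power_inverse\<close>)
  have "of_nat (p ^ m) = (0 :: 'k)"
    using of_nat_CHAR[where 'a = 'k] m unfolding p(2) by (simp add: power_0_left)
  then show "card {x :: 'k. x ^ (p ^ m) = x} = p ^ m" by (rule card_power_eq_self[OF pm])
qed

text \<open>On the fixed points of x \<mapsto> x^(B^f) this is the trace down to the field with q
  elements for B = q, and the absolute trace for B = p.\<close>

definition power_sum_trace :: "nat \<Rightarrow> nat \<Rightarrow> 'k::comm_semiring_1 \<Rightarrow> 'k" where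
  "power_sum_trace B f x = (\<Sum>j<f. x ^ (B ^ j))"

text \<open>The trace is a nonzero polynomial of degree at most B^(f-1), so it has fewer roots than
  A has elements.\<close>

lemma power_sum_trace_nonzero:
  assumes B: "B > 1" and f: "f > 0" and A: "finite A" "card A \<ge> B ^ f"
  obtains x :: "'k::field" where "x \<in> A" "power_sum_trace B f x \<noteq> 0"
proof -
  let ?P = "\<Sum>j<f. Polynomial.monom 1 (B ^ j) :: 'k poly"
  have eval: "poly ?P x = power_sum_trace B f x" for x
    by (simp add: power_sum_trace_def poly_sum poly_monom)
  have deg: "Polynomial.degree ?P \<le> B ^ (f - 1)"
  proof (rule degree_sum_le)
    fix j assume "j \<in> {..<f}"
    then have "B ^ j \<le> B ^ (f - 1)" using B by (intro power_increasing) auto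
    then show "Polynomial.degree (Polynomial.monom 1 (B ^ j) :: 'k poly) \<le> B ^ (f - 1)"
      by (simp add: Polynomial.degree_monom_eq)
  qed simp
  have "coeff ?P (B ^ 0) = (\<Sum>j<f. if j = 0 then 1 else 0)"
    unfolding coeff_sum using B by (intro sum.cong refl) auto
  then have "coeff ?P (B ^ 0) = 1" using f by simp
  then have nz: "?P \<noteq> 0" by auto
  have "\<not> A \<subseteq> {x. poly ?P x = 0}"
  proof
    assume "A \<subseteq> {x. poly ?P x = 0}"
    then have "card A \<le> card {x. poly ?P x = 0}" by (rule card_mono[OF poly_roots_finite[OF nz]])
    also have "\<dots> \<le> B ^ (f - 1)" using card_poly_roots_bound[OF nz] deg by simp
    also have "\<dots> < B ^ f" using B f by (intro power_strict_increasing) auto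
    finally show False using A(2) by simp
  qed
  then show ?thesis using that unfolding eval by blast
qed

lemma power_sum_trace_add:
  assumes "prime CHAR('k::field)" "B = CHAR('k) ^ e"
  shows "power_sum_trace B f (x + y :: 'k) = power_sum_trace B f x + power_sum_trace B f y"
proof -
  have "(x + y) ^ (B ^ j) = x ^ (B ^ j) + y ^ (B ^ j)" for j
    by (rule freshmans_dream'[OF assms(1), of _ "e * j"]) (simp add: assms(2) power_mult)
  then show ?thesis unfolding power_sum_trace_def by (simp add: sum.distrib)
qed

lemma power_sum_trace_Suc:
  fixes x :: "'k::field"
  assumes "x ^ (B ^ f) = x"
  shows "(\<Sum>j<f. x ^ (B ^ Suc j)) = power_sum_trace B f x"
proof (cases f)
  case (Suc m)
  have "(\<Sum>j<f. x ^ (B ^ Suc j)) + x ^ (B ^ 0) = (\<Sum>j<Suc f. x ^ (B ^ j))"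
    by (simp only: sum.lessThan_Suc_shift add.commute)
  also have "\<dots> = power_sum_trace B f x + x" unfolding power_sum_trace_def using assms by simp
  finally show ?thesis by simp
qed (simp add: power_sum_trace_def)

text \<open>Frobenius commutes with the trace; for P = B it permutes the summands cyclically, so the
  trace is fixed and lies in the small field.\<close>

lemma power_sum_trace_power:
  fixes x :: "'k::field"
  assumes "prime CHAR('k)" "P = CHAR('k) ^ e"
  shows "power_sum_trace B f x ^ P = power_sum_trace B f (x ^ P)"
    and "x ^ (B ^ f) = x \<Longrightarrow> B = P \<Longrightarrow> power_sum_trace B f x ^ P = power_sum_trace B f x"
proof -
  show 1: "power_sum_trace B f x ^ P = power_sum_trace B f (x ^ P)"
    unfolding power_sum_trace_def freshmans_dream_sum'[OF assms]
    by (intro sum.cong refl) (simp only: power_mult[symmetric] mult.commute)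
  show "power_sum_trace B f x ^ P = power_sum_trace B f x" if "x ^ (B ^ f) = x" "B = P"
  proof -
    have "power_sum_trace B f (x ^ P) = (\<Sum>j<f. x ^ (B ^ Suc j))"
      unfolding power_sum_trace_def that(2) by (intro sum.cong refl) (simp add: power_mult[symmetric])
    then show ?thesis unfolding 1 power_sum_trace_Suc[OF that(1)] .
  qed
qed

text \<open>The character is \<omega> raised to the absolute trace. Its invariance under t \<mapsto>
  t^p is what makes the coefficients of the Gauss sums invariant under Frobenius.\<close>

lemma exists_frobenius_character:
  assumes p: "prime p" and k: "k > 0" "CARD('a::{finite,field}) = p ^ k"
  obtains \<psi>0 :: "'a::{finite,field} \<Rightarrow> complex" where "finite_subfield_char UNIV \<psi>0" "\<And>t. \<psi>0 (t ^ p) = \<psi>0 t"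
proof -
  have char: "CHAR('a) = p" by (rule CHAR_finite_field[OF p k(2)])
  have p1: "p > 1" using p prime_gt_1_nat by blast
  have pr: "prime CHAR('a)" "p = CHAR('a) ^ 1" using p char by simp_all
  define tr :: "'a \<Rightarrow> 'a" where "tr = power_sum_trace p k"
  have xq: "x ^ (p ^ k) = x" for x :: 'a using power_card_eq_same[of x] k(2) by simp
  have tr_p: "tr x ^ p = tr x" for x unfolding tr_def by (rule power_sum_trace_power(2)[OF pr xq refl])
  have prime_field: "{x :: 'a. x ^ p = x} = of_nat ` {..<p}"
  proof (rule sym, rule card_subset_eq)
    have le: "card {x :: 'a. x ^ p = x} \<le> p" "finite {x :: 'a. x ^ p = x}"
      using card_power_eq_le[of 1 p, where 'k = 'a] p1 by simp_all
    show "finite {x :: 'a. x ^ p = x}" by (rule le(2))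
    show sub: "of_nat ` {..<p} \<subseteq> {x :: 'a. x ^ p = x}"
    proof (rule image_subsetI)
      fix j
      have "(of_nat j :: 'a) ^ p = of_nat j"
      proof (induction j)
        case (Suc j)
        then show ?case using freshmans_dream[OF pr(1), of p "1 :: 'a" "of_nat j"] char by simp
      qed (use p1 in \<open>simp add: power_0_left\<close>)
      then show "(of_nat j :: 'a) \<in> {x. x ^ p = x}" by simp
    qed
    have inj: "inj_on (of_nat :: nat \<Rightarrow> 'a) {..<p}"
      by (rule inj_onI) (simp add: of_nat_eq_iff_cong_CHAR char cong_def)
    show "card (of_nat ` {..<p} :: 'a set) = card {x :: 'a. x ^ p = x}"
      using le card_mono[OF le(2) sub] card_image[OF inj] by simp
  qed
  obtain \<omega> :: complex where \<omega>: "\<omega> ^ p = 1" "\<omega> \<noteq> 1"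
  proof -
    have "card (roots_unity p) > card {1 :: complex}" using card_roots_unity_eq[of p] p1 by simp
    then have "\<not> roots_unity p \<subseteq> {1}" using card_mono[of "{1 :: complex}" "roots_unity p"] by auto
    then show ?thesis using that by auto
  qed
  have \<omega>n: "norm \<omega> = 1" using cnj_root_unity(2)[OF \<omega>(1)] p1 by simp
  \<comment> \<open>An exponent representing an element of the prime field. The power of \<omega> is
    independent of the choice, as \<omega>^p = 1.\<close>
  define idx where "idx = (\<lambda>x :: 'a. SOME j. of_nat j = x)"
  have idx: "of_nat (idx (tr x)) = tr x" for x
  proof -
    have "tr x \<in> of_nat ` {..<p}" unfolding prime_field[symmetric] using tr_p by simp
    then have "\<exists>j. of_nat j = tr x" by auto
    then show ?thesis unfolding idx_def by (rule someI_ex)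
  qed
  have \<omega>_eq: "\<omega> ^ i = \<omega> ^ j" if "(of_nat i :: 'a) = of_nat j" for i j
    by (rule power_cong_exponent[OF \<omega>(1)]) (use that in \<open>simp add: of_nat_eq_iff_cong_CHAR char\<close>)
  define \<psi>0 where "\<psi>0 = (\<lambda>x. \<omega> ^ idx (tr x))"
  have tr_add: "tr (x + y) = tr x + tr y" for x y
    unfolding tr_def by (rule power_sum_trace_add[OF pr])
  have "finite_subfield_char (UNIV :: 'a set) \<psi>0"
  proof
    fix x y :: 'a
    have "of_nat (idx (tr (x + y))) = tr x + tr y" unfolding idx by (rule tr_add)
    also have "\<dots> = (of_nat (idx (tr x) + idx (tr y)) :: 'a)" by (simp add: idx)
    finally have "of_nat (idx (tr (x + y))) = (of_nat (idx (tr x) + idx (tr y)) :: 'a)" .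
    then have "\<psi>0 (x + y) = \<omega> ^ (idx (tr x) + idx (tr y))" unfolding \<psi>0_def by (rule \<omega>_eq)
    then show "\<psi>0 (x + y) = \<psi>0 x * \<psi>0 y" unfolding \<psi>0_def by (simp add: power_add)
    show "norm (\<psi>0 x) = 1" unfolding \<psi>0_def by (simp add: norm_power \<omega>n)
  next
    obtain x :: 'a where x: "tr x \<noteq> 0"
      unfolding tr_def by (rule power_sum_trace_nonzero[OF p1 k(1), of UNIV]) (use k(2) in auto)
    have "\<not> p dvd idx (tr x)"
    proof
      assume "p dvd idx (tr x)"
      then have "(of_nat (idx (tr x)) :: 'a) = 0" unfolding of_nat_eq_0_iff_char_dvd char .
      then show False using idx x by simp
    qed
    then have "coprime (idx (tr x)) p" using p by (metis coprime_commute prime_imp_coprime)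
    then have "\<psi>0 x \<noteq> 1" unfolding \<psi>0_def using power_eq_one_coprime[of \<omega> "idx (tr x)" p] \<omega> by blast
    then show "\<exists>x\<in>UNIV. \<psi>0 x \<noteq> 1" by blast
  qed auto
  moreover have "\<psi>0 (t ^ p) = \<psi>0 t" for t
  proof -
    have "tr (t ^ p) = tr t" unfolding tr_def power_sum_trace_power(1)[OF pr, symmetric]
      using tr_p[of t] unfolding tr_def .
    then show ?thesis unfolding \<psi>0_def by simp
  qed
  ultimately show ?thesis using that by blast
qed

text \<open>\<theta> is the discrete logarithm of x^((Q-1)/v) to a generator g of the v-th roots of
  unity in the ambient field, transported to a complex root of unity of order v. Since v is a power
  of r, any v-th root of unity that is not an r^(N-1)-th one generates, so g comes from a count of
  roots.\<close>

lemma exists_class_character: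
  fixes F :: "'k::alg_closed_field set"
  assumes F: "finite_subfield F" "F = {x. x ^ Q = x}" "card F = Q"
    and r: "prime r" "v = r ^ N" "N > 0" "of_nat v \<noteq> (0 :: 'k)" and dvd: "v dvd Q - 1"
  obtains \<theta> :: "'k \<Rightarrow> complex" where "finite_subfield.mult_char F \<theta>"
    "\<And>x. x \<in> F \<Longrightarrow> x \<noteq> 0 \<Longrightarrow> \<theta> x \<in> roots_unity v"
    "\<And>y. y \<in> roots_unity v \<Longrightarrow> \<exists>x\<in>F. x \<noteq> 0 \<and> \<theta> x = y"
    "\<And>x. x \<in> F \<Longrightarrow> x ^ ((Q - 1) div v) = 1 \<Longrightarrow> \<theta> x = 1"
proof -
  interpret finite_subfield F by (rule F(1))
  have Q1: "Q > 1" using Q_gt_1 F(3) by simp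
  have r1: "r > 1" using r(1) prime_gt_1_nat by blast
  have v1: "v > 1" unfolding r(2) using r1 r(3) by (rule one_less_power)
  define h where "h = (Q - 1) div v"
  have hv: "h * v = Q - 1" unfolding h_def using dvd by simp
  have h0: "h > 0" using hv Q1 by (cases "h = 0") auto
  have pow1: "x ^ (Q - 1) = 1" if "x \<in> F" "x \<noteq> 0" for x
  proof -
    have "x * x ^ (Q - 1) = x ^ Q" using Q1 by (simp flip: power_Suc)
    then have "x * x ^ (Q - 1) = x * 1" using that(1) F(2) by simp
    then show ?thesis using that(2) by simp
  qed
  let ?U = "{y :: 'k. y ^ v = 1}"
  have cardU: "card ?U = v" by (rule card_power_eq_one) (use v1 r(4) in auto)
  have finU: "finite ?U" using cardU v1 card.infinite by fastforce
  let ?V = "{y :: 'k. y ^ (r ^ (N - 1)) = 1}"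
  have cV: "card ?V \<le> r ^ (N - 1)" and finV: "finite ?V"
    using card_power_eq_le[of 0 "r ^ (N - 1)", where 'k = 'k] r1 by simp_all
  note cV
  also have "r ^ (N - 1) < v" unfolding r(2) using r1 r(3) by (intro power_strict_increasing) auto
  finally have "\<not> ?U \<subseteq> ?V" using card_mono[OF finV, of ?U] cardU by auto
  then obtain g :: 'k where g: "g ^ v = 1" "g ^ (r ^ (N - 1)) \<noteq> 1" by blast
  have g0: "g \<noteq> 0" using g(1) v1 by (auto simp: power_0_left)
  have ord: "v dvd m" if "g ^ m = 1" for m
  proof (rule ccontr)
    assume nd: "\<not> v dvd m"
    let ?d = "gcd m v"
    have gd: "g ^ ?d = 1"
    proof (cases "m = 0")
      case False
      then obtain i j where ij: "m * i = v * j + ?d" using bezout_nat[of m v] by auto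
      have "g ^ (m * i) = g ^ (v * j) * g ^ ?d" unfolding ij power_add ..
      then show ?thesis using that g(1) by (simp add: power_mult)
    qed (use nd in simp)
    obtain i where i: "i \<le> N" "?d = r ^ i" using divides_primepow_nat[OF r(1), of ?d N] r(2) by auto
    have "i \<noteq> N" using nd i(2) r(2) by (metis gcd_dvd1)
    then have "?d dvd r ^ (N - 1)" unfolding i(2) using i(1) by (intro le_imp_power_dvd) auto
    then obtain e where "r ^ (N - 1) = ?d * e" by blast
    then show False using g(2) gd by (simp add: power_mult)
  qed
  have inj_g: "i = j" if "i < v" "j < v" "g ^ i = g ^ j" "i \<le> j" for i j
  proof -
    have "g ^ i * g ^ (j - i) = g ^ i * 1" using that(3,4) by (metis le_add_diff_inverse mult.right_neutral power_add)
    then have "v dvd j - i" using g0 by (intro ord) simp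
    then show ?thesis using that by (metis diff_is_0_eq dvd_imp_le le_antisym less_imp_diff_less linorder_not_less not_gr_zero)
  qed
  have gU: "(\<lambda>i. g ^ i) ` {..<v} = ?U"
  proof (rule card_subset_eq[OF finU])
    show "(\<lambda>i. g ^ i) ` {..<v} \<subseteq> ?U"
    proof (rule image_subsetI)
      fix i
      have "(g ^ i) ^ v = (g ^ v) ^ i" by (simp only: power_mult[symmetric] mult.commute)
      then show "g ^ i \<in> ?U" using g(1) by simp
    qed
    have "inj_on (\<lambda>i. g ^ i) {..<v}" by (rule inj_onI) (metis inj_g lessThan_iff nat_le_linear)
    then show "card ((\<lambda>i. g ^ i) ` {..<v}) = card ?U" using cardU by (simp add: card_image)
  qed
  obtain \<zeta> :: complex where \<zeta>: "\<zeta> ^ v = 1" "\<And>c. 0 < c \<Longrightarrow> c < v \<Longrightarrow> \<zeta> ^ c \<noteq> 1"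
    using exists_primitive_root_unity[of v] v1 by auto
  have \<zeta>_eq: "\<zeta> ^ i = \<zeta> ^ j" if "g ^ i = g ^ j" for i j
  proof -
    have *: "\<zeta> ^ i = \<zeta> ^ j" if "i \<le> j" "g ^ i = g ^ j" for i j
    proof -
      have "g ^ i * g ^ (j - i) = g ^ i * 1" using that by (metis le_add_diff_inverse mult.right_neutral power_add)
      then have "v dvd j - i" using g0 by (intro ord) simp
      then obtain e where "j - i = v * e" by blast
      then have "j = i + v * e" using that(1) by simp
      then show ?thesis using \<zeta>(1) by (simp add: power_add power_mult)
    qed
    show ?thesis
    proof (cases "i \<le> j")
      case True
      show ?thesis by (rule *[OF True that])
    next
      case False
      then have "\<zeta> ^ j = \<zeta> ^ i" by (intro *) (use that in simp_all)
      then show ?thesis by simp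
    qed
  qed
  define idx where "idx = (\<lambda>x. SOME i. g ^ i = x ^ h)"
  have idx: "g ^ idx x = x ^ h" if x: "x \<in> F" "x \<noteq> 0" for x
  proof -
    have "(x ^ h) ^ v = 1" using pow1[OF x] hv by (simp flip: power_mult)
    then have "x ^ h \<in> (\<lambda>i. g ^ i) ` {..<v}" unfolding gU by simp
    then have "\<exists>i. g ^ i = x ^ h" by auto
    then show ?thesis unfolding idx_def by (rule someI_ex)
  qed
  define \<theta> where "\<theta> = (\<lambda>x. if x = 0 then 0 else \<zeta> ^ idx x)"
  have \<zeta>n: "norm \<zeta> = 1" using cnj_root_unity(2)[OF \<zeta>(1)] v1 by simp
  have mult: "mult_char \<theta>"
    unfolding mult_char_def
  proof (intro conjI ballI)
    fix x y assume xy: "x \<in> F" "y \<in> F"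
    show "\<theta> (x * y) = \<theta> x * \<theta> y"
    proof (cases "x = 0 \<or> y = 0")
      case False
      then have "g ^ idx (x * y) = g ^ (idx x + idx y)"
        using idx xy mult_F[OF xy] by (simp add: power_add power_mult_distrib)
      then have "\<zeta> ^ idx (x * y) = \<zeta> ^ (idx x + idx y)" by (rule \<zeta>_eq)
      then show ?thesis using False by (simp add: \<theta>_def power_add)
    qed (auto simp: \<theta>_def)
  qed (auto simp: \<theta>_def norm_power \<zeta>n)
  have val: "\<theta> x \<in> roots_unity v" if "x \<in> F" "x \<noteq> 0" for x
  proof -
    have "(\<zeta> ^ idx x) ^ v = (\<zeta> ^ v) ^ idx x" by (simp only: power_mult[symmetric] mult.commute)
    then show ?thesis using that \<zeta>(1) by (simp add: \<theta>_def)
  qed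
  have triv: "\<theta> x = 1" if "x \<in> F" "x ^ h = 1" for x
  proof -
    have x0: "x \<noteq> 0" using that(2) h0 by (auto simp: power_0_left)
    then have "g ^ idx x = g ^ 0" using idx[OF that(1)] that(2) by simp
    then have "\<zeta> ^ idx x = \<zeta> ^ 0" by (rule \<zeta>_eq)
    then show ?thesis using x0 by (simp add: \<theta>_def)
  qed
  \<comment> \<open>Each fibre of x \<mapsto> x^h has at most h elements, so the Q - 1 = h v nonzero
    elements produce at least v values.\<close>
  have imU: "(\<lambda>x. x ^ h) ` (F - {0}) = ?U"
  proof (rule card_subset_eq[OF finU])
    show sub: "(\<lambda>x. x ^ h) ` (F - {0}) \<subseteq> ?U"
      using pow1 hv by (auto simp flip: power_mult)
    have "Q - 1 = card (F - {0})" using zero_F finite_F F(3) by simp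
    also have "\<dots> = (\<Sum>w\<in>(\<lambda>x. x ^ h) ` (F - {0}). card {x \<in> F - {0}. x ^ h = w})"
      using sum.image_gen[of "F - {0}" "\<lambda>_. 1 :: nat" "\<lambda>x. x ^ h"] finite_F by simp
    also have "\<dots> \<le> (\<Sum>w\<in>(\<lambda>x. x ^ h) ` (F - {0}). h)"
    proof (rule sum_mono)
      fix w assume "w \<in> (\<lambda>x. x ^ h) ` (F - {0})"
      then obtain x0 where x0: "x0 \<in> F" "x0 \<noteq> 0" "w = x0 ^ h" by auto
      have "card {x \<in> F - {0}. x ^ h = w} \<le> card {y :: 'k. y ^ h = y ^ 0}"
      proof (rule card_inj_on_le[of "\<lambda>x. x / x0"])
        show "inj_on (\<lambda>x. x / x0) {x \<in> F - {0}. x ^ h = w}"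
          by (rule inj_onI) (use x0(2) in simp)
        show "(\<lambda>x. x / x0) ` {x \<in> F - {0}. x ^ h = w} \<subseteq> {y. y ^ h = y ^ 0}"
          by (rule image_subsetI) (use x0 in \<open>simp add: power_divide\<close>)
        show "finite {y :: 'k. y ^ h = y ^ 0}" by (rule card_power_eq_le(2)[OF h0])
      qed
      also have "\<dots> \<le> h" by (rule card_power_eq_le(1)[OF h0])
      finally show "card {x \<in> F - {0}. x ^ h = w} \<le> h" .
    qed
    finally have "h * v \<le> card ((\<lambda>x. x ^ h) ` (F - {0})) * h" using hv by simp
    then have "v \<le> card ((\<lambda>x. x ^ h) ` (F - {0}))" using h0 by (simp add: mult.commute)
    then show "card ((\<lambda>x. x ^ h) ` (F - {0})) = card ?U"
      using card_mono[OF finU sub] cardU by simp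
  qed
  have surj: "\<exists>x\<in>F. x \<noteq> 0 \<and> \<theta> x = y" if y: "y \<in> roots_unity v" for y
  proof -
    have "inj_on (\<lambda>i. \<zeta> ^ i) {..<v}"
    proof (rule inj_onI)
      have *: "i = j" if "i < v" "j < v" "\<zeta> ^ i = \<zeta> ^ j" "i \<le> j" for i j
      proof (rule ccontr)
        assume "i \<noteq> j"
        have "\<zeta> ^ i * \<zeta> ^ (j - i) = \<zeta> ^ i * 1" using that by (metis le_add_diff_inverse mult.right_neutral power_add)
        moreover have "\<zeta> \<noteq> 0" using \<zeta>n by auto
        ultimately have "\<zeta> ^ (j - i) = 1" by simp
        then show False using \<zeta>(2)[of "j - i"] that \<open>i \<noteq> j\<close> by simp
      qed
      fix i j assume "i \<in> {..<v}" "j \<in> {..<v}" "\<zeta> ^ i = \<zeta> ^ j"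
      then show "i = j" using *[of i j] *[of j i] by (cases "i \<le> j") auto
    qed
    then have "card ((\<lambda>i. \<zeta> ^ i) ` {..<v}) = card (roots_unity v)"
      using card_roots_unity_eq[of v] v1 by (simp add: card_image)
    moreover have "(\<lambda>i. \<zeta> ^ i) ` {..<v} \<subseteq> roots_unity v"
    proof (rule image_subsetI)
      fix i
      have "(\<zeta> ^ i) ^ v = (\<zeta> ^ v) ^ i" by (simp only: power_mult[symmetric] mult.commute)
      then show "\<zeta> ^ i \<in> roots_unity v" using \<zeta>(1) by simp
    qed
    ultimately have "(\<lambda>i. \<zeta> ^ i) ` {..<v} = roots_unity v"
      using v1 by (intro card_subset_eq finite_roots_unity') auto
    then obtain i where i: "y = \<zeta> ^ i" using y by blast
    have "g ^ i \<in> ?U"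
    proof -
      have "(g ^ i) ^ v = (g ^ v) ^ i" by (simp only: power_mult[symmetric] mult.commute)
      then show ?thesis using g(1) by simp
    qed
    then obtain x where x: "x \<in> F" "x \<noteq> 0" "g ^ i = x ^ h" unfolding imU[symmetric] by auto
    have "\<zeta> ^ idx x = \<zeta> ^ i" by (rule \<zeta>_eq) (simp add: idx[OF x(1,2)] x(3))
    then show ?thesis using x i by (intro bexI[of _ x]) (auto simp: \<theta>_def)
  qed
  show ?thesis using that[OF mult val surj triv[unfolded h_def]] .
qed

text \<open>The terms are collected by y = \<theta> x. Multiplication by a natural number prime to p
  preserves \<theta> and raises \<psi> to a power, so on each class \<psi> takes all nontrivial p-th
  roots of unity equally often and the partial sum is an integer - e y. The map x \<mapsto> x^p
  sends the class of y to that of y^p and preserves \<psi>, so e is Frobenius invariant. The sum of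
  e is 1, since \<psi> sums to -1 over the nonzero elements: the minus sign in front of the Gauss
  sum makes the residue a power of p.\<close>

lemma (in finite_subfield_char) gauss_sum_frob_sums:
  assumes p: "prime p" "CHAR('k) = p" and cop: "coprime p v" "v > 0"
    and frob: "\<And>x. x \<in> F \<Longrightarrow> x ^ p \<in> F" "\<And>x. x \<in> F \<Longrightarrow> \<psi> (x ^ p) = \<psi> x"
    and \<theta>: "mult_char \<theta>" "\<And>x. x \<in> F \<Longrightarrow> x \<noteq> 0 \<Longrightarrow> \<theta> x \<in> roots_unity v"
      "\<And>a. \<not> p dvd a \<Longrightarrow> \<theta> (of_nat a) = 1"
  shows "- gauss_sum \<theta> \<in> frob_sums p r v"
proof -
  let ?Y = "roots_unity v" and ?F = "F - {0}"
  have p1: "p > 1" using p(1) prime_gt_1_nat by blast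
  have pr: "prime CHAR('k)" using p by simp
  have finY: "finite ?Y" using finite_roots_unity'[OF cop(2)] .
  have natF: "of_nat a \<in> F" for a by (induction a) (auto intro: zero_F one_F add_F)
  have nat0: "(of_nat a :: 'k) \<noteq> 0" if "\<not> p dvd a" for a
    using that unfolding of_nat_eq_0_iff_char_dvd p(2) .
  have psi_nat: "\<psi> (of_nat a * x) = \<psi> x ^ a" if "x \<in> F" for a x
  proof (induction a)
    case (Suc a)
    have "\<psi> (x + of_nat a * x) = \<psi> x * \<psi> (of_nat a * x)" using that natF by (intro psi_add mult_F)
    then show ?case using Suc by (simp add: distrib_right)
  qed (simp add: psi_0)
  have psi_p: "\<psi> x ^ p = 1" if "x \<in> F" for x
    using psi_nat[OF that, of p] psi_0 of_nat_CHAR[where 'a = 'k] unfolding p(2) by simp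
  obtain \<omega> :: complex where \<omega>p: "\<omega> ^ p = 1" and prim: "\<And>c. 0 < c \<Longrightarrow> c < p \<Longrightarrow> \<omega> ^ c \<noteq> 1"
    by (rule exists_primitive_root_unity[of p]) (use p1 in auto)
  have \<omega>: "\<omega> ^ p = 1" "\<omega> \<noteq> 1" using \<omega>p prim[of 1] p1 by simp_all
  define n where "n = (\<lambda>y z. card {x \<in> ?F. \<theta> x = y \<and> \<psi> x = z})"
  have n_const: "n y z = n y \<omega>" if y: "y \<in> ?Y" and z: "z \<in> roots_unity p" "z \<noteq> 1" for y z
  proof -
    obtain a where a: "a < p" "z = \<omega> ^ a"
      using roots_unity_prime_generated[OF p(1) \<omega>] z(1) by auto
    have pa: "\<not> p dvd a" using a z(2) by (cases "a = 0") (auto simp: nat_dvd_not_less)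
    have "coprime a p" using pa p(1) by (metis coprime_commute prime_imp_coprime)
    have "bij_betw (\<lambda>x. of_nat a * x) {x \<in> ?F. \<theta> x = y \<and> \<psi> x = \<omega>} {x \<in> ?F. \<theta> x = y \<and> \<psi> x = z}"
    proof -
      have bij: "bij_betw (\<lambda>x. of_nat a * x) F F" by (rule bij_betw_mult_F[OF natF nat0[OF pa]])
      have iff: "(of_nat a * x \<in> ?F \<and> \<theta> (of_nat a * x) = y \<and> \<psi> (of_nat a * x) = z) \<longleftrightarrow>
          (x \<in> ?F \<and> \<theta> x = y \<and> \<psi> x = \<omega>)" if x: "x \<in> F" for x
      proof -
        have "\<psi> x = \<omega>" if "\<psi> x ^ a = \<omega> ^ a"
          by (rule inj_onD[OF bij_betw_imp_inj_on[OF bij_betw_power_roots_unity[OF \<open>coprime a p\<close>]]])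
            (use that psi_p[OF x] \<omega>(1) p1 in simp_all)
        then have "\<psi> x ^ a = \<omega> ^ a \<longleftrightarrow> \<psi> x = \<omega>" by blast
        moreover have "\<theta> (of_nat a * x) = \<theta> x"
          using mult_char_mult[OF \<theta>(1) natF[of a] x] \<theta>(3)[OF pa] by simp
        moreover have "of_nat a * x \<in> ?F \<longleftrightarrow> x \<in> ?F" using nat0[OF pa] x mult_F[OF natF x] by simp
        ultimately show ?thesis unfolding psi_nat[OF x] a(2) by simp
      qed
      show ?thesis unfolding bij_betw_def
      proof
        show "inj_on (\<lambda>x. of_nat a * x) {x \<in> ?F. \<theta> x = y \<and> \<psi> x = \<omega>}"
          by (rule inj_on_subset[OF bij_betw_imp_inj_on[OF bij]]) blast
        show "(\<lambda>x. of_nat a * x) ` {x \<in> ?F. \<theta> x = y \<and> \<psi> x = \<omega>} = {x \<in> ?F. \<theta> x = y \<and> \<psi> x = z}"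
        proof
          show "(\<lambda>x. of_nat a * x) ` {x \<in> ?F. \<theta> x = y \<and> \<psi> x = \<omega>} \<subseteq> {x \<in> ?F. \<theta> x = y \<and> \<psi> x = z}"
          proof (rule image_subsetI)
            fix x assume x: "x \<in> {x \<in> ?F. \<theta> x = y \<and> \<psi> x = \<omega>}"
            then have "x \<in> F" by simp
            from iff[OF this] x show "of_nat a * x \<in> {x \<in> ?F. \<theta> x = y \<and> \<psi> x = z}"
              by (simp only: mem_Collect_eq)
          qed
          show "{x \<in> ?F. \<theta> x = y \<and> \<psi> x = z} \<subseteq> (\<lambda>x. of_nat a * x) ` {x \<in> ?F. \<theta> x = y \<and> \<psi> x = \<omega>}"
          proof
            fix x assume x: "x \<in> {x \<in> ?F. \<theta> x = y \<and> \<psi> x = z}"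
            then have "x \<in> (\<lambda>x. of_nat a * x) ` F" using bij_betw_imp_surj_on[OF bij] by simp
            then obtain x' where x': "x' \<in> F" "x = of_nat a * x'" by blast
            then show "x \<in> (\<lambda>x. of_nat a * x) ` {x \<in> ?F. \<theta> x = y \<and> \<psi> x = \<omega>}" using iff[OF x'(1)] x by blast
          qed
        qed
      qed
    qed
    then show ?thesis unfolding n_def by (rule bij_betw_same_card[symmetric])
  qed
  define \<eta> where "\<eta> = (\<lambda>y. \<Sum>x\<in>?F. if \<theta> x = y then \<psi> x else 0)"
  define e where "e = (\<lambda>y. int (n y \<omega>) - int (n y 1))"
  have \<eta>_e: "\<eta> y = - of_int (e y)" if y: "y \<in> ?Y" for y
  proof -
    let ?C = "{x \<in> ?F. \<theta> x = y}"
    have one: "1 \<in> roots_unity p" by simp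
    have finp: "finite (roots_unity p)" using finite_roots_unity' p1 by auto
    have "\<eta> y = (\<Sum>x\<in>?C. \<psi> x)" unfolding \<eta>_def by (rule sum.inter_filter[symmetric]) (use finite_F in simp)
    also have "\<dots> = (\<Sum>z\<in>roots_unity p. \<Sum>x | x \<in> ?C \<and> \<psi> x = z. \<psi> x)"
      by (rule sum.group[symmetric]) (use finite_F finp psi_p in auto)
    also have "\<dots> = (\<Sum>z\<in>roots_unity p. of_nat (n y z) * z)"
      unfolding n_def by (intro sum.cong refl) (simp add: conj_assoc)
    also have "\<dots> = of_nat (n y 1) + (\<Sum>z\<in>roots_unity p - {1}. of_nat (n y z) * z)"
      by (subst sum.remove[OF finp one]) simp
    also have "(\<Sum>z\<in>roots_unity p - {1}. of_nat (n y z) * z) = of_nat (n y \<omega>) * (\<Sum>z\<in>roots_unity p - {1}. z)"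
      unfolding sum_distrib_left by (intro sum.cong refl) (use n_const[OF y] in auto)
    also have "(\<Sum>z\<in>roots_unity p - {1}. z) = -1"
      using sum.remove[OF finp one, of "\<lambda>z. z"] sum_roots_unity[OF p1] by (simp add: add_eq_0_iff)
    finally show ?thesis unfolding e_def by simp
  qed
  have frob_inj: "inj_on (\<lambda>x. x ^ p) F"
  proof (rule inj_onI)
    fix x y :: 'k assume "x ^ p = y ^ p"
    moreover have "((x - y) + y) ^ p = (x - y) ^ p + y ^ p" by (rule freshmans_dream[OF pr]) (simp add: p(2))
    ultimately have "(x - y) ^ p = 0" by simp
    then show "x = y" by simp
  qed
  have frob_bij: "bij_betw (\<lambda>x. x ^ p) ?F ?F"
    by (rule bij_betw_endo) (use finite_F frob(1) inj_on_subset[OF frob_inj] in auto)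
  have \<theta>_pow: "\<theta> (x ^ m) = \<theta> x ^ m \<and> x ^ m \<in> F" if "x \<in> F" for x m
    by (induction m) (use that mult_char_1[OF \<theta>(1)] mult_char_mult[OF \<theta>(1)] one_F mult_F in auto)
  have \<eta>_frob: "\<eta> (y ^ p) = \<eta> y" if y: "y \<in> ?Y" for y
  proof -
    have "\<eta> (y ^ p) = (\<Sum>x\<in>?F. if \<theta> (x ^ p) = y ^ p then \<psi> (x ^ p) else 0)"
      unfolding \<eta>_def by (rule sum.reindex_bij_betw[OF frob_bij, symmetric])
    also have "\<dots> = \<eta> y" unfolding \<eta>_def
    proof (rule sum.cong[OF refl])
      fix x assume x: "x \<in> ?F"
      have "\<theta> x ^ p = y ^ p \<longleftrightarrow> \<theta> x = y"
        using inj_onD[OF bij_betw_imp_inj_on[OF bij_betw_power_roots_unity[OF cop]], of "\<theta> x" y] \<theta>(2)[of x] x y by auto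
      then show "(if \<theta> (x ^ p) = y ^ p then \<psi> (x ^ p) else 0) = (if \<theta> x = y then \<psi> x else 0)"
        using \<theta>_pow[of x p] frob(2)[of x] x by simp
    qed
    finally show ?thesis .
  qed
  have e_frob: "e (y ^ p) = e y" if y: "y \<in> ?Y" for y
  proof -
    have "y ^ p \<in> ?Y" using bij_betwE[OF bij_betw_power_roots_unity[OF cop]] y by blast
    then have "- complex_of_int (e (y ^ p)) = - complex_of_int (e y)" using \<eta>_frob[OF y] \<eta>_e y by metis
    then show ?thesis by simp
  qed
  have "(\<Sum>x\<in>F. \<psi> (1 * x)) = 0" using sum_psi_scaled[OF one_F] by simp
  then have psi_sum: "(\<Sum>x\<in>?F. \<psi> x) = -1"
    using sum.remove[OF finite_F zero_F, of \<psi>] psi_0 by (simp add: add_eq_0_iff)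
  have "(\<Sum>y\<in>?Y. \<eta> y) = (\<Sum>x\<in>?F. \<Sum>y\<in>?Y. if \<theta> x = y then \<psi> x else 0)"
    unfolding \<eta>_def by (rule sum.swap)
  also have "\<dots> = (\<Sum>x\<in>?F. \<psi> x)"
    by (intro sum.cong refl) (use finY \<theta>(2) in \<open>simp add: sum.delta'\<close>)
  finally have "(\<Sum>y\<in>?Y. - complex_of_int (e y)) = -1"
    using psi_sum \<eta>_e by simp
  then have "complex_of_int (\<Sum>y\<in>?Y. e y) = complex_of_int 1" by (simp add: sum_negf)
  then have e_sum: "(\<Sum>y\<in>?Y. e y) = int p ^ 0" unfolding of_int_eq_iff by simp
  have "gauss_sum \<theta> = (\<Sum>x\<in>?F. \<theta> x * \<psi> x)"
    unfolding gauss_sum_def using sum.remove[OF finite_F zero_F, of "\<lambda>x. \<theta> x * \<psi> x"] mult_char_0[OF \<theta>(1)] by simp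
  also have "\<dots> = (\<Sum>x\<in>?F. \<Sum>y\<in>?Y. y * (if \<theta> x = y then \<psi> x else 0))"
  proof (rule sum.cong[OF refl])
    fix x assume x: "x \<in> ?F"
    have "(\<Sum>y\<in>?Y. y * (if \<theta> x = y then \<psi> x else 0)) = (\<Sum>y\<in>?Y. if \<theta> x = y then \<theta> x * \<psi> x else 0)"
      by (intro sum.cong refl) auto
    then show "\<theta> x * \<psi> x = (\<Sum>y\<in>?Y. y * (if \<theta> x = y then \<psi> x else 0))"
      using finY \<theta>(2)[of x] x by simp
  qed
  also have "\<dots> = (\<Sum>y\<in>?Y. y * \<eta> y)"
    unfolding \<eta>_def sum_distrib_left by (rule sum.swap)
  also have "\<dots> = (\<Sum>y\<in>?Y. - (of_int (e y) * y))"
    by (intro sum.cong refl) (simp add: \<eta>_e)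
  finally have "- gauss_sum \<theta> = (\<Sum>y\<in>?Y. of_int (e y) * y)" by (simp add: sum_negf)
  then show ?thesis unfolding frob_sums_def
    using e_frob e_sum by (intro CollectI exI[of _ e] conjI exI[of _ 0]) auto
qed

section \<open>Coordinates on matrices and balanced labellings\<close>

context finite_subfield
begin

lemma mtrace_mult:
  assumes "A \<in> carrier_mat n n" "B \<in> carrier_mat n n"
  shows "mtrace (A * B) = (\<Sum>i<n. \<Sum>j<n. A $$ (i, j) * B $$ (j, i))"
  using assms unfolding mtrace_def by (simp add: scalar_prod_def lessThan_atLeast0)

definition lincomb_mat :: "nat \<Rightarrow> ('a \<Rightarrow> 'k) \<Rightarrow> nat \<Rightarrow> (nat \<Rightarrow> 'k mat) \<Rightarrow> (nat \<Rightarrow> 'a) \<Rightarrow> 'k mat" where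
  "lincomb_mat n emb m e y = mat n n (\<lambda>(i, j). \<Sum>k<m. emb (y k) * e k $$ (i, j))"

lemma lincomb_mat_mats:
  assumes "\<And>a. emb a \<in> F" "\<And>k. k < m \<Longrightarrow> e k \<in> mats n n"
  shows "lincomb_mat n emb m e y \<in> mats n n"
  using assms unfolding lincomb_mat_def mats_def by (auto intro!: sum_F mult_F)

text \<open>Greedy choice by counting: the q^m combinations of m matrices cannot exhaust a space
  with at least q^(m+1) elements. The hypothesis \<open>emb_neg_div\<close> has the shape of the
  coefficients that arise when a relation is solved for the new matrix.\<close>

lemma exists_independent_mats:
  fixes emb :: "'a::{finite,field} \<Rightarrow> 'k"
  assumes emb_F: "\<And>a. emb a \<in> F" and emb_0: "\<And>a. emb a = 0 \<longleftrightarrow> a = 0"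
    and emb_neg_div: "\<And>a b. emb (- a / b) = - emb a / emb b"
    and m: "CARD('a) ^ m \<le> card (mats n n)"
  shows "\<exists>e. (\<forall>k<m. e k \<in> mats n n) \<and> (\<forall>y. lincomb_mat n emb m e y = 0\<^sub>m n n \<longrightarrow> (\<forall>k<m. y k = 0))"
  using m
proof (induction m)
  case (Suc m)
  have q1: "CARD('a) > 1" by (rule card_field_gt_1)
  have "CARD('a) ^ m < CARD('a) ^ Suc m" using q1 by (intro power_strict_increasing) auto
  then have less: "CARD('a) ^ m < card (mats n n)" using Suc.prems by (rule less_le_trans)
  from Suc.IH[OF less_imp_le[OF less]] obtain e where e: "\<And>k. k < m \<Longrightarrow> e k \<in> mats n n"
    "\<And>y k. lincomb_mat n emb m e y = 0\<^sub>m n n \<Longrightarrow> k < m \<Longrightarrow> y k = 0"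
    by blast
  let ?A = "lincomb_mat n emb m e ` PiE {..<m} (\<lambda>_. UNIV)"
  have "card ?A \<le> card (PiE {..<m} (\<lambda>_. UNIV :: 'a set))" by (rule card_image_le) (simp add: finite_PiE)
  also have "\<dots> = CARD('a) ^ m" by (simp add: card_PiE)
  finally have "\<not> mats n n \<subseteq> ?A" using less card_mono[of ?A "mats n n"] by (auto simp: finite_PiE)
  then obtain x where x: "x \<in> mats n n" "x \<notin> ?A" by blast
  have xc: "x \<in> carrier_mat n n" by (rule mats_carrier[OF x(1)])
  let ?e = "e(m := x)"
  have "y k = 0" if y: "lincomb_mat n emb (Suc m) ?e y = 0\<^sub>m n n" and k: "k < Suc m" for y k
  proof -
    have entry: "(\<Sum>k<m. emb (y k) * e k $$ (i, j)) + emb (y m) * x $$ (i, j) = 0" if "i < n" "j < n" for i j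
    proof -
      have "lincomb_mat n emb (Suc m) ?e y $$ (i, j) = 0\<^sub>m n n $$ (i, j)" unfolding y ..
      then show ?thesis using that by (simp add: lincomb_mat_def)
    qed
    have ym: "y m = 0"
    proof (rule ccontr)
      assume ym: "y m \<noteq> 0"
      have "x = lincomb_mat n emb m e (\<lambda>k. - y k / y m)"
      proof (rule eq_matI)
        fix i j assume "i < dim_row (lincomb_mat n emb m e (\<lambda>k. - y k / y m))"
          "j < dim_col (lincomb_mat n emb m e (\<lambda>k. - y k / y m))"
        then have ij: "i < n" "j < n" by (simp_all add: lincomb_mat_def)
        have "x $$ (i, j) = - (\<Sum>k<m. emb (y k) * e k $$ (i, j)) / emb (y m)"
          using entry[OF ij] ym emb_0 by (simp add: field_simps add_eq_0_iff)
        also have "\<dots> = (\<Sum>k<m. emb (- y k / y m) * e k $$ (i, j))"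
          unfolding sum_negf[symmetric] sum_divide_distrib
          by (intro sum.cong refl, subst emb_neg_div) simp
        also have "\<dots> = lincomb_mat n emb m e (\<lambda>k. - y k / y m) $$ (i, j)" using ij by (simp add: lincomb_mat_def)
        finally show "x $$ (i, j) = lincomb_mat n emb m e (\<lambda>k. - y k / y m) $$ (i, j)" .
      qed (use xc in \<open>simp_all add: lincomb_mat_def\<close>)
      also have "\<dots> = lincomb_mat n emb m e (restrict (\<lambda>k. - y k / y m) {..<m})"
        by (simp add: lincomb_mat_def)
      finally show False using x(2) by (auto intro: image_eqI)
    qed
    have "lincomb_mat n emb m e y = 0\<^sub>m n n"
      using entry ym emb_0[of 0] by (intro eq_matI) (simp_all add: lincomb_mat_def)
    then show ?thesis using e(2)[of y k] k ym by (cases "k = m") auto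
  qed
  moreover have "?e k \<in> mats n n" if "k < Suc m" for k using that e(1) x(1) by (cases "k = m") auto
  ultimately show ?case by blast
qed simp

text \<open>T (mtrace (b x)) is a nondegenerate pairing over the small field, so distinct b induce
  distinct functionals, and there are as many b as vectors u. Agreement with an affine function thus
  becomes a Fourier problem on matrices.\<close>

lemma exists_matrix_coordinates:
  fixes emb :: "'a::{finite,field} \<Rightarrow> 'k" and T :: "'k \<Rightarrow> 'a"
  assumes emb: "\<And>a. emb a \<in> F" "\<And>a. emb a = 0 \<longleftrightarrow> a = 0" "\<And>a b. emb (a - b) = emb a - emb b"
      "\<And>a b. emb (- a / b) = - emb a / emb b"
    and T: "\<And>a x. x \<in> F \<Longrightarrow> T (emb a * x) = a * T x" "\<And>x y. x \<in> F \<Longrightarrow> y \<in> F \<Longrightarrow> T (x + y) = T x + T y"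
      "\<exists>x\<in>F. T x \<noteq> 0"
    and N: "card (mats n n) = CARD('a) ^ N"
  obtains \<Phi> :: "'a vec \<Rightarrow> 'k mat" where "bij_betw \<Phi> (carrier_vec N) (mats n n)"
    "\<And>u. u \<in> carrier_vec N \<Longrightarrow> \<exists>b\<in>mats n n. \<forall>y\<in>carrier_vec N. u \<bullet> y = T (mtrace (b * \<Phi> y))"
proof -
  obtain e where e: "\<And>k. k < N \<Longrightarrow> e k \<in> mats n n"
    "\<And>y k. lincomb_mat n emb N e y = 0\<^sub>m n n \<Longrightarrow> k < N \<Longrightarrow> y k = 0"
    using exists_independent_mats[OF emb(1,2,4), of N n] N by auto
  define \<Phi> where "\<Phi> = (\<lambda>y :: 'a vec. lincomb_mat n emb N e (\<lambda>k. y $ k))"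
  have \<Phi>_mats: "\<Phi> y \<in> mats n n" for y unfolding \<Phi>_def by (rule lincomb_mat_mats[OF emb(1) e(1)])
  have inj: "inj_on \<Phi> (carrier_vec N)"
  proof (rule inj_onI)
    fix y y' :: "'a vec" assume y: "y \<in> carrier_vec N" "y' \<in> carrier_vec N" "\<Phi> y = \<Phi> y'"
    have "lincomb_mat n emb N e (\<lambda>k. y $ k - y' $ k) = 0\<^sub>m n n"
    proof (rule eq_matI)
      fix i j assume "i < dim_row (0\<^sub>m n n :: 'k mat)" "j < dim_col (0\<^sub>m n n :: 'k mat)"
      then have ij: "i < n" "j < n" by simp_all
      have "\<Phi> y $$ (i, j) = \<Phi> y' $$ (i, j)" unfolding y(3) ..
      then show "lincomb_mat n emb N e (\<lambda>k. y $ k - y' $ k) $$ (i, j) = 0\<^sub>m n n $$ (i, j)"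
        using ij unfolding \<Phi>_def lincomb_mat_def by (simp add: emb(3) left_diff_distrib sum_subtractf)
    qed (simp_all add: lincomb_mat_def)
    then have "y $ k = y' $ k" if "k < N" for k using e(2)[of "\<lambda>k. y $ k - y' $ k" k] that by simp
    then show "y = y'" using y(1,2) by (intro eq_vecI) auto
  qed
  have bij: "bij_betw \<Phi> (carrier_vec N) (mats n n)"
  proof -
    have "\<Phi> ` carrier_vec N = mats n n"
      by (rule card_subset_eq[OF finite_mats]) (use \<Phi>_mats card_image[OF inj] N card_carrier_vec[of N, where 'a = 'a] in auto)
    then show ?thesis using inj unfolding bij_betw_def by simp
  qed
  have T0: "T 0 = 0" using T(1)[OF zero_F, of 0] by simp
  have T_sum: "T (\<Sum>k\<in>A. f k) = (\<Sum>k\<in>A. T (f k))" if "finite A" "\<And>k. k \<in> A \<Longrightarrow> f k \<in> F" for A and f :: "nat \<Rightarrow> 'k"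
    using that
  proof (induction A rule: finite_induct)
    case (insert a A)
    have "T (f a + (\<Sum>k\<in>A. f k)) = T (f a) + T (\<Sum>k\<in>A. f k)"
      by (rule T(2)) (use insert.prems in \<open>auto intro: sum_F\<close>)
    then show ?case using insert by simp
  qed (simp add: T0)
  have tr_\<Phi>: "mtrace (b * \<Phi> y) = (\<Sum>k<N. emb (y $ k) * mtrace (b * e k))" if b: "b \<in> mats n n" for b y
  proof -
    have "mtrace (b * \<Phi> y) = (\<Sum>i<n. \<Sum>j<n. \<Sum>k<N. emb (y $ k) * (b $$ (i, j) * e k $$ (j, i)))"
      unfolding mtrace_mult[OF mats_carrier[OF b] mats_carrier[OF \<Phi>_mats]]
      by (intro sum.cong refl) (simp add: \<Phi>_def lincomb_mat_def sum_distrib_left ac_simps)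
    also have "\<dots> = (\<Sum>i<n. \<Sum>k<N. \<Sum>j<n. emb (y $ k) * (b $$ (i, j) * e k $$ (j, i)))"
      by (rule sum.cong[OF refl sum.swap])
    also have "\<dots> = (\<Sum>k<N. \<Sum>i<n. \<Sum>j<n. emb (y $ k) * (b $$ (i, j) * e k $$ (j, i)))" by (rule sum.swap)
    also have "\<dots> = (\<Sum>k<N. emb (y $ k) * mtrace (b * e k))"
    proof (rule sum.cong[OF refl])
      fix k assume "k \<in> {..<N}"
      then have ek: "e k \<in> carrier_mat n n" using mats_carrier[OF e(1)] by simp
      show "(\<Sum>i<n. \<Sum>j<n. emb (y $ k) * (b $$ (i, j) * e k $$ (j, i))) = emb (y $ k) * mtrace (b * e k)"
        unfolding mtrace_mult[OF mats_carrier[OF b] ek] sum_distrib_left by (rule refl)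
    qed
    finally show ?thesis .
  qed
  define \<Lambda> where "\<Lambda> = (\<lambda>b. vec N (\<lambda>k. T (mtrace (b * e k))))"
  have \<Lambda>: "\<Lambda> b \<bullet> y = T (mtrace (b * \<Phi> y))" if b: "b \<in> mats n n" and y: "y \<in> carrier_vec N" for b y
  proof -
    have in_F: "mtrace (b * e k) \<in> F" if "k < N" for k by (rule mtrace_F[OF mult_mats[OF b e(1)[OF that]]])
    have "T (mtrace (b * \<Phi> y)) = (\<Sum>k<N. T (emb (y $ k) * mtrace (b * e k)))"
      unfolding tr_\<Phi>[OF b] by (rule T_sum) (use in_F mult_F emb(1) in auto)
    also have "\<dots> = (\<Sum>k<N. y $ k * T (mtrace (b * e k)))"
      by (intro sum.cong refl) (use T(1) in_F in auto)
    also have "\<dots> = \<Lambda> b \<bullet> y"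
      using y unfolding \<Lambda>_def scalar_prod_def by (simp add: lessThan_atLeast0 mult.commute)
    finally show ?thesis by simp
  qed
  have inj_\<Lambda>: "inj_on \<Lambda> (mats n n)"
  proof (rule inj_onI)
    fix b b' assume b: "b \<in> mats n n" "b' \<in> mats n n" and eq: "\<Lambda> b = \<Lambda> b'"
    have pair: "T (mtrace (b * x)) = T (mtrace (b' * x))" if "x \<in> mats n n" for x
    proof -
      have "x \<in> \<Phi> ` carrier_vec N" using that bij unfolding bij_betw_def by simp
      then obtain y where "y \<in> carrier_vec N" "x = \<Phi> y" by blast
      then show ?thesis using \<Lambda>[OF b(1), of y] \<Lambda>[OF b(2), of y] eq by simp
    qed
    show "b = b'"
    proof (rule ccontr)
      assume "b \<noteq> b'"
      then obtain i j where ij: "i < n" "j < n" "b $$ (i, j) \<noteq> b' $$ (i, j)"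
        using mats_carrier[OF b(1)] mats_carrier[OF b(2)] by (auto simp: mat_eq_iff)
      obtain t where t: "t \<in> F" "T t \<noteq> 0" using T(3) by blast
      define d where "d = b $$ (i, j) - b' $$ (i, j)"
      have bF: "b $$ (i, j) \<in> F" "b' $$ (i, j) \<in> F" using mats_index b ij(1,2) by auto
      have d: "d \<in> F" "d \<noteq> 0" unfolding d_def using diff_F[OF bF] ij(3) by auto
      \<comment> \<open>A matrix unit at the transposed position (j, i), scaled so that the traces
        against b and b' differ by t, where T t is nonzero.\<close>
      define x where "x = mat n n (\<lambda>(a, c). if a = j \<and> c = i then t / d else 0)"
      have x: "x \<in> mats n n" unfolding x_def mats_def using divide_F[OF t(1) d(1)] zero_F by auto
      have tr: "mtrace (a * x) = a $$ (i, j) * (t / d)" if a: "a \<in> mats n n" for a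
      proof -
        have "mtrace (a * x) = (\<Sum>i'<n. \<Sum>j'<n. if i' = i then if j' = j then a $$ (i, j) * (t / d) else 0 else 0)"
          unfolding mtrace_mult[OF mats_carrier[OF a] mats_carrier[OF x]]
          by (intro sum.cong refl) (simp add: x_def)
        also have "\<dots> = (\<Sum>i'<n. if i' = i then (\<Sum>j'<n. if j' = j then a $$ (i, j) * (t / d) else 0) else 0)"
          by (intro sum.cong refl) auto
        also have "\<dots> = a $$ (i, j) * (t / d)" using ij(1,2) by simp
        finally show ?thesis .
      qed
      have "b $$ (i, j) * (t / d) = b' $$ (i, j) * (t / d) + t"
      proof -
        have "d * (t / d) = t" using d(2) by simp
        then show ?thesis unfolding d_def by (simp only: left_diff_distrib diff_eq_eq add.commute)
      qed
      then have "T (mtrace (b * x)) = T (mtrace (b' * x)) + T t"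
        unfolding tr[OF b(1)] tr[OF b(2)]
        using T(2)[OF mult_F[OF bF(2) divide_F[OF t(1) d(1)]] t(1)] by simp
      then show False using pair[OF x] t(2) by simp
    qed
  qed
  have surj: "\<Lambda> ` mats n n = carrier_vec N"
  proof (rule card_subset_eq[OF finite_carrier_vec])
    show "\<Lambda> ` mats n n \<subseteq> carrier_vec N" unfolding \<Lambda>_def by (intro image_subsetI vec_carrier)
    show "card (\<Lambda> ` mats n n) = card (carrier_vec N :: 'a vec set)"
      unfolding card_image[OF inj_\<Lambda>] card_carrier_vec by (rule N)
  qed
  show ?thesis
  proof (rule that[OF bij])
    fix u :: "'a vec" assume "u \<in> carrier_vec N"
    then have "u \<in> \<Lambda> ` mats n n" unfolding surj .
    then obtain b where b: "b \<in> mats n n" "u = \<Lambda> b" by (elim imageE)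
    then show "\<exists>b\<in>mats n n. \<forall>y\<in>carrier_vec N. u \<bullet> y = T (mtrace (b * \<Phi> y))"
      using \<Lambda>[OF b(1)] by (intro bexI[of _ b] ballI) simp_all
  qed
qed

end

text \<open>Each label receives the same number of elements; the fewer than CARD('a) elements left
  over stay outside I and will join the exceptional set.\<close>

lemma exists_balanced_labelling:
  assumes "finite J"
  obtains I :: "'b set" and f0 :: "'b \<Rightarrow> 'a::finite" where "I \<subseteq> J" "\<And>t. card {y \<in> I. f0 y = t} = card J div CARD('a)"
proof -
  let ?k = "card J div CARD('a)" and ?A = "(UNIV :: 'a set) \<times> {..<card J div CARD('a)}"
  have "card ?A \<le> card J" by (simp add: card_cartesian_product)
  then obtain h where h: "h ` ?A \<subseteq> J" "inj_on h ?A"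
    using card_le_inj[of ?A J] assms by auto
  define f0 where "f0 = (\<lambda>y. fst (inv_into ?A h y))"
  have f0: "f0 (h a) = fst a" if "a \<in> ?A" for a
    unfolding f0_def inv_into_f_f[OF h(2) that] ..
  have "card {y \<in> h ` ?A. f0 y = t} = ?k" for t
  proof -
    have "{y \<in> h ` ?A. f0 y = t} = h ` ({t} \<times> {..<?k})"
    proof
      show "{y \<in> h ` ?A. f0 y = t} \<subseteq> h ` ({t} \<times> {..<?k})"
      proof
        fix y assume "y \<in> {y \<in> h ` ?A. f0 y = t}"
        then obtain a where a: "a \<in> ?A" "y = h a" "f0 y = t" by blast
        then have "fst a = t" using f0[OF a(1)] by simp
        then have "a \<in> {t} \<times> {..<?k}" using a(1) by (cases a) auto
        then show "y \<in> h ` ({t} \<times> {..<?k})" using a(2) by blast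
      qed
      show "h ` ({t} \<times> {..<?k}) \<subseteq> {y \<in> h ` ?A. f0 y = t}"
      proof (rule image_subsetI)
        fix a assume "a \<in> {t} \<times> {..<?k}"
        then have "a \<in> ?A" "fst a = t" by auto
        then show "h a \<in> {y \<in> h ` ?A. f0 y = t}" using f0 by blast
      qed
    qed
    also have "card \<dots> = card ({t} \<times> {..<?k})"
      by (rule card_image, rule inj_on_subset[OF h(2)]) auto
    finally show ?thesis by (simp add: card_cartesian_product)
  qed
  then show ?thesis using that[of "h ` ?A" f0] h(1) by blast
qed

text \<open>The primitive root -p lifts from r^2 to r^N, so every unit is a power of p up to sign.
  As r is 3 modulo 4, half of totient (r^N) is an odd number f, and (-p)^f = -1 then reads p^f =
  1.\<close>

lemma minus_prime_generates_units:
  assumes p: "prime p" and r: "prime r" "[r = 3] (mod 4)" and root: "int_primroot (r ^ 2) (- int p)" and N: "N > 0"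
  shows "\<And>m. \<not> r dvd m \<Longrightarrow> \<exists>x. [m = p ^ x] (mod r ^ N) \<or> [m + p ^ x = 0] (mod r ^ N)"
    and "\<exists>f. odd f \<and> [p ^ f = 1] (mod r ^ N)"
proof -
  have r1: "r > 1" using r(1) prime_gt_1_nat by blast
  have r4: "r mod 4 = 3" using r(2) by (simp add: cong_def)
  have odd_r: "odd r" using r4 by presburger
  have r2: "\<not> r dvd 2" using r1 odd_r by (auto dest: dvd_imp_le simp: le_Suc_eq numeral_2_eq_2)
  \<comment> \<open>The two extra factors of r make g congruent to -p modulo r^2 and modulo r^N at
    once, also for N = 1.\<close>
  define M where "M = r ^ (N + 2)"
  have M0: "M > 0" unfolding M_def using r1 by simp
  define g where "g = nat (- int p mod int M)"
  have g_int: "int g = - int p mod int M" unfolding g_def using M0 by simp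
  have g_cong: "[int g = - int p] (mod int (r ^ i))" if "i \<le> N + 2" for i
  proof -
    have "[int g = - int p] (mod int M)" unfolding g_int cong_def by simp
    moreover have "int (r ^ i) dvd int M" unfolding M_def of_nat_power using that by (rule le_imp_power_dvd)
    ultimately show ?thesis by (rule cong_dvd_modulus)
  qed
  have root2: "residue_primroot (r ^ 2) g"
  proof -
    have "int (nat (- int p mod int (r ^ 2))) = - int p mod int (r ^ 2)" using r1 by simp
    then have "[int (nat (- int p mod int (r ^ 2))) = int g] (mod int (r ^ 2))"
      using g_cong[of 2] by (simp add: cong_def)
    then have "[nat (- int p mod int (r ^ 2)) = g] (mod r ^ 2)" unfolding cong_int_iff .
    then have "residue_primroot (r ^ 2) (nat (- int p mod int (r ^ 2))) = residue_primroot (r ^ 2) g"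
      by (rule residue_primroot_cong)
    then show ?thesis using root unfolding int_primroot_def by simp
  qed
  have ord2: "ord (r ^ 2) g = r * (r - 1)" and cop2: "coprime (r ^ 2) g"
    using root2 totient_prime_power[OF r(1), of 2] unfolding residue_primroot_def by auto
  have cop: "coprime r g" using cop2 by simp
  have root1: "residue_primroot r g"
  proof -
    let ?d = "ord r g"
    have gd: "[g ^ ?d = 1] (mod r)" by (rule ord)
    \<comment> \<open>If x = 1 modulo r then x^r = 1 modulo r^2, because x - 1 and the geometric sum
      with r terms are both divisible by r. Hence the order of g modulo r is not smaller than r -
      1.\<close>
    have "[(g ^ ?d) ^ r = 1] (mod r ^ 2)"
    proof -
      let ?x = "int (g ^ ?d)"
      have x1: "int r dvd ?x - 1"
        using gd by (metis cong_iff_dvd_diff cong_int_iff of_nat_1)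
      have "[(\<Sum>i<r. ?x ^ i) = (\<Sum>i<r. 1 ^ i)] (mod int r)"
        by (intro cong_sum cong_pow) (use x1 in \<open>simp add: cong_iff_dvd_diff\<close>)
      then have "int r dvd (\<Sum>i<r. ?x ^ i)" by (simp add: cong_dvd_iff)
      then have "int r * int r dvd (?x - 1) * (\<Sum>i<r. ?x ^ i)" using x1 by (intro mult_dvd_mono)
      moreover have "(?x - 1) * (\<Sum>i<r. ?x ^ i) = ?x ^ r - 1" by (rule power_diff_1_eq[symmetric])
      ultimately have "[?x ^ r = 1] (mod int (r ^ 2))" by (simp add: cong_iff_dvd_diff power2_eq_square)
      then have "[int ((g ^ ?d) ^ r) = int 1] (mod int (r ^ 2))" by simp
      then show ?thesis unfolding cong_int_iff .
    qed
    then have "r * (r - 1) dvd ?d * r" unfolding ord2[symmetric] ord_divides[symmetric] by (simp flip: power_mult)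
    then have "r - 1 dvd ?d" using r1 by (simp add: mult.commute)
    moreover have "?d dvd r - 1" using order_divides_totient[OF cop] r(1) by (simp add: totient_prime)
    ultimately have "?d = totient r" using r(1) by (simp add: totient_prime dvd_antisym)
    then show ?thesis using cop r1 unfolding residue_primroot_def by simp
  qed
  have "[g ^ (r - 1) \<noteq> 1] (mod r\<^sup>2)"
  proof
    assume "[g ^ (r - 1) = 1] (mod r\<^sup>2)"
    then have "r * (r - 1) dvd r - 1" unfolding ord2[symmetric] ord_divides .
    then have "r * (r - 1) \<le> 1 * (r - 1)" using r1 by (simp add: dvd_imp_le)
    then show False using r1 by simp
  qed
  then have rootN: "residue_primroot (r ^ N) g"
    using residue_primroot_prime_lift_iff[OF r(1) odd_r root1] N by blast
  have g_pow: "[int g ^ x = (- int p) ^ x] (mod int (r ^ N))" for x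
    by (rule cong_pow[OF g_cong]) simp
  show "\<exists>x. [m = p ^ x] (mod r ^ N) \<or> [m + p ^ x = 0] (mod r ^ N)" if m: "\<not> r dvd m" for m
  proof -
    have rN1: "r ^ N > 1" using r1 N by (rule one_less_power)
    have copm: "coprime m (r ^ N)" using prime_imp_coprime[OF r(1) m] by (metis coprime_commute coprime_power_right_iff)
    have "m mod r ^ N \<in> totatives (r ^ N)"
    proof -
      have "m mod r ^ N > 0"
      proof (rule ccontr)
        assume "\<not> m mod r ^ N > 0"
        then have "r ^ N dvd m" by (simp add: mod_eq_0_iff_dvd)
        then show False using m N by (metis dvd_power dvd_trans)
      qed
      moreover have "coprime (m mod r ^ N) (r ^ N)" using copm rN1 r1 by (subst coprime_mod_left_iff) auto
      moreover have "m mod r ^ N \<le> r ^ N" using r1 by (intro less_imp_le mod_less_divisor) simp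
      ultimately show ?thesis unfolding in_totatives_iff by blast
    qed
    then have "m mod r ^ N \<in> (\<lambda>i. g ^ i mod r ^ N) ` {..<totient (r ^ N)}"
      using residue_primroot_is_generator[OF rN1 rootN] unfolding bij_betw_def by simp
    then obtain x where "m mod r ^ N = g ^ x mod r ^ N" by blast
    then have "[int m = int g ^ x] (mod int (r ^ N))" unfolding cong_def[symmetric] by (metis cong_int_iff of_nat_power)
    then have mx: "[int m = (- int p) ^ x] (mod int (r ^ N))" using g_pow cong_trans by blast
    show ?thesis
    proof (cases "even x")
      case True
      then have "[int m = int (p ^ x)] (mod int (r ^ N))" using mx by simp
      then show ?thesis unfolding cong_int_iff by blast
    next
      case False
      then have "int (r ^ N) dvd int m - - (int p ^ x)" using mx by (simp add: cong_iff_dvd_diff)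
      then have "int (r ^ N) dvd int (m + p ^ x)" by simp
      then have "r ^ N dvd m + p ^ x" unfolding int_dvd_int_iff .
      then show ?thesis by (auto simp: cong_0_iff)
    qed
  qed
  show "\<exists>f. odd f \<and> [p ^ f = 1] (mod r ^ N)"
  proof -
    define f where "f = r ^ (N - 1) * ((r - 1) div 2)"
    have half: "(r - 1) div 2 * 2 = r - 1" "odd ((r - 1) div 2)" using r4 by presburger+
    have odd_f: "odd f" unfolding f_def using odd_r half(2) by simp
    have tot: "totient (r ^ N) = f * 2"
      unfolding f_def using totient_prime_power[OF r(1) N] half(1) by (simp add: mult.assoc)
    have f0: "f > 0" using odd_f by (cases "f = 0") auto
    let ?y = "int g ^ f"
    have "[g ^ (f * 2) = 1] (mod r ^ N)"
      unfolding ord_divides using rootN tot unfolding residue_primroot_def by simp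
    then have "[int (g ^ (f * 2)) = int 1] (mod int (r ^ N))" unfolding cong_int_iff .
    then have "int (r ^ N) dvd ?y ^ 2 - 1" by (simp add: cong_iff_dvd_diff power_mult)
    then have dvd: "int r ^ N dvd (?y - 1) * (?y + 1)" by (simp add: power2_eq_square algebra_simps)
    have not1: "\<not> int r ^ N dvd ?y - 1"
    proof
      assume "int r ^ N dvd ?y - 1"
      then have "[int (g ^ f) = int 1] (mod int (r ^ N))" by (simp add: cong_iff_dvd_diff)
      then have "[g ^ f = 1] (mod r ^ N)" unfolding cong_int_iff .
      then have "f * 2 dvd f" unfolding ord_divides using rootN tot unfolding residue_primroot_def by simp
      then show False using f0 by (auto dest: dvd_imp_le)
    qed
    \<comment> \<open>As r is odd it divides only one of ?y - 1 and ?y + 1, so r^N divides a single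
      factor. It cannot be ?y - 1, because g has order 2 f.\<close>
    have "int r dvd ?y - 1 \<or> int r dvd ?y + 1"
    proof -
      have "int r dvd (?y - 1) * (?y + 1)" using dvd N by (metis dvd_power dvd_trans)
      then show ?thesis using r(1) by (simp add: prime_dvd_mult_iff)
    qed
    moreover have "\<not> (int r dvd ?y - 1 \<and> int r dvd ?y + 1)"
    proof
      assume "int r dvd ?y - 1 \<and> int r dvd ?y + 1"
      then have "int r dvd (?y + 1) - (?y - 1)" using dvd_diff by blast
      then have "int r dvd int 2" by simp
      then show False using r2 unfolding int_dvd_int_iff by simp
    qed
    moreover have "\<not> int r dvd ?y - 1 \<Longrightarrow> int r ^ N dvd ?y + 1"
    proof -
      assume "\<not> int r dvd ?y - 1"
      then have "coprime (int r ^ N) (?y - 1)" using r(1) by (simp add: prime_imp_coprime)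
      then show ?thesis using dvd by (simp add: coprime_dvd_mult_right_iff)
    qed
    moreover have "\<not> int r dvd ?y + 1 \<Longrightarrow> False"
    proof -
      assume "\<not> int r dvd ?y + 1"
      then have "coprime (int r ^ N) (?y + 1)" using r(1) by (simp add: prime_imp_coprime)
      then show False using dvd not1 by (simp add: coprime_dvd_mult_left_iff)
    qed
    ultimately have "int r ^ N dvd ?y + 1" by blast
    then have "[?y = - 1] (mod int (r ^ N))" by (simp add: cong_iff_dvd_diff)
    then have "[(- int p) ^ f = - 1] (mod int (r ^ N))" using g_pow[of f] by (meson cong_sym cong_trans)
    then have "[- (int p ^ f) = - 1] (mod int (r ^ N))" using odd_f by simp
    then have "[int (p ^ f) = int 1] (mod int (r ^ N))" by (simp add: cong_minus_minus_iff)
    then have "[p ^ f = 1] (mod r ^ N)" unfolding cong_int_iff .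
    then show ?thesis using odd_f by blast
  qed
qed

section \<open>Functions in odd dimension\<close>

text \<open>At b = 0 the class sums are the class sizes, and all of them are within s \<delta> of
  the same C. No class therefore exceeds the average by more than 2 s \<delta>.\<close>

lemma (in finite_subfield_char) class_card_le:
  assumes v: "v > 0" and n: "n > 0" and \<theta>0: "\<theta> 0 = 0"
    and cls: "\<And>b. b \<in> mats n n \<Longrightarrow> \<exists>C. \<forall>y\<in>roots_unity v.
        norm ((\<Sum>x | x \<in> mats n n \<and> \<theta> (det x) = y. \<psi> (mtrace (b * x))) -
          (C - (if det b \<noteq> 0 \<and> y * \<theta> (det b) = 1 then of_real s else 0))) \<le> s * \<delta>"
    and y: "y \<in> roots_unity v"
  shows "real (card {x \<in> mats n n. \<theta> (det x) = y}) \<le> real (card (mats n n)) / real v + 2 * (s * \<delta>)"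
proof -
  define c where "c = (\<lambda>y. real (card {x \<in> mats n n. \<theta> (det x) = y}))"
  have "det (0\<^sub>m n n :: 'k mat) = 0"
  proof -
    have "0\<^sub>m n n = (0 :: 'k) \<cdot>\<^sub>m 1\<^sub>m n" by (rule eq_matI) auto
    then show ?thesis using n by (simp add: det_smult power_0_left)
  qed
  moreover have "\<psi> (mtrace (0\<^sub>m n n * x)) = 1" if "x \<in> mats n n" for x
    using mats_carrier[OF that] psi_0 by (simp add: mtrace_def)
  then have "(\<Sum>x | x \<in> mats n n \<and> \<theta> (det x) = z. \<psi> (mtrace (0\<^sub>m n n * x))) = of_real (c z)" for z
    unfolding c_def by simp
  moreover obtain C where "\<forall>y\<in>roots_unity v. norm ((\<Sum>x | x \<in> mats n n \<and> \<theta> (det x) = y. \<psi> (mtrace (0\<^sub>m n n * x))) -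
      (C - (if det (0\<^sub>m n n :: 'k mat) \<noteq> 0 \<and> y * \<theta> (det (0\<^sub>m n n)) = 1 then of_real s else 0))) \<le> s * \<delta>"
    using cls[OF zero_mats] by blast
  ultimately have C: "norm (complex_of_real (c z) - C) \<le> s * \<delta>" if "z \<in> roots_unity v" for z
    using that by simp
  have near: "c y - 2 * (s * \<delta>) \<le> c z" if "z \<in> roots_unity v" for z
  proof -
    have "\<bar>c y - c z\<bar> = norm (complex_of_real (c y - c z))" by (simp only: norm_of_real)
    also have "\<dots> = norm ((of_real (c y) - C) - (of_real (c z) - C))" by simp
    also have "\<dots> \<le> s * \<delta> + s * \<delta>"
      using norm_triangle_ineq4[of "of_real (c y) - C" "of_real (c z) - C"] C[OF y] C[OF that] by linarith
    finally show ?thesis by linarith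
  qed
  have finY: "finite (roots_unity v)" using finite_roots_unity'[OF v] .
  have "real v * (c y - 2 * (s * \<delta>)) = (\<Sum>z\<in>roots_unity v. c y - 2 * (s * \<delta>))"
    by (simp add: card_roots_unity_eq[OF v])
  also have "\<dots> \<le> (\<Sum>z\<in>roots_unity v. c z)" by (rule sum_mono[OF near])
  also have "\<dots> = real (card (\<Union>z\<in>roots_unity v. {x \<in> mats n n. \<theta> (det x) = z}))"
    unfolding c_def of_nat_sum[symmetric]
    by (subst card_UN_disjoint) (use finY finite_mats in auto)
  also have "\<dots> \<le> real (card (mats n n))"
    using card_mono[OF finite_mats, of "\<Union>z\<in>roots_unity v. {x \<in> mats n n. \<theta> (det x) = z}" n n] by auto
  finally have "c y - 2 * (s * \<delta>) \<le> real (card (mats n n)) / real v"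
    using v by (simp add: pos_le_divide_eq mult.commute)
  then show ?thesis unfolding c_def by linarith
qed

lemma odd_dimensional_core:
  fixes p k r :: nat and \<epsilon> :: real
  assumes p: "prime p" and k: "k > 0" and card_a: "CARD('a::{finite,field}) = p ^ k"
    and r: "prime r" "r \<noteq> p" "[r = 3] (mod 4)" "int_primroot (r ^ 2) (- int p)"
    and \<epsilon>: "\<epsilon> > 0"
  shows "\<exists>n R (F0 :: 'a vec \<Rightarrow> 'a). odd n \<and> R \<subseteq> carrier_vec n \<and> R \<noteq> {} \<and>
    real (card R) \<le> \<epsilon> * real CARD('a) ^ n \<and>
    (\<forall>u\<in>carrier_vec n. \<forall>c. real (card {x \<in> carrier_vec n - R. F0 x = u \<bullet> x + c}) \<le>
      card (carrier_vec n - R) / CARD('a) + (1 + \<epsilon>) * real CARD('a) powr (real n / 2 - 1))"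
proof -
  define q where "q = CARD('a)"
  have q1: "q > 1" unfolding q_def by (rule card_field_gt_1)
  have qpk: "q = p ^ k" unfolding q_def by (rule card_a)
  have p1: "p > 1" using p prime_gt_1_nat by blast
  have r1: "r > 1" using r(1) prime_gt_1_nat by blast
  have odd_r: "odd r" using r(3) unfolding cong_def by presburger
  have rp: "\<not> r dvd p" using r(1,2) p primes_dvd_imp_eq by blast
  \<comment> \<open>The singular matrices and each of the fewer than q unlabelled classes take a
    share of about 1/v of the space, so v has to exceed 2 (q + 1)/\<epsilon>.\<close>
  obtain N0 where N0: "real (q + 1) * 2 / \<epsilon> < real r ^ N0"
    using real_arch_pow[of "real r" "real (q + 1) * 2 / \<epsilon>"] r1 by auto
  define N where "N = Suc N0"
  define v where "v = r ^ N"
  have N: "N > 0" unfolding N_def by simp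
  have v1: "v > 1" unfolding v_def using r1 N by (rule one_less_power)
  have v0: "v > 0" using v1 by simp
  have v_large: "real (q + 1) * 2 \<le> \<epsilon> * real v"
  proof -
    have "r ^ N0 \<le> v" unfolding v_def N_def using r1 by simp
    then have "real r ^ N0 \<le> real v" by (metis of_nat_le_iff of_nat_power)
    then have "real (q + 1) * 2 / \<epsilon> \<le> real v" using N0 by linarith
    then show ?thesis using \<epsilon> by (simp add: pos_divide_le_eq mult.commute)
  qed
  \<comment> \<open>The surplus q in the exponent pays for the r-part of q - 1: since r^(q+1) > q -
    1, at least r^N is left in (Q - 1)/(q - 1).\<close>
  obtain f where f: "odd f" "[p ^ f = 1] (mod r ^ (N + q))"
    using minus_prime_generates_units(2)[OF p r(1,3,4), of "N + q"] N by auto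
  have f0: "f > 0" using f(1) by (cases "f = 0") auto
  define Q where "Q = q ^ f"
  have Q_pow: "Q = p ^ (k * f)" unfolding Q_def qpk by (simp add: power_mult)
  have Q1: "Q > 1" unfolding Q_def using q1 f0 by (rule one_less_power)
  define S where "S = (\<Sum>j<f. q ^ j)"
  have S: "(q - 1) * S = Q - 1"
  proof -
    have "(int q - 1) * (\<Sum>j<f. int q ^ j) = int q ^ f - 1" by (rule power_diff_1_eq[symmetric])
    then have "int ((q - 1) * S) = int (Q - 1)" using q1 Q1 unfolding S_def Q_def by (simp add: of_nat_diff)
    then show ?thesis unfolding of_nat_eq_iff .
  qed
  have vS: "v dvd S"
  proof -
    have "[(p ^ f) ^ k = 1 ^ k] (mod r ^ (N + q))" by (rule cong_pow[OF f(2)])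
    then have "[Q = 1] (mod r ^ (N + q))" unfolding Q_pow by (simp add: power_mult[symmetric] mult.commute)
    then have "r ^ (N + q) dvd Q - 1" using Q1 by (simp add: cong_altdef_nat)
    then have "r ^ (N + q) dvd S * (q - 1)" unfolding S[symmetric] by (simp add: mult.commute)
    moreover have "N + (q + 1) = Suc (N + q)" by simp
    ultimately have "r ^ N dvd S \<or> r ^ (q + 1) dvd q - 1"
      using prime_elem_power_dvd_cases[of r "N + q" S "q - 1" N "q + 1"] r(1) by auto
    moreover have "\<not> r ^ (q + 1) dvd q - 1"
    proof
      assume "r ^ (q + 1) dvd q - 1"
      then have "r ^ (q + 1) \<le> q - 1" using q1 by (intro dvd_imp_le) auto
      moreover have "q + 1 < r ^ (q + 1)" using power_gt_expt[of r "q + 1"] r1 by simp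
      ultimately show False by simp
    qed
    ultimately show ?thesis unfolding v_def by blast
  qed
  have vQ: "v dvd Q - 1" unfolding S[symmetric] using vS by simp
  have div_v: "(Q - 1) div v = (q - 1) * (S div v)" unfolding S[symmetric] using vS by (simp add: div_mult_swap)
  have Qv: "v \<le> Q - 1" using vQ Q1 by (intro dvd_imp_le) auto
  have charK: "CHAR('a alg_closure) = p" using CHAR_finite_field[OF p card_a] by simp
  have prK: "prime CHAR('a alg_closure)" using p charK by simp
  define F where "F = {x :: 'a alg_closure. x ^ Q = x}"
  have kf: "k * f > 0" using k f0 by simp
  have F_sub: "finite_subfield F" and F_card: "card F = Q"
    using finite_subfield_frobenius[OF p charK kf] unfolding F_def Q_pow by simp_all
  interpret finite_subfield F by (rule F_sub)
  have emb_q: "(to_ac a :: 'a alg_closure) ^ q = to_ac a" for a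
    unfolding q_def to_ac_power[symmetric] power_card_eq_same ..
  have emb_qj: "(to_ac a :: 'a alg_closure) ^ (q ^ j) = to_ac a" for a j
  proof (induction j)
    case (Suc j)
    then show ?case using emb_q[of a] by (simp add: power_mult mult.commute[of q])
  qed simp
  have emb_F: "(to_ac a :: 'a alg_closure) \<in> F" for a unfolding F_def Q_def using emb_qj by simp
  \<comment> \<open>By counting, the q-th power map fixes exactly the image of the small field, so
    the trace can be pulled back along the embedding.\<close>
  have base: "{x :: 'a alg_closure. x ^ q = x} = range to_ac"
  proof (rule sym, rule card_seteq)
    show "finite {x :: 'a alg_closure. x ^ q = x}" using card_power_eq_le(2)[of 1 q] q1 by simp
    show "range to_ac \<subseteq> {x :: 'a alg_closure. x ^ q = x}" using emb_q by auto
    have "card (range to_ac :: 'a alg_closure set) = q" unfolding q_def by (rule card_image[OF inj_to_ac])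
    then show "card {x :: 'a alg_closure. x ^ q = x} \<le> card (range to_ac :: 'a alg_closure set)"
      using card_power_eq_le(1)[of 1 q, where 'k = "'a alg_closure"] q1 by simp
  qed
  define T where "T = (\<lambda>x :: 'a alg_closure. of_ac (power_sum_trace q f x))"
  have q_char: "q = CHAR('a alg_closure) ^ k" unfolding charK by (rule qpk)
  have T_ac: "to_ac (T x) = power_sum_trace q f x" if "x \<in> F" for x
  proof -
    have "power_sum_trace q f x ^ q = power_sum_trace q f x"
      by (rule power_sum_trace_power(2)[OF prK q_char _ refl]) (use that in \<open>simp add: F_def Q_def\<close>)
    then have "power_sum_trace q f x \<in> range to_ac" unfolding base[symmetric] by simp
    then show ?thesis unfolding T_def by (rule to_ac_of_ac)
  qed
  have T_scale: "T (to_ac a * x) = a * T x" if "x \<in> F" for a x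
  proof -
    have "to_ac (T (to_ac a * x)) = power_sum_trace q f (to_ac a * x)" by (rule T_ac[OF mult_F[OF emb_F that]])
    also have "\<dots> = to_ac a * power_sum_trace q f x"
      unfolding power_sum_trace_def by (simp add: power_mult_distrib emb_qj sum_distrib_left)
    also have "\<dots> = to_ac (a * T x)" using T_ac[OF that] by simp
    finally show ?thesis by (rule injD[OF inj_to_ac])
  qed
  have T_add: "T (x + y) = T x + T y" if "x \<in> F" "y \<in> F" for x y
  proof -
    have "to_ac (T (x + y)) = to_ac (T x + T y)"
      using T_ac[OF that(1)] T_ac[OF that(2)] T_ac[OF add_F[OF that]] power_sum_trace_add[OF prK q_char] by simp
    then show ?thesis by (rule injD[OF inj_to_ac])
  qed
  have T_nz: "\<exists>x\<in>F. T x \<noteq> 0"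
  proof -
    obtain x where x: "x \<in> F" "power_sum_trace q f x \<noteq> 0"
      by (rule power_sum_trace_nonzero[OF q1 f0 finite_F]) (simp_all add: F_card Q_def)
    then show ?thesis using T_ac[OF x(1)] by (intro bexI[of _ x]) auto
  qed
  obtain \<psi>0 :: "'a \<Rightarrow> complex" where \<psi>0: "finite_subfield_char UNIV \<psi>0" "\<And>t. \<psi>0 (t ^ p) = \<psi>0 t"
    using exists_frobenius_character[OF p k card_a] by blast
  interpret P: finite_subfield_char "UNIV :: 'a set" \<psi>0 by (rule \<psi>0(1))
  define \<psi> where "\<psi> = (\<lambda>x. \<psi>0 (T x))"
  have psi: "finite_subfield_char F \<psi>"
  proof
    fix x y assume xy: "x \<in> F" "y \<in> F"
    then show "\<psi> (x + y) = \<psi> x * \<psi> y" unfolding \<psi>_def by (simp add: T_add P.psi_add)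
    show "norm (\<psi> x) = 1" unfolding \<psi>_def by (rule P.psi_norm) simp
  next
    obtain t where t: "\<psi>0 t \<noteq> 1" using P.psi_nontrivial by blast
    obtain x where x: "x \<in> F" "T x \<noteq> 0" using T_nz by blast
    have eq: "T (to_ac (t / T x) * x) = t" using T_scale[OF x(1), of "t / T x"] x(2) by simp
    have "\<psi> (to_ac (t / T x) * x) \<noteq> 1" unfolding \<psi>_def eq by (rule t)
    then show "\<exists>x\<in>F. \<psi> x \<noteq> 1" using mult_F[OF emb_F x(1)] by blast
  qed
  interpret finite_subfield_char F \<psi> by (rule psi)
  have frob_F: "x ^ p \<in> F" if "x \<in> F" for x
  proof -
    have "(x ^ p) ^ Q = (x ^ Q) ^ p" by (simp only: power_mult[symmetric] mult.commute)
    then show ?thesis using that unfolding F_def by simp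
  qed
  have frob_psi: "\<psi> (x ^ p) = \<psi> x" if "x \<in> F" for x
  proof -
    have "to_ac (T (x ^ p)) = power_sum_trace q f (x ^ p)" by (rule T_ac[OF frob_F[OF that]])
    also have "\<dots> = power_sum_trace q f x ^ p"
      by (rule power_sum_trace_power(1)[OF prK, of _ 1, symmetric]) (simp add: CHAR_finite_field[OF p card_a])
    also have "\<dots> = to_ac (T x ^ p)" using T_ac[OF that] by simp
    finally have "T (x ^ p) = T x ^ p" by (rule injD[OF inj_to_ac])
    then show ?thesis unfolding \<psi>_def using \<psi>0(2) by simp
  qed
  have v_char: "of_nat v \<noteq> (0 :: 'a alg_closure)"
  proof
    assume "of_nat v = (0 :: 'a alg_closure)"
    then have "p dvd r ^ N" unfolding of_nat_eq_0_iff_char_dvd charK v_def .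
    then have "p dvd r" using p prime_dvd_power by blast
    then show False using p r(1,2) primes_dvd_imp_eq by blast
  qed
  obtain \<theta> where \<theta>: "mult_char \<theta>"
    "\<And>x. x \<in> F \<Longrightarrow> x \<noteq> 0 \<Longrightarrow> \<theta> x \<in> roots_unity v"
    "\<And>y. y \<in> roots_unity v \<Longrightarrow> \<exists>x\<in>F. x \<noteq> 0 \<and> \<theta> x = y"
    "\<And>x. x \<in> F \<Longrightarrow> x ^ ((Q - 1) div v) = 1 \<Longrightarrow> \<theta> x = 1"
    using exists_class_character[OF F_sub F_def F_card r(1) v_def N v_char vQ] by blast
  \<comment> \<open>Here v has to divide (Q - 1)/(q - 1) and not only Q - 1: the exponent (Q - 1)/v
    is then a multiple of q - 1.\<close>
  have \<theta>_emb: "\<theta> (to_ac a) = 1" if a: "a \<noteq> 0" for a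
  proof (rule \<theta>(4)[OF emb_F])
    have "a * a ^ (q - 1) = a ^ q" using q1 by (simp flip: power_Suc)
    also have "\<dots> = a * 1" unfolding q_def power_card_eq_same by simp
    finally have "a ^ (q - 1) = 1" using a by simp
    then have "a ^ ((Q - 1) div v) = 1" unfolding div_v power_mult by simp
    then show "to_ac a ^ ((Q - 1) div v) = 1" unfolding to_ac_power[symmetric] by simp
  qed
  have \<theta>_nat: "\<theta> (of_nat a) = 1" if "\<not> p dvd a" for a
  proof -
    have "(of_nat a :: 'a) \<noteq> 0" using that unfolding of_nat_eq_0_iff_char_dvd CHAR_finite_field[OF p card_a] .
    then show ?thesis using \<theta>_emb[of "of_nat a"] by simp
  qed
  have cop: "coprime p v" unfolding v_def using prime_imp_coprime[OF r(1) rp] by (metis coprime_commute coprime_power_right_iff)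
  define w where "w = (\<lambda>c. - gauss_sum (power_char \<theta> c) / of_real (sqrt (real Q)))"
  have sQ: "sqrt (real Q) > 0" using Q1 by simp
  obtain \<zeta> :: complex where \<zeta>: "\<zeta> ^ v = 1" "\<And>c. 0 < c \<Longrightarrow> c < v \<Longrightarrow> \<zeta> ^ c \<noteq> 1"
    using exists_primitive_root_unity[OF v0] by blast
  obtain g where g: "g \<in> F" "g \<noteq> 0" "\<theta> g = \<zeta>" using \<theta>(3)[of \<zeta>] \<zeta>(1) by auto
  have w_in: "w c \<in> frob_units p r v" if c: "c \<in> {1..<v}" for c
  proof -
    let ?\<theta> = "power_char \<theta> c"
    have mc: "mult_char ?\<theta>" by (rule mult_char_power_char[OF \<theta>(1)])
    have val: "?\<theta> x \<in> roots_unity v" if "x \<in> F" "x \<noteq> 0" for x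
    proof -
      have "(\<theta> x ^ c) ^ v = (\<theta> x ^ v) ^ c" by (simp only: power_mult[symmetric] mult.commute)
      then show ?thesis using \<theta>(2)[OF that] that(2) by (simp add: power_char_def)
    qed
    have nat: "?\<theta> (of_nat a) = 1" if "\<not> p dvd a" for a
    proof -
      have "(of_nat a :: 'a alg_closure) \<noteq> 0" using that unfolding of_nat_eq_0_iff_char_dvd charK .
      then show ?thesis using \<theta>_nat[OF that] by (simp add: power_char_def)
    qed
    have frob: "- gauss_sum ?\<theta> \<in> frob_sums p r v"
      by (rule gauss_sum_frob_sums[OF p charK cop v0 frob_F frob_psi mc val nat])
    have "?\<theta> g \<noteq> 1" using \<zeta>(2)[of c] c g by (simp add: power_char_def)
    then have "(norm (gauss_sum ?\<theta>))\<^sup>2 = real Q" using norm_gauss_sum[OF mc g(1,2)] F_card by simp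
    then have "norm (gauss_sum ?\<theta>) = sqrt (real Q)" by (metis norm_ge_zero real_sqrt_unique)
    then have "norm (w c) = 1" unfolding w_def using sQ by (simp add: norm_divide)
    moreover have "w c * of_real (sqrt (real p ^ (k * f))) = - gauss_sum ?\<theta>"
    proof -
      have pQ: "real p ^ (k * f) = real Q" unfolding Q_pow by simp
      show ?thesis unfolding w_def pQ using sQ by simp
    qed
    ultimately show ?thesis unfolding frob_units_def using frob by (intro CollectI conjI exI[of _ "k * f"]) simp_all
  qed
  \<comment> \<open>The factor 1/(4 q v) serves two estimates: the error q v \<delta> of the
    agreement and the share 2 q \<delta> of the exceptional set.\<close>
  define \<delta> where "\<delta> = \<epsilon> / (4 * real q * real v)"
  have \<delta>: "\<delta> > 0" unfolding \<delta>_def using \<epsilon> q1 v0 by simp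
  \<comment> \<open>An odd power f' of p is 1 modulo r, so raising p^i = -p^x to the power f' would
    give 1 = -1 modulo the odd prime r.\<close>
  have neg: "\<not> r dvd p ^ i + p ^ x" for i x
  proof
    assume dvd: "r dvd p ^ i + p ^ x"
    obtain f' where f': "odd f'" "[p ^ f' = 1] (mod r ^ 1)"
      using minus_prime_generates_units(2)[OF p r(1,3,4), of 1] by auto
    have pf: "[int p ^ f' = 1] (mod int r)" using f'(2) by (metis cong_int_iff of_nat_1 of_nat_power power_one_right)
    have "int r dvd int p ^ i - - (int p ^ x)" using dvd by (metis diff_minus_eq_add int_dvd_int_iff of_nat_add of_nat_power)
    then have "[int p ^ i = - (int p ^ x)] (mod int r)" by (simp only: cong_iff_dvd_diff)
    then have "[(int p ^ i) ^ f' = (- (int p ^ x)) ^ f'] (mod int r)" by (rule cong_pow)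
    moreover have "[(int p ^ f') ^ i = 1 ^ i] (mod int r)" "[(int p ^ f') ^ x = 1 ^ x] (mod int r)"
      by (rule cong_pow[OF pf])+
    moreover have "(int p ^ i) ^ f' = (int p ^ f') ^ i" "(- (int p ^ x)) ^ f' = - ((int p ^ f') ^ x)"
      using f'(1) by (simp_all add: power_mult[symmetric] mult.commute)
    ultimately have "[1 = - ((int p ^ f') ^ x)] (mod int r)" "[- ((int p ^ f') ^ x) = - 1] (mod int r)"
      by (simp_all add: cong_minus_minus_iff) (metis cong_sym cong_trans)
    then have "[1 = - 1] (mod int r)" by (rule cong_trans)
    then have "int r dvd int 2" by (simp add: cong_iff_dvd_diff)
    then have "r dvd 2" unfolding int_dvd_int_iff .
    then show False using r1 odd_r by (auto dest: dvd_imp_le simp: le_Suc_eq numeral_2_eq_2)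
  qed
  obtain n where n: "odd n" "\<And>c. c \<in> {1..<v} \<Longrightarrow> norm (w c ^ n - 1) < \<delta>"
  proof (rule odd_power_near_one[of "{1..<v}" w "frob_units p r v" \<delta>])
    show "norm z = 1" if "z \<in> frob_units p r v" for z using that unfolding frob_units_def by blast
    show "- 1 \<notin> frob_units p r v"
      using minus_one_not_frob_unit[OF p r(1) odd_r N v_def _ neg]
        minus_prime_generates_units(1)[OF p r(1,3,4) N] unfolding v_def by blast
  qed (use w_in frob_units_group[OF v0 cop] \<delta> that in auto)
  have n0: "n > 0" using n(1) by (cases "n = 0") auto
  define s where "s = sqrt (real Q) ^ (n * n)"
  have s0: "s \<ge> 0" unfolding s_def by simp
  have near: "norm ((- gauss_sum (power_char \<theta> c) / of_real (sqrt (real (card F)))) ^ n - 1) \<le> \<delta>" if "0 < c" "c < v" for c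
    using n(2)[of c] that unfolding w_def F_card by simp
  have cls: "\<exists>C. \<forall>y\<in>roots_unity v.
      norm ((\<Sum>x | x \<in> mats n n \<and> \<theta> (det x) = y. \<psi> (mtrace (b * x))) -
        (C - (if det b \<noteq> 0 \<and> y * \<theta> (det b) = 1 then of_real s else 0))) \<le> s * \<delta>" if b: "b \<in> mats n n" for b
    using class_sum[OF \<theta>(1) v0 \<theta>(2,3) n(1) less_imp_le[OF \<delta>] near b] unfolding s_def F_card .
  \<comment> \<open>The dimension over the small field of the space of n by n matrices over F; it is
    odd because f and n are.\<close>
  define D where "D = f * (n * n)"
  have odd_D: "odd D" unfolding D_def using f(1) n(1) by simp
  have card_D: "card (mats n n) = CARD('a) ^ D"
    unfolding card_mats F_card Q_def q_def[symmetric] D_def by (simp add: power_mult)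
  have s2: "s * s = real q ^ D"
  proof -
    have "s * s = (sqrt (real Q) * sqrt (real Q)) ^ (n * n)" unfolding s_def by (simp only: power_mult_distrib)
    then show ?thesis unfolding D_def Q_def by (simp add: power_mult)
  qed
  have s_powr: "s = real q powr (real D / 2)"
  proof -
    have "(real q powr (real D / 2))\<^sup>2 = real q ^ D"
      using q1 by (simp add: power2_eq_square powr_add[symmetric] powr_realpow)
    then show ?thesis using s0 s2 by (metis power2_eq_iff_nonneg power2_eq_square powr_ge_zero)
  qed
  obtain \<Phi> :: "'a vec \<Rightarrow> 'a alg_closure mat" where \<Phi>: "bij_betw \<Phi> (carrier_vec D) (mats n n)"
    "\<And>u. u \<in> carrier_vec D \<Longrightarrow> \<exists>b\<in>mats n n. \<forall>y\<in>carrier_vec D. u \<bullet> y = T (mtrace (b * \<Phi> y))"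
    using exists_matrix_coordinates[of to_ac T n D] emb_F T_scale T_add T_nz card_D by auto
  have finY: "finite (roots_unity v)" by (rule finite_roots_unity'[OF v0])
  obtain I and f0 :: "complex \<Rightarrow> 'a" where I: "I \<subseteq> roots_unity v" "\<And>t. card {y \<in> I. f0 y = t} = card (roots_unity v) div CARD('a)"
    using exists_balanced_labelling[OF finY] by blast
  have finI: "finite I" using I(1) finY finite_subset by blast
  define R where "R = {y \<in> carrier_vec D. \<theta> (det (\<Phi> y)) \<notin> I}"
  define F0 where "F0 = (\<lambda>y. f0 (\<theta> (det (\<Phi> y))))"
  have transfer: "card {y \<in> carrier_vec D. A (\<Phi> y)} = card {x \<in> mats n n. A x}" for A
  proof -
    have im: "mats n n = \<Phi> ` carrier_vec D" using \<Phi>(1) unfolding bij_betw_def by simp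
    have "\<Phi> ` {y \<in> carrier_vec D. A (\<Phi> y)} = {x \<in> mats n n. A x}" unfolding im by blast
    moreover have "inj_on \<Phi> {y \<in> carrier_vec D. A (\<Phi> y)}"
      by (rule inj_on_subset[OF bij_betw_imp_inj_on[OF \<Phi>(1)]]) blast
    ultimately show ?thesis using card_image[of \<Phi> "{y \<in> carrier_vec D. A (\<Phi> y)}"] by simp
  qed
  have compl: "carrier_vec D - R = {y \<in> carrier_vec D. \<theta> (det (\<Phi> y)) \<in> I}" unfolding R_def by blast
  have core: "real (card {y \<in> carrier_vec D - R. F0 y = u \<bullet> y + c}) \<le>
      real (card (carrier_vec D - R)) / real CARD('a) + (1 + \<epsilon>) * real CARD('a) powr (real D / 2 - 1)"
    if u: "u \<in> carrier_vec D" for u c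
  proof -
    obtain b where b: "b \<in> mats n n" "\<And>y. y \<in> carrier_vec D \<Longrightarrow> u \<bullet> y = T (mtrace (b * \<Phi> y))"
      using \<Phi>(2)[OF u] by blast
    have "{y \<in> carrier_vec D - R. F0 y = u \<bullet> y + c} =
        {y \<in> carrier_vec D. \<theta> (det (\<Phi> y)) \<in> I \<and> f0 (\<theta> (det (\<Phi> y))) = T (mtrace (b * \<Phi> y)) + c}"
      unfolding compl F0_def using b(2) by auto
    then have "real (card {y \<in> carrier_vec D - R. F0 y = u \<bullet> y + c}) =
        real (card {x \<in> mats n n. \<theta> (det x) \<in> I \<and> f0 (\<theta> (det x)) = T (mtrace (b * x)) + c})"
      using transfer[of "\<lambda>x. \<theta> (det x) \<in> I \<and> f0 (\<theta> (det x)) = T (mtrace (b * x)) + c"] by simp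
    also have "\<dots> \<le> real (card {x \<in> mats n n. \<theta> (det x) \<in> I}) / real CARD('a) +
        s / real CARD('a) * (1 + real CARD('a) * real v * \<delta>)"
      by (rule balanced_class_count[OF \<theta>(1) v0 cls s0 less_imp_le[OF \<delta>] \<psi>0(1) emb_F _ \<theta>_emb T_scale _ I b(1)])
        (simp_all add: \<psi>_def)
    finally have 1: "real (card {y \<in> carrier_vec D - R. F0 y = u \<bullet> y + c}) \<le>
        real (card {x \<in> mats n n. \<theta> (det x) \<in> I}) / real CARD('a) +
        s / real CARD('a) * (1 + real CARD('a) * real v * \<delta>)" .
    have 2: "card {x \<in> mats n n. \<theta> (det x) \<in> I} = card (carrier_vec D - R)"
      unfolding compl transfer[of "\<lambda>x. \<theta> (det x) \<in> I"] ..
    have 3: "s / real CARD('a) * (1 + real CARD('a) * real v * \<delta>) \<le> (1 + \<epsilon>) * real CARD('a) powr (real D / 2 - 1)"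
    proof -
      have "real q * real v * \<delta> = \<epsilon> / 4" unfolding \<delta>_def using q1 v0 by simp
      then have "1 + real q * real v * \<delta> \<le> 1 + \<epsilon>" using \<epsilon> by simp
      moreover have "s / real q = real q powr (real D / 2 - 1)"
        unfolding s_powr using q1 by (simp add: powr_diff)
      ultimately have "s / real q * (1 + real q * real v * \<delta>) \<le> real q powr (real D / 2 - 1) * (1 + \<epsilon>)"
        by (simp add: mult_left_mono)
      then show ?thesis unfolding q_def[symmetric] by (simp only: mult.commute)
    qed
    show ?thesis using 1 3 unfolding 2 by linarith
  qed
  \<comment> \<open>R corresponds to the singular matrices and the v mod q classes without label,
    none of which is much larger than average by \<open>class_card_le\<close>.\<close>
  have card_R: "real (card R) \<le> \<epsilon> * real CARD('a) ^ D"
  proof -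
    let ?X = "real (card (mats n n))"
    have X: "?X = real q ^ D" unfolding card_D q_def by simp
    let ?sing = "{x \<in> mats n n. det x = 0}" and ?J = "roots_unity v - I"
    have "card R = card {x \<in> mats n n. \<theta> (det x) \<notin> I}" unfolding R_def by (rule transfer)
    also have "\<dots> \<le> card (?sing \<union> (\<Union>y\<in>?J. {x \<in> mats n n. \<theta> (det x) = y}))"
    proof (rule card_mono)
      show "finite (?sing \<union> (\<Union>y\<in>?J. {x \<in> mats n n. \<theta> (det x) = y}))" using finite_mats finY by auto
      show "{x \<in> mats n n. \<theta> (det x) \<notin> I} \<subseteq> ?sing \<union> (\<Union>y\<in>?J. {x \<in> mats n n. \<theta> (det x) = y})"
        using \<theta>(2) det_F by fastforce
    qed
    also have "\<dots> \<le> card ?sing + (\<Sum>y\<in>?J. card {x \<in> mats n n. \<theta> (det x) = y})"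
      by (rule order_trans[OF card_Un_le add_left_mono[OF card_UN_le]]) (use finY in simp)
    finally have "real (card R) \<le> real (card ?sing + (\<Sum>y\<in>?J. card {x \<in> mats n n. \<theta> (det x) = y}))"
      unfolding of_nat_le_iff .
    then have "real (card R) \<le> real (card ?sing) + (\<Sum>y\<in>?J. real (card {x \<in> mats n n. \<theta> (det x) = y}))"
      by (simp only: of_nat_add of_nat_sum)
    also have "(\<Sum>y\<in>?J. real (card {x \<in> mats n n. \<theta> (det x) = y})) \<le> (\<Sum>y\<in>?J. ?X / real v + 2 * (s * \<delta>))"
      by (intro sum_mono class_card_le[OF v0 n0 mult_char_0[OF \<theta>(1)] cls]) auto
    also have "\<dots> = real (card ?J) * (?X / real v + 2 * (s * \<delta>))" by simp
    also have "\<dots> \<le> real q * (?X / real v + 2 * (s * \<delta>))"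
    proof (rule mult_right_mono)
      have "card I = (\<Sum>t\<in>UNIV. card {y \<in> I. f0 y = t})"
        using sum.group[OF finI, of UNIV f0 "\<lambda>_. 1 :: nat"] by simp
      also have "\<dots> = q * (v div q)" unfolding I(2) q_def by (simp add: card_roots_unity_eq[OF v0])
      finally have "card ?J = v - q * (v div q)"
        using card_Diff_subset[OF finI I(1)] card_roots_unity_eq[OF v0] by simp
      also have "\<dots> = v mod q" by (simp add: minus_mult_div_eq_mod)
      also have "\<dots> \<le> q" using q1 by (intro less_imp_le mod_less_divisor) simp
      finally show "real (card ?J) \<le> real q" by simp
    qed (use s0 \<delta> in simp)
    finally have 1: "real (card R) \<le> real (card ?sing) + real q * (?X / real v + 2 * (s * \<delta>))" by simp
    have 2: "real (card ?sing) \<le> ?X / real v"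
    proof -
      have "card ?sing * v \<le> card ?sing * (card F - 1)" using Qv F_card by simp
      also have "\<dots> \<le> card (mats n n)" unfolding card_mats by (rule card_singular_mats)
      finally have "real (card ?sing * v) \<le> ?X" unfolding of_nat_le_iff .
      then have "real (card ?sing) * real v \<le> ?X" by (simp only: of_nat_mult)
      then show ?thesis using v0 by (simp add: pos_le_divide_eq)
    qed
    have "s \<le> ?X"
    proof -
      have "1 \<le> s" unfolding s_def using Q1 by (intro one_le_power) simp
      then have "s * 1 \<le> s * s" using s0 by (intro mult_left_mono)
      then show ?thesis unfolding X s2[symmetric] by simp
    qed
    then have "2 * (s * \<delta>) \<le> 2 * (?X * \<delta>)" using \<delta> by simp
    then have "real q * (?X / real v + 2 * (s * \<delta>)) \<le> real q * (?X / real v + 2 * (?X * \<delta>))"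
      using q1 by simp
    then have "real (card R) \<le> ?X / real v + real q * (?X / real v + 2 * (?X * \<delta>))" using 1 2 by linarith
    also have "\<dots> = ?X * (real (q + 1) / real v + 2 * real q * \<delta>)" by (simp add: algebra_simps add_divide_distrib)
    also have "\<dots> \<le> ?X * \<epsilon>"
    proof (rule mult_left_mono)
      have "real (q + 1) / real v \<le> \<epsilon> / 2" using v_large v0 by (simp add: field_simps)
      moreover have "2 * real q * \<delta> \<le> \<epsilon> / 2"
      proof -
        have "2 * real q * \<delta> = \<epsilon> / 2 / real v" unfolding \<delta>_def using q1 v0 by (simp add: field_simps)
        also have "\<dots> \<le> \<epsilon> / 2 / 1" using v1 \<epsilon> by (intro divide_left_mono) auto
        finally show ?thesis by simp
      qed
      ultimately show "real (q + 1) / real v + 2 * real q * \<delta> \<le> \<epsilon>" by linarith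
    qed simp
    finally show ?thesis unfolding X q_def by (simp only: mult.commute)
  qed
  \<comment> \<open>The zero matrix is always exceptional. Nonemptiness will turn the smallness of R
    into a lower bound on the dimension.\<close>
  have "R \<noteq> {}"
  proof -
    have "0\<^sub>m n n \<in> \<Phi> ` carrier_vec D" using \<Phi>(1) zero_mats unfolding bij_betw_def by blast
    then obtain y where y: "y \<in> carrier_vec D" "\<Phi> y = 0\<^sub>m n n" by auto
    have "0\<^sub>m n n = (0 :: 'a alg_closure) \<cdot>\<^sub>m 1\<^sub>m n" by (rule eq_matI) auto
    then have "\<theta> (det (\<Phi> y)) = 0" unfolding y(2) using n0 mult_char_0[OF \<theta>(1)] by (simp add: det_smult power_0_left)
    moreover have "0 \<notin> I" using I(1) v0 by (auto simp: power_0_left)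
    ultimately have "y \<in> R" unfolding R_def using y(1) by simp
    then show ?thesis by blast
  qed
  moreover have "R \<subseteq> carrier_vec D" unfolding R_def by blast
  ultimately show ?thesis using odd_D card_R core by blast
qed

text \<open>A core function in a single odd dimension n suffices, since adding 2 m variables reaches
  the larger odd dimensions. The parameter t is fixed first, to make the loss q powr (1/2 - t)
  small, and the density e of the exceptional set is adapted to it.\<close>

lemma mu_odd_eventually_le:
  fixes p k r :: nat and \<epsilon> :: real
  assumes p: "prime p" and k: "k > 0" and card_a: "CARD('a::{finite,field}) = p ^ k"
    and r: "prime r" "r \<noteq> p" "[r = 3] (mod 4)" "int_primroot (r ^ 2) (- int p)"
    and \<epsilon>: "\<epsilon> > 0"
  shows "\<exists>n0. \<forall>n\<ge>n0. odd n \<longrightarrow> mu TYPE('a) n \<le> 1 + \<epsilon>"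
proof -
  let ?q = "real CARD('a)"
  have q1: "?q > 1" using card_field_gt_1[where 'a = 'a] by simp
  obtain t0 where t0: "2 / \<epsilon> < ?q ^ t0" using real_arch_pow[OF q1] by blast
  define t where "t = Suc t0"
  have t: "?q powr (1 / 2 - real t) \<le> \<epsilon> / 2"
  proof -
    have "?q powr (1 / 2 - real t) \<le> ?q powr (- real t0)" unfolding t_def using q1 by (intro powr_mono) auto
    also have "\<dots> = 1 / ?q ^ t0" using q1 by (simp add: powr_minus powr_realpow divide_inverse)
    also have "\<dots> \<le> \<epsilon> / 2" using t0 \<epsilon> q1 by (simp add: field_simps)
    finally show ?thesis .
  qed
  \<comment> \<open>The second bound makes R at most q^(n - 1 - 2 t), which is what the choice of s
    below requires.\<close>
  define e where "e = min (\<epsilon> / 2) (1 / ?q ^ (1 + 2 * t))"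
  have e: "e > 0" "e \<le> \<epsilon> / 2" "e \<le> 1 / ?q ^ (1 + 2 * t)" unfolding e_def using \<epsilon> q1 by auto
  obtain n R and F0 :: "'a vec \<Rightarrow> 'a" where core: "odd n" "R \<subseteq> carrier_vec n" "R \<noteq> {}"
    "real (card R) \<le> e * ?q ^ n"
    "\<And>u c. u \<in> carrier_vec n \<Longrightarrow> real (card {x \<in> carrier_vec n - R. F0 x = u \<bullet> x + c}) \<le>
      card (carrier_vec n - R) / CARD('a) + (1 + e) * ?q powr (real n / 2 - 1)"
    using odd_dimensional_core[OF p k card_a r e(1)] by blast
  have finR: "finite R" using core(2) finite_carrier_vec finite_subset by blast
  have R_le: "real (card R) * ?q ^ (1 + 2 * t) \<le> ?q ^ n"
  proof -
    have "real (card R) * ?q ^ (1 + 2 * t) \<le> (e * ?q ^ n) * ?q ^ (1 + 2 * t)"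
      using core(4) q1 by (intro mult_right_mono) auto
    also have "\<dots> \<le> (1 / ?q ^ (1 + 2 * t) * ?q ^ n) * ?q ^ (1 + 2 * t)"
      using e(3) q1 by (intro mult_right_mono) auto
    also have "\<dots> = ?q ^ n" using q1 by simp
    finally show ?thesis .
  qed
  \<comment> \<open>R has an element, so a density of at most 1/q^(1 + 2 t) forces q^n \<ge> q^(1 +
    2 t).\<close>
  have nt: "1 + 2 * t \<le> n"
  proof (rule ccontr)
    assume "\<not> 1 + 2 * t \<le> n"
    then have "?q ^ n < ?q ^ (1 + 2 * t)" using q1 by (intro power_strict_increasing) auto
    also have "\<dots> = 1 * ?q ^ (1 + 2 * t)" by simp
    also have "\<dots> \<le> real (card R) * ?q ^ (1 + 2 * t)"
      using finR core(3) q1 card_gt_0_iff[of R] by (intro mult_right_mono) (auto simp: Suc_le_eq)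
    finally show False using R_le by simp
  qed
  obtain h where h: "n = 2 * h + 1" using core(1) by (elim oddE)
  have th: "t \<le> h" using nt h by simp
  show ?thesis
  \<comment> \<open>From 3 n on, the number m of added pairs of variables is at least n, which
    guarantees s \<le> 2 m.\<close>
  proof (intro exI[of _ "3 * n"] allI impI)
    fix n' assume n': "3 * n \<le> n'" "odd n'"
    then obtain m where m: "n' = n + (m + m)"
    proof -
      have "even (n' - n)" using n'(2) core(1) by simp
      then obtain m where "n' - n = 2 * m" by blast
      then show ?thesis using n'(1) that[of m] by simp
    qed
    have mn: "n \<le> m" using n'(1) m by simp
    \<comment> \<open>With n = 2 h + 1 the set R has at most q^(2 h - 2 t) elements, and this is the
      least s for which the bound q^s on |R| q^(2 m - s) follows: 2 h - 2 t + m - h + t = m + h -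
      t.\<close>
    define s where "s = m + (h - t)"
    have s: "s \<le> m + m" unfolding s_def using mn h by simp
    have card_s: "card R * CARD('a) ^ (m + m - s) \<le> CARD('a) ^ s"
    proof -
      have eq: "m + m - s + n = s + (1 + 2 * t)" unfolding s_def using mn h th by simp
      have "(real (card R) * ?q ^ (m + m - s)) * ?q ^ (1 + 2 * t) = (real (card R) * ?q ^ (1 + 2 * t)) * ?q ^ (m + m - s)"
        by simp
      also have "\<dots> \<le> ?q ^ n * ?q ^ (m + m - s)" using R_le q1 by (intro mult_right_mono) auto
      also have "\<dots> = ?q ^ s * ?q ^ (1 + 2 * t)" unfolding power_add[symmetric] using eq by (simp add: add.commute)
      finally have "real (card R) * ?q ^ (m + m - s) \<le> ?q ^ s"
        using q1 by (simp only: mult_le_cancel_right_pos zero_less_power)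
      then have "real (card R * CARD('a) ^ (m + m - s)) \<le> real (CARD('a) ^ s)" by simp
      then show ?thesis unfolding of_nat_le_iff .
    qed
    have "mu TYPE('a) (n + (m + m)) \<le> (1 + e) + ?q powr (real s - real m - real n / 2 + 1)"
      by (rule mu_le_of_core[OF core(5) core(2) s card_s]) (use h in auto)
    also have "real s - real m - real n / 2 + 1 = 1 / 2 - real t"
    proof -
      have "real s = real m + (real h - real t)" unfolding s_def using th by (simp add: of_nat_diff)
      moreover have "real n / 2 = real h + 1 / 2" unfolding h by (simp add: add_divide_distrib)
      ultimately show ?thesis by linarith
    qed
    finally show "mu TYPE('a) n' \<le> 1 + \<epsilon>" unfolding m using t e(2) by linarith
  qed
qed

theorem theorem1p1:
  fixes p q r k :: nat
  assumes "prime p" and "k > 0" and "q = p ^ k"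
    and "CARD('a::{finite,field}) = q"
    and "prime r" and "r > 3" and "r \<noteq> p"
    and "[r = 3] (mod 4)"
    and "int_primroot (r ^ 2) (- int p)"
  shows "mu TYPE('a) \<longlonglongrightarrow> 1"
proof (rule LIMSEQ_I)
  fix \<epsilon> :: real assume \<epsilon>: "\<epsilon> > 0"
  let ?q = "real CARD('a)"
  have q1: "?q > 1" using card_field_gt_1[where 'a = 'a] by simp
  obtain n1 where n1: "\<And>n. n \<ge> n1 \<Longrightarrow> odd n \<Longrightarrow> mu TYPE('a) n \<le> 1 + \<epsilon> / 2"
    using mu_odd_eventually_le[OF assms(1,2) _ assms(5,7,8,9), of "\<epsilon> / 2", where 'a = 'a] assms(3,4) \<epsilon> by auto
  obtain m0 where m0: "2 / \<epsilon> < ?q ^ m0" using real_arch_pow[OF q1] by blast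
  show "\<exists>no. \<forall>n\<ge>no. norm (mu TYPE('a) n - 1) < \<epsilon>"
  proof (intro exI[of _ "n1 + 2 * m0 + 2"] allI impI)
    fix n assume n: "n1 + 2 * m0 + 2 \<le> n"
    have ge: "mu TYPE('a) n \<ge> 1" using n by (intro mu_ge_1) simp
    have "mu TYPE('a) n \<le> 1 + \<epsilon> / 2"
    proof (cases "odd n")
      case True
      then show ?thesis using n1 n by simp
    next
      case False
      then obtain h where h: "n = 2 * h" by blast
      \<comment> \<open>The construction in even dimension starts from a plane, so n = 2 + 2
        m.\<close>
      define m where "m = h - 1"
      have m: "n = 2 + (m + m)" "m0 \<le> m" unfolding m_def using n h by auto
      have "?q powr (- real m) = 1 / ?q ^ m" using q1 by (simp add: powr_minus powr_realpow divide_inverse)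
      also have "\<dots> \<le> 1 / ?q ^ m0" using q1 m(2) by (intro divide_left_mono power_increasing) auto
      also have "\<dots> \<le> \<epsilon> / 2" using m0 \<epsilon> q1 by (simp add: field_simps)
      finally show ?thesis using mu_even_le[of m, where 'a = 'a] unfolding m(1) by linarith
    qed
    then show "norm (mu TYPE('a) n - 1) < \<epsilon>" using ge \<epsilon> by (simp add: abs_if)
  qed
qed

end
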